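(* Let $D$, $\Delta$, $m=m(n)$ and $\chi$ be as described in the context. Let $F$ be a strictly balanced $(k,\ell)$-multigraph with $\mathfrak{a}$ automorphisms. Assume that $m$ goes to infinity with $n$ in such a way that $$\frac{1}{\mathfrak{a}}\,\frac{n^k}{(2m)^{\ell}}\,\frac{\chi^{2\ell}}{\Delta(\chi)^k}\prod_{v\in V(F)}\Delta^{(\deg(v))}(\chi)$$ has a positive limit, denoted by $\lambda$, where $\Delta^{(s)}$ denotes the $s$-th derivative of $\Delta$ and $\deg(v)$ the degree of $v$ in $F$. Then the number $G[F]$ of $F$-subgraphs in a uniformly random $(n,m,D)$-multigraph $G$ follows a Poisson limit law of parameter $\lambda$, i.e. for every nonnegative integer $t$, $$\lim_{n\to\infty}\mathbb{P}(G[F]=t)=\frac{\lambda^t}{t!}e^{-\lambda}.$$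
   Context: A multigraph $G=(V(G),E(G))$ has a finite set of labeled vertices and a finite set of labeled oriented edges; each edge is an oriented pair of vertices, and loops and multiple edges are allowed. An $(n,m)$-multigraph has $n$ vertices labeled $1,\dots,n$ and $m$ edges labeled $1,\dots,m$. The degree of a vertex is the number of half-edges at it (a loop contributes $2$). A sub-multigraph of $G$ consists of a subset of the vertices and a subset of the edges (keeping labels and orientations) whose endpoints lie in the chosen vertex subset. Two multigraphs are isomorphic if there are bijections between their vertex sets and between their edge sets that preserve incidence; edge orientations and labels are disregarded. An $F$-subgraph of $G$ is a sub-multigraph of $G$ isomorphic to $F$, and $G[F]$ is the number of $F$-subgraphs of $G$. Automorphisms of a $(k,\ell)$-multigraph $F$ act both on vertices and on edges: $\mathfrak{a}$ is the number of triples (permutation of the $k$ vertex labels, permutation of the $\ell$ edge labels, choice of a subset of edges whose orientation is reversed) that leave $F$ unchanged. Equivalently, the number of $(k,\ell)$-multigraphs isomorphic to $F$ is $2^{\ell}\,\ell!\,k!/\mathfrak{a}$ (so, e.g., a cycle of length $j\ge 1$ has $2j$ automorphisms, a single loop being the cycle of length $1$ and a double edge the cycle of length $2$). The density of a multigraph (with at least one vertex) is the ratio of its number of edges to its number of vertices. A multigraph is strictly balanced if its density is larger than the density of each of its strict sub-multigraphs. $D$ is a set of nonnegative integers containing at least two elements, with $\gcd(d-\min(D)\mid d\in D)=1$ ($\max(D)=+\infty$ if $D$ is infinite). An $(n,m,D)$-multigraph is an $(n,m)$-multigraph all of whose vertices have degree in $D$. It is assumed that $m=m(n)$ goes to infinity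 with $n$ in such a way that $2m/n$ has a limit in the open interval $]\min(D),\max(D)[$. Put $\Delta(x)=\sum_{d\in D}\frac{x^d}{d!}$, and let $\chi=\chi_{m/n}$ be the unique positive solution of $\frac{\chi\Delta'(\chi)}{\Delta(\chi)}=\frac{2m}{n}$. *)

theory Defs
  imports "HOL-Probability.Probability" "Graph_Theory.Digraph_Component"
begin

text \<open>
  Multigraphs are digraphs of the type \<open>pre_digraph\<close>, which allows loops and multiple edges;
  an edge is an arc, oriented from its tail to its head. Sub-multigraphs are given by the library's
  \<open>subgraph\<close>: it requires the tail and head functions to coincide everywhere, so a sub-multigraph
  is determined by its vertex set and its edge set.
\<close>

text \<open>
  The extensional function space makes tail and head canonical outside the set of edge labels, so
  that each multigraph is represented by exactly one element of this finite set.
\<close>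

definition multigraphs :: "nat \<Rightarrow> nat \<Rightarrow> (nat, nat) pre_digraph set" where
  "multigraphs n m = {G. verts G = {1..n} \<and> arcs G = {1..m} \<and>
     tail G \<in> {1..m} \<rightarrow>\<^sub>E {1..n} \<and> head G \<in> {1..m} \<rightarrow>\<^sub>E {1..n}}"

definition vdeg :: "('a, 'b) pre_digraph \<Rightarrow> 'a \<Rightarrow> nat" where
  "vdeg G v = in_degree G v + out_degree G v"

definition multigraphs_deg_in :: "nat \<Rightarrow> nat \<Rightarrow> nat set \<Rightarrow> (nat, nat) pre_digraph set" where
  "multigraphs_deg_in n m D = {G \<in> multigraphs n m. \<forall>v\<in>verts G. vdeg G v \<in> D}"

text \<open>Comparing the sets of endpoints disregards orientation; a loop has a singleton set.\<close>

definition multigraph_iso :: "('a, 'b) pre_digraph \<Rightarrow> ('c, 'd) pre_digraph \<Rightarrow> bool" where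
  "multigraph_iso G H \<longleftrightarrow> (\<exists>f g. bij_betw f (verts G) (verts H) \<and> bij_betw g (arcs G) (arcs H) \<and>
     (\<forall>e\<in>arcs G. {tail H (g e), head H (g e)} = {f (tail G e), f (head G e)}))"

definition subgraph_count :: "('a, 'b) pre_digraph \<Rightarrow> ('c, 'd) pre_digraph \<Rightarrow> nat" where
  "subgraph_count F G = card {H. subgraph H G \<and> multigraph_iso H F}"

text \<open>
  In a triple \<open>(\<sigma>, \<tau>, R)\<close>, the vertices are relabeled by \<open>\<sigma>\<close>, the edges by \<open>\<tau>\<close>, and the edges in
  \<open>R\<close> are reversed. For a loop, both choices of membership in \<open>R\<close> are possible, so that a single
  loop has two automorphisms.
\<close>

definition automorphism_triples ::
  "('a, 'b) pre_digraph \<Rightarrow> (('a \<Rightarrow> 'a) \<times> ('b \<Rightarrow> 'b) \<times> 'b set) set" where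
  "automorphism_triples F = {(\<sigma>, \<tau>, R). \<sigma> permutes verts F \<and> \<tau> permutes arcs F \<and> R \<subseteq> arcs F \<and>
     (\<forall>e\<in>arcs F. (tail F (\<tau> e), head F (\<tau> e)) =
        (if e \<in> R then (\<sigma> (head F e), \<sigma> (tail F e)) else (\<sigma> (tail F e), \<sigma> (head F e))))}"

definition density :: "('a, 'b) pre_digraph \<Rightarrow> real" where
  "density G = real (card (arcs G)) / real (card (verts G))"

text \<open>The density is meaningful only for multigraphs with at least one vertex.\<close>

definition strictly_balanced :: "('a, 'b) pre_digraph \<Rightarrow> bool" where
  "strictly_balanced G \<longleftrightarrow> verts G \<noteq> {} \<and>
     (\<forall>H. subgraph H G \<and> H \<noteq> G \<and> verts H \<noteq> {} \<longrightarrow> density H < density G)"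

definition Delta :: "nat set \<Rightarrow> real \<Rightarrow> real" where
  "Delta D x = (\<Sum>\<^sub>\<infinity>d\<in>D. x ^ d / fact d)"

text \<open>Here \<open>r\<close> stands for the ratio \<open>m / n\<close>.\<close>

definition chi :: "nat set \<Rightarrow> real \<Rightarrow> real" where
  "chi D r = (THE x. 0 < x \<and> x * deriv (Delta D) x / Delta D x = 2 * r)"

end

theory Submission
  imports Defs
begin

text \<open>
  Since \<open>2 m / n\<close> converges to a positive limit, the limiting expression can be positive only if
  \<open>k = l\<close>. Strict balance then means that a proper nonempty part of a copy of \<open>F\<close> has fewer edges than
  vertices, so the union of two overlapping copies has more edges than vertices.

  The number of \<open>(n, m, D)\<close>-multigraphs containing a prescribed pattern is a factorial times a
  coefficient of \<open>\<Delta>(z)^(n - v)\<close> times finitely many derivatives of \<open>\<Delta>\<close>. Writing the coefficient as a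
  Fourier integral over the circle of radius \<open>\<chi>\<close>, on which \<open>2 m / n\<close> is the mean of the tilted degree
  distribution, gives a local limit theorem; the gcd condition keeps the integrand small away
  from \<open>\<theta> = 0\<close>. Hence the expected number of embeddings of a pattern with \<open>v\<close> vertices and \<open>e\<close> edges is
  of order \<open>n^(v - e)\<close> with an explicit constant. Tuples of overlapping copies contribute nothing in
  the limit, tuples of disjoint copies give the factorial moments \<open>\<lambda>^t\<close>, and Bonferroni's inequalities
  turn these moments into the Poisson law.
\<close>

section \<open>Power series of degree sets and the saddle point\<close>

text \<open>The number of admissible multigraphs is never estimated on its own. Every expectation is
  a quotient of two coefficients in which the Gaussian constant and the factor sqrt n cancel; for
  this reason \<open>local_limit\<close> fixes its constant before the pattern is chosen. Only the
  ratio 2m/n converges, so the radius \<open>\<chi>\<close> moves with n, and the decay and Taylor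
  bounds need constants that stay bounded near the limiting radius. Random multigraphs have oriented
  edges, whereas copies of F ignore orientation. An embedding therefore also records which edges it
  reverses: each copy then comes from exactly as many embeddings as F has automorphisms, and the
  choices of reversed edges supply the powers of 2 by which n^k m^l / (2m)^(2l) falls short of n^k /
  (2m)^l. Overlaps are not classified. An overlapping tuple is charged to the union of its members,
  a sub-multigraph of bounded size with more edges than vertices; these have finitely many shapes,
  each of vanishing expectation.\<close>

definition egf :: "nat set \<Rightarrow> 'a::{banach,real_normed_field} fps" where
  "egf S = Abs_fps (\<lambda>d. if d \<in> S then 1 / fact d else 0)"

lemma fps_nth_egf [simp]: "fps_nth (egf S) d = (if d \<in> S then 1 / fact d else 0)"
  by (simp add: egf_def)

lemma norm_summable_egf: "summable (\<lambda>d. norm (fps_nth (egf S) d * z ^ d))"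
proof (rule summable_comparison_test)
  show "\<exists>N. \<forall>n\<ge>N. norm (norm (fps_nth (egf S) n * z ^ n)) \<le> norm z ^ n / fact n"
    by (auto simp: norm_mult norm_power norm_divide)
  show "summable (\<lambda>n. norm z ^ n / fact n)"
    using summable_exp[of "norm z"] by (simp add: divide_inverse mult.commute)
qed

lemma fps_conv_radius_egf [simp]: "fps_conv_radius (egf S :: 'a::{banach,real_normed_field} fps) = \<infinity>"
proof -
  have "conv_radius (fps_nth (egf S) :: nat \<Rightarrow> 'a) = \<infinity>"
    by (rule conv_radius_inftyI'') (rule summable_norm_cancel, rule norm_summable_egf)
  then show ?thesis by (simp add: fps_conv_radius_def)
qed

text \<open>Differentiation lowers every degree by one, so derivatives of \<open>Delta S\<close> are
  again functions \<open>Delta\<close> of shifted sets. Later arguments work with these sets instead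
  of derivative operators.\<close>

lemma fps_deriv_egf: "fps_deriv (egf S) = egf {d. Suc d \<in> S}"
  by (rule fps_ext) (auto simp: divide_simps simp del: of_nat_Suc)

text \<open>\<open>Delta\<close> is an unordered sum over S; absolute convergence allows reading it
  as a power series with zero coefficients outside S.\<close>

lemma Delta_sums: "(\<lambda>d. fps_nth (egf S) d * x ^ d) sums Delta S x"
proof -
  have "((\<lambda>d. fps_nth (egf S) d * x ^ d) has_sum (\<Sum>n. fps_nth (egf S) n * x ^ n)) UNIV"
    by (rule norm_summable_imp_has_sum[OF norm_summable_egf])
       (rule summable_sums, rule summable_norm_cancel, rule norm_summable_egf)
  then have "((\<lambda>d. x ^ d / fact d) has_sum (\<Sum>n. fps_nth (egf S) n * x ^ n)) S"
    by (rule has_sum_cong_neutral[THEN iffD1, rotated -1]) auto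
  then have "Delta S x = (\<Sum>n. fps_nth (egf S) n * x ^ n)"
    by (simp add: Delta_def infsumI)
  then show ?thesis
    using summable_sums[OF summable_norm_cancel[OF norm_summable_egf[of S x]]] by (simp only:)
qed

lemma Delta_eq_eval_fps: "Delta S x = eval_fps (egf S) x"
  using Delta_sums[of S x] by (simp add: eval_fps_def sums_iff)

lemma Delta_has_real_derivative:
  "(Delta S has_real_derivative Delta {d. Suc d \<in> S} x) (at x)"
proof -
  have "(eval_fps (egf S) has_real_derivative eval_fps (fps_deriv (egf S)) x) (at x)"
    by (rule has_field_derivative_eval_fps) simp
  then show ?thesis
    by (simp add: fps_deriv_egf Delta_eq_eval_fps[abs_def])
qed

lemma deriv_Delta: "deriv (Delta S) = Delta {d. Suc d \<in> S}"
  by (rule ext) (rule DERIV_imp_deriv, rule Delta_has_real_derivative)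

lemma higher_deriv_Delta: "(deriv ^^ c) (Delta S) = Delta {d. d + c \<in> S}"
  by (induction c) (simp_all add: deriv_Delta)

lemma isCont_Delta: "isCont (Delta S) x"
  by (rule DERIV_isCont) (rule Delta_has_real_derivative)

lemma tendsto_Delta: "(f \<longlongrightarrow> x) A \<Longrightarrow> ((\<lambda>n. Delta S (f n)) \<longlongrightarrow> Delta S x) A"
  by (rule isCont_tendsto_compose[OF isCont_Delta])

lemma Delta_nonneg: "0 \<le> x \<Longrightarrow> 0 \<le> Delta S x"
  by (rule sums_le[OF _ sums_zero Delta_sums]) simp

lemma Delta_ge_term:
  assumes "0 \<le> x" "d \<in> S" shows "x ^ d / fact d \<le> Delta S x"
proof -
  have "sum (\<lambda>d. fps_nth (egf S) d * x ^ d) {d} \<le> suminf (\<lambda>d. fps_nth (egf S) d * x ^ d)"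
    by (rule sum_le_suminf[OF sums_summable[OF Delta_sums]]) (use assms in auto)
  then show ?thesis using assms by (simp add: sums_unique[OF Delta_sums])
qed

lemma Delta_pos: "0 < x \<Longrightarrow> S \<noteq> {} \<Longrightarrow> 0 < Delta S x"
  using Delta_ge_term[of x _ S] by (smt (verit) divide_pos_pos ex_in_conv fact_gt_zero zero_less_power)

lemma Delta_mono: "0 \<le> x \<Longrightarrow> x \<le> y \<Longrightarrow> Delta S x \<le> Delta S y"
  by (rule sums_le[OF _ Delta_sums Delta_sums]) (auto simp: divide_right_mono power_mono)

lemma Delta_empty [simp]: "Delta {} x = 0"
  by (simp add: Delta_def)

section \<open>First moments and the mean of the tilted degree distribution\<close>

lemma sums_first_moment:
  "(\<lambda>d. of_nat d * (fps_nth (egf S) d * x ^ d)) sums (x * Delta {d. Suc d \<in> S} x)"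
proof -
  have "(\<lambda>d. x * (fps_nth (egf {d. Suc d \<in> S}) d * x ^ d)) sums (x * Delta {d. Suc d \<in> S} x)"
    by (rule sums_mult) (rule Delta_sums)
  also have "(\<lambda>d. x * (fps_nth (egf {d. Suc d \<in> S}) d * x ^ d)) = 
     (\<lambda>d. of_nat (Suc d) * (fps_nth (egf S) (Suc d) * x ^ (Suc d)))"
    by (auto simp: fun_eq_iff divide_simps simp del: of_nat_Suc)
  \<comment> \<open>The term at d = 0 carries the factor 0, so the index shift leaves no
    remainder.\<close>
  finally show ?thesis
    by (subst (asm) sums_Suc_iff) simp
qed

lemma sums_first_moment_minus:
  "(\<lambda>d. (real d - c) * (fps_nth (egf S) d * x ^ d)) sums (x * Delta {d. Suc d \<in> S} x - c * Delta S x)"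
  unfolding left_diff_distrib by (intro sums_diff sums_first_moment sums_mult Delta_sums)

text \<open>Mean of a random degree that takes the value d in D with probability proportional to x^d
  / d!. The saddle point \<open>chi\<close> inverts this function.\<close>

definition mean :: "nat set \<Rightarrow> real \<Rightarrow> real" where
  "mean D x = x * Delta {d. Suc d \<in> D} x / Delta D x"

lemma sums_centered:
  assumes "0 < x" "D \<noteq> {}"
  shows "(\<lambda>d. (real d - mean D x) * (fps_nth (egf D) d * x ^ d)) sums 0"
proof -
  have "x * Delta {d. Suc d \<in> D} x - mean D x * Delta D x = 0"
    using Delta_pos[OF assms] by (simp add: mean_def)
  then show ?thesis using sums_first_moment_minus[of "mean D x" D x] by simp
qed

text \<open>No derivative is taken: with t = y / x and \<mu> the mean at x, the sign of the mean at
  y minus \<mu> is that of a sum of weights at x times (d - \<mu>) (t^d - t^\<mu>), and these two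
  factors always have the same sign.\<close>

lemma mean_less:
  assumes D: "a \<in> D" "b \<in> D" "a \<noteq> b" and x: "0 < x" "x < y"
  shows "mean D x < mean D y"
proof -
  define \<mu> where "\<mu> = mean D x"
  define t where "t = y / x"
  have t: "t > 1" "y = t * x" using x by (auto simp: t_def)
  have Dne: "D \<noteq> {}" using D by auto
  have "y > 0" using x by simp
  \<comment> \<open>The subtracted series is a multiple of the centered one, whose sum is 0. The
    total is unchanged, but every term becomes nonnegative.\<close>
  define f where "f = (\<lambda>d. (real d - \<mu>) * (fps_nth (egf D) d * y ^ d) - t powr \<mu> * ((real d - \<mu>) * (fps_nth (egf D) d * x ^ d)))"
  have f: "f sums ((y * Delta {d. Suc d \<in> D} y - \<mu> * Delta D y) - t powr \<mu> * 0)"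
    unfolding f_def using sums_centered[OF x(1) Dne]
    by (intro sums_diff sums_mult sums_first_moment_minus) (simp add: \<mu>_def)
  have f_eq: "f d = fps_nth (egf D) d * x ^ d * ((real d - \<mu>) * (t powr real d - t powr \<mu>))" for d
    using t by (simp add: f_def powr_realpow power_mult_distrib algebra_simps)
  have pos: "(real d - \<mu>) * (t powr real d - t powr \<mu>) > 0" if "real d \<noteq> \<mu>" for d
  proof (cases "real d > \<mu>")
    case True then show ?thesis using t by (intro mult_pos_pos) auto
  next
    case False then show ?thesis using t that by (intro mult_neg_neg) auto
  qed
  have nonneg: "f d \<ge> 0" for d
    unfolding f_eq using pos[of d] x by (cases "real d = \<mu>") (auto intro!: mult_nonneg_nonneg)
  obtain c where c: "c \<in> D" "real c \<noteq> \<mu>" using D by (metis of_nat_eq_iff)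
  have "0 < f c" unfolding f_eq using c pos[of c] x by (auto intro!: mult_pos_pos)
  then have "0 < suminf f"
    using nonneg suminf_pos2[OF sums_summable[OF f]] by blast
  then have "0 < y * Delta {d. Suc d \<in> D} y - \<mu> * Delta D y"
    using sums_unique[OF f] by simp
  then have "\<mu> < mean D y"
    using Delta_pos[OF \<open>y > 0\<close> Dne] by (simp add: mean_def pos_less_divide_eq)
  then show ?thesis by (simp add: \<mu>_def)
qed

text \<open>Near 0 the least degree a dominates: for x \<le> 1 all other terms are at most of order
  x^(a+1), while \<open>Delta D x\<close> is at least x^a / a!. Hence the mean exceeds a by at most
  a constant times x.\<close>

lemma mean_below:
  assumes "a \<in> D" "real (Inf D) < L"
  shows "\<exists>x>0. mean D x < L"
proof -
  define a where "a = Inf D"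
  have aD: "a \<in> D" unfolding a_def using assms Inf_nat_def1 by blast
  have amin: "d \<in> D \<Longrightarrow> a \<le> d" for d unfolding a_def by (simp add: cInf_lower)
  have *: "mean D x - a \<le> x * (fact a * Delta D' 1)" if D': "D' = {d. Suc d \<in> D}" and x: "0 < x" "x \<le> 1" for x D'
  proof -
    have s1: "(\<lambda>d. (real d - a) * (fps_nth (egf D) d * x ^ d)) sums (x * Delta D' x - a * Delta D x)"
      unfolding D' by (rule sums_first_moment_minus)
    have s2: "(\<lambda>d. x ^ Suc a * (real d * (fps_nth (egf D) d * 1 ^ d))) sums (x ^ Suc a * (1 * Delta D' 1))"
      unfolding D' by (intro sums_mult sums_first_moment)
    have "x * Delta D' x - a * Delta D x \<le> x ^ Suc a * (1 * Delta D' 1)"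
    proof (rule sums_le[OF _ s1 s2])
      fix d
      show "(real d - real a) * (fps_nth (egf D) d * x ^ d) \<le> x ^ Suc a * (real d * (fps_nth (egf D) d * 1 ^ d))"
      proof (cases "d \<in> D \<and> d \<noteq> a")
        case True
        then have "Suc a \<le> d" using amin[of d] by auto
        then have "x ^ d \<le> x ^ Suc a" using x by (intro power_decreasing) auto
        then have "(real d - real a) * x ^ d \<le> real d * x ^ Suc a"
          using x \<open>Suc a \<le> d\<close> by (intro mult_mono) auto
        then show ?thesis using True by (simp add: divide_simps mult.commute)
      next
        case False
        then show ?thesis using x by auto
      qed
    qed
    moreover have "x ^ a / fact a \<le> Delta D x" using x aD by (intro Delta_ge_term) auto
    then have "x ^ Suc a * (1 * Delta D' 1) \<le> x * (fact a * Delta D' 1) * Delta D x"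
      using mult_left_mono[of "x ^ a / fact a" "Delta D x" "x * (fact a * Delta D' 1)"] x Delta_nonneg[of 1 D']
      by (simp add: mult_ac)
    ultimately have "x * Delta D' x \<le> (a + x * (fact a * Delta D' 1)) * Delta D x"
      by (simp add: algebra_simps)
    moreover have "0 < Delta D x" using x aD by (intro Delta_pos) auto
    ultimately have "mean D x \<le> a + x * (fact a * Delta D' 1)"
      by (simp add: mean_def D' pos_divide_le_eq)
    then show ?thesis by simp
  qed
  define C where "C = fact a * Delta {d. Suc d \<in> D} 1"
  have "C \<ge> 0" by (simp add: C_def Delta_nonneg)
  \<comment> \<open>Makes x * C smaller than L - a; the added 1 guards against C = 0.\<close>
  define x where "x = min 1 ((L - a) / (2 * (C + 1)))"
  have x: "0 < x" "x \<le> 1" using assms \<open>C \<ge> 0\<close> by (auto simp: x_def a_def)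
  have "x * C \<le> (L - a) / (2 * (C + 1)) * C"
    using \<open>C \<ge> 0\<close> by (intro mult_right_mono) (auto simp: x_def)
  also have "\<dots> = (L - a) * (C / (2 * (C + 1)))" by simp
  also have "\<dots> < (L - a) * 1"
    using \<open>C \<ge> 0\<close> assms(2) by (intro mult_strict_left_mono) (auto simp: a_def)
  finally have "mean D x < L" using *[OF refl x] by (simp add: C_def)
  then show ?thesis using x by blast
qed

text \<open>After centering at L, the terms from degree b on are positive, and for large y the
  single term at b outweighs the finitely many terms below it, which grow at most like
  y^(b-1).\<close>

lemma mean_above:
  assumes "b \<in> D" "L < real b"
  shows "\<exists>y>0. L < mean D y"
proof -
  \<comment> \<open>C bounds the terms below b once y^(b-1) is factored out, and c is the
    coefficient of y^b. The choice of y below gives C < c * y.\<close>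
  define C where "C = (\<Sum>d<b. (\<bar>L\<bar> + d))"
  define c where "c = (b - L) / fact b"
  have c: "c > 0" using assms by (simp add: c_def)
  have "C \<ge> 0" unfolding C_def by (intro sum_nonneg) auto
  define y where "y = 1 + C / c"
  have y: "y \<ge> 1" using c \<open>C \<ge> 0\<close> by (simp add: y_def)
  have s1: "(\<lambda>d. (real d - L) * (fps_nth (egf D) d * y ^ d)) sums (y * Delta {d. Suc d \<in> D} y - L * Delta D y)"
    by (rule sums_first_moment_minus)
  have "(\<Sum>d\<le>b. (real d - L) * (fps_nth (egf D) d * y ^ d)) \<le> y * Delta {d. Suc d \<in> D} y - L * Delta D y"
    unfolding sums_unique[OF s1]
    by (rule sum_le_suminf[OF sums_summable[OF s1]]) (use assms y in \<open>auto intro!: mult_nonneg_nonneg\<close>)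
  moreover have "0 < (\<Sum>d\<le>b. (real d - L) * (fps_nth (egf D) d * y ^ d))"
  proof (cases b)
    case 0
    then show ?thesis using assms by auto
  next
    case (Suc b')
    have "(\<Sum>d<b. - (\<bar>L\<bar> + d) * y ^ b') \<le> (\<Sum>d<b. (real d - L) * (fps_nth (egf D) d * y ^ d))"
    proof (rule sum_mono)
      fix d assume "d \<in> {..<b}"
      then have "y ^ d \<le> y ^ b'" using y Suc by (intro power_increasing) auto
      moreover have "fps_nth (egf D) d \<le> (1::real)" "fps_nth (egf D) d \<ge> (0::real)" by auto
      ultimately have "fps_nth (egf D) d * y ^ d \<le> 1 * y ^ b'" "0 \<le> fps_nth (egf D) d * y ^ d"
        using y by (intro mult_mono mult_nonneg_nonneg; simp del: fps_nth_egf)+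
      then have "(\<bar>L\<bar> + d) * (fps_nth (egf D) d * y ^ d) \<le> (\<bar>L\<bar> + d) * y ^ b'"
        by (intro mult_left_mono) auto
      moreover have "- (\<bar>L\<bar> + d) * (fps_nth (egf D) d * y ^ d) \<le> (real d - L) * (fps_nth (egf D) d * y ^ d)"
        using \<open>0 \<le> fps_nth (egf D) d * y ^ d\<close> by (intro mult_right_mono) (auto simp del: fps_nth_egf)
      ultimately show "- (\<bar>L\<bar> + real d) * y ^ b' \<le> (real d - L) * (fps_nth (egf D) d * y ^ d)"
        by linarith
    qed
    also have "(\<Sum>d<b. - (\<bar>L\<bar> + d) * y ^ b') = - (C * y ^ b')"
      by (simp only: C_def sum_distrib_right sum_negf[symmetric] mult_minus_left)
    finally have 1: "- (C * y ^ b') \<le> (\<Sum>d<b. (real d - L) * (fps_nth (egf D) d * y ^ d))" .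
    have "C < c * y" using c by (simp add: y_def distrib_left)
    then have "C * y ^ b' < c * y * y ^ b'" using y by (intro mult_strict_right_mono) auto
    also have "\<dots> = (real b - L) * (fps_nth (egf D) b * y ^ b)"
      using assms Suc by (simp add: c_def)
    finally show ?thesis using 1 by (simp add: lessThan_Suc_atMost[symmetric])
  qed
  ultimately have "L * Delta D y < y * Delta {d. Suc d \<in> D} y" by linarith
  moreover have "0 < Delta D y" using y assms by (intro Delta_pos) auto
  ultimately have "L < mean D y" by (simp add: mean_def pos_less_divide_eq)
  then show ?thesis using y by (intro exI[of _ y]) auto
qed

lemma isCont_mean: "0 < x \<Longrightarrow> D \<noteq> {} \<Longrightarrow> isCont (mean D) x"
  unfolding mean_def[abs_def] using Delta_pos[of x D] by (intro continuous_intros isCont_Delta) auto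

lemma mean_IVT:
  assumes D: "D \<noteq> {}" and x: "0 < x" "x \<le> y" and r: "mean D x < r" "r < mean D y"
  shows "\<exists>z. x \<le> z \<and> z \<le> y \<and> mean D z = r"
  using x r isCont_mean[OF _ D] by (intro IVT) (auto intro: less_imp_le)

lemma chi_eqI:
  assumes D: "a \<in> D" "b \<in> D" "a \<noteq> b" and z: "0 < z" "mean D z = 2 * r"
  shows "chi D r = z"
proof -
  have uniq: "y = z" if "0 < y" "mean D y = 2 * r" for y
    using mean_less[OF D, of y z] mean_less[OF D, of z y] that z by (cases y z rule: linorder_cases) auto
  show ?thesis
    unfolding chi_def deriv_Delta mean_def[symmetric] by (rule the_equality) (use z uniq in blast)+
qed

text \<open>Continuity of the inverse of a strictly increasing continuous function. If lo < x0 < hi,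
  then 2r lies strictly between the means at lo and hi for large n; the intermediate value theorem
  puts a solution between lo and hi, and uniqueness identifies it with \<open>chi\<close>.\<close>

lemma chi_tendsto:
  fixes r :: "nat \<Rightarrow> real"
  assumes D: "a \<in> D" "b \<in> D" "a \<noteq> b" and r: "(\<lambda>n. 2 * r n) \<longlonglongrightarrow> L"
    and L: "real (Inf D) < L" "\<exists>d\<in>D. L < real d"
  obtains x0 where "0 < x0" "mean D x0 = L" "(\<lambda>n. chi D (r n)) \<longlonglongrightarrow> x0"
    "\<forall>\<^sub>F n in sequentially. mean D (chi D (r n)) = 2 * r n"
proof -
  have Dne: "D \<noteq> {}" using D by auto
  obtain x where x: "x > 0" "mean D x < L" using mean_below[OF D(1) L(1)] by auto
  obtain y where y: "y > 0" "L < mean D y" using mean_above L(2) by metis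
  have "x < y" using x y mean_less[OF D, of y x] by (cases x y rule: linorder_cases) auto
  obtain x0 where x0: "x \<le> x0" "x0 \<le> y" "mean D x0 = L"
    using mean_IVT[OF Dne x(1) less_imp_le[OF \<open>x < y\<close>] x(2) y(2)] by auto
  then have x0pos: "0 < x0" using x by linarith
  have ev: "\<forall>\<^sub>F n in sequentially. lo \<le> chi D (r n) \<and> chi D (r n) \<le> hi \<and> mean D (chi D (r n)) = 2 * r n"
    if lo: "0 < lo" "lo < x0" and hi: "x0 < hi" for lo hi
  proof -
    have "mean D lo < L" "L < mean D hi" using mean_less[OF D] lo hi x0pos x0(3) by auto
    then have "\<forall>\<^sub>F n in sequentially. mean D lo < 2 * r n \<and> 2 * r n < mean D hi"
      using order_tendstoD[OF r] by (auto intro: eventually_conj)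
    then show ?thesis
    proof (eventually_elim)
      case (elim n)
      then obtain z where z: "lo \<le> z" "z \<le> hi" "mean D z = 2 * r n"
        using mean_IVT[OF Dne lo(1), of hi "2 * r n"] lo hi by auto
      then have "chi D (r n) = z" using chi_eqI[OF D, of z "r n"] lo by auto
      then show ?case using z by simp
    qed
  qed
  have "(\<lambda>n. chi D (r n)) \<longlonglongrightarrow> x0"
  proof (rule order_tendstoI)
    fix u assume u: "u < x0"
    \<comment> \<open>Taking the maximum with 0 keeps lo positive even if u is negative.\<close>
    define lo where "lo = (max u 0 + x0) / 2"
    have "0 < lo" "lo < x0" "u < lo" using u x0pos by (auto simp: lo_def)
    then show "\<forall>\<^sub>F n in sequentially. u < chi D (r n)"
      using ev[of lo "x0 + 1"] by (auto elim!: eventually_mono)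
  next
    fix u assume u: "x0 < u"
    define hi where "hi = (u + x0) / 2"
    have "x0 < hi" "hi < u" using u by (auto simp: hi_def field_simps)
    then show "\<forall>\<^sub>F n in sequentially. chi D (r n) < u"
      using ev[of "x0 / 2" hi] x0pos by (auto elim!: eventually_mono)
  qed
  moreover have "\<forall>\<^sub>F n in sequentially. mean D (chi D (r n)) = 2 * r n"
    using ev[of "x0 / 2" "x0 + 1"] x0pos by (auto elim!: eventually_mono)
  ultimately show thesis using that x0pos x0(3) by blast
qed

section \<open>Fourier inversion and decay of characteristic functions\<close>

lemma integral_cis_period:
  fixes k :: int
  shows "(LBINT \<theta>:{-pi..pi}. cis (of_int k * \<theta>)) = (if k = 0 then of_real (2 * pi) else 0)"
proof (cases "k = 0")
  case True
  then show ?thesis by (simp add: set_lebesgue_integral_def scaleR_conv_of_real)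
next
  case False
  have "(LBINT \<theta>:{-pi..pi}. cis (of_int k * \<theta>)) =
      cis (of_int k * pi) / (\<i> * of_int k) - cis (of_int k * (-pi)) / (\<i> * of_int k)"
    unfolding set_lebesgue_integral_def
  proof (rule integral_FTC_atLeastAtMost)
    fix x :: real
    have "((\<lambda>\<theta>. exp (\<i> * of_int k * of_real \<theta>) / (\<i> * of_int k)) has_vector_derivative
        exp (\<i> * of_int k * of_real x)) (at x within {-pi..pi})"
      using False
      by (intro has_vector_derivative_real_field) (auto intro!: derivative_eq_intros)
    then show "((\<lambda>\<theta>. cis (of_int k * \<theta>) / (\<i> * of_int k)) has_vector_derivative cis (of_int k * x)) (at x within {-pi..pi})"
      by (simp add: cis_conv_exp mult_ac)
  next
    show "continuous_on {-pi..pi} (\<lambda>x. cis (of_int k * x))"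
      unfolding cis_conv_exp by (intro continuous_intros)
  qed simp
  also have "cis (of_int k * pi) = cis (of_int k * (-pi))"
    by (rule complex_eqI) (auto simp: sin_integer_2pi mult.commute sin_times_pi_eq_0)
  finally show ?thesis using False by simp
qed

lemma cis_integer_mult_diff: "cis \<theta> ^ d * cis (- (real N * \<theta>)) = cis (of_int (int d - int N) * \<theta>)"
  unfolding Complex.DeMoivre cis_mult by (simp add: left_diff_distrib)

text \<open>Cauchy's coefficient formula on the circle of radius x, obtained by integrating the
  absolutely convergent series term by term. The power of x stays on the right, so no division by x
  occurs.\<close>

lemma fps_nth_eq_integral:
  fixes P :: "complex fps"
  assumes P: "fps_conv_radius P = \<infinity>" and x: "0 \<le> x"
  shows "(LBINT \<theta>:{-pi..pi}. eval_fps P (of_real x * cis \<theta>) * cis (- (real N * \<theta>)))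
    = of_real (2 * pi * x ^ N) * fps_nth P N"
proof -
  define f where "f = (\<lambda>d \<theta>. indicator {-pi..pi} \<theta> *\<^sub>R
    (fps_nth P d * of_real (x ^ d) * cis (of_int (int d - int N) * \<theta>)))"
  have sums: "(\<lambda>d. f d \<theta>) sums (indicator {-pi..pi} \<theta> *\<^sub>R (eval_fps P (of_real x * cis \<theta>) * cis (- (real N * \<theta>))))" for \<theta>
  proof -
    have "(\<lambda>d. fps_nth P d * (of_real x * cis \<theta>) ^ d) sums eval_fps P (of_real x * cis \<theta>)"
      by (rule sums_eval_fps) (simp add: P)
    then have "(\<lambda>d. indicator {-pi..pi} \<theta> *\<^sub>R (fps_nth P d * (of_real x * cis \<theta>) ^ d * cis (- (real N * \<theta>)))) sums 
       (indicator {-pi..pi} \<theta> *\<^sub>R (eval_fps P (of_real x * cis \<theta>) * cis (- (real N * \<theta>))))"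
      by (intro sums_scaleR_right sums_mult2)
    then show ?thesis
      unfolding f_def power_mult_distrib cis_integer_mult_diff[symmetric] of_real_power by (simp only: mult.assoc)
  qed
  have integ: "integrable lborel (f d)" for d
    unfolding f_def cis_conv_exp set_integrable_def[symmetric]
    by (rule borel_integrable_atLeastAtMost') (intro continuous_intros)
  have norm_f: "norm (f d \<theta>) = indicator {-pi..pi} \<theta> * (norm (fps_nth P d) * x ^ d)" for d \<theta>
    using x by (simp add: f_def norm_mult norm_power)
  have summ: "summable (\<lambda>d. norm (fps_nth P d) * x ^ d)"
    using norm_summable_fps[of "of_real x" P] x by (simp add: P norm_mult norm_power)
  have "(\<lambda>d. integral\<^sup>L lborel (f d)) sums (\<integral>\<theta>. (\<Sum>d. f d \<theta>) \<partial>lborel)"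
  proof (rule sums_integral)
    show "AE \<theta> in lborel. summable (\<lambda>d. norm (f d \<theta>))"
      unfolding norm_f by (intro AE_I2 summable_mult summ)
    show "summable (\<lambda>d. \<integral>\<theta>. norm (f d \<theta>) \<partial>lborel)"
      unfolding norm_f by (simp add: summable_mult summ)
  qed (rule integ)
  also have "(\<lambda>\<theta>. \<Sum>d. f d \<theta>) = (\<lambda>\<theta>. indicator {-pi..pi} \<theta> *\<^sub>R (eval_fps P (of_real x * cis \<theta>) * cis (- (real N * \<theta>))))"
    using sums by (simp add: sums_iff)
  also have "(\<lambda>d. integral\<^sup>L lborel (f d)) = (\<lambda>d. if d = N then of_real (2 * pi * x ^ N) * fps_nth P N else 0)"
  proof
    fix d
    have "integral\<^sup>L lborel (f d) = fps_nth P d * of_real (x ^ d) * (LBINT \<theta>:{-pi..pi}. cis (of_int (int d - int N) * \<theta>))"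
      unfolding f_def set_lebesgue_integral_def mult_scaleR_right[symmetric] by (rule integral_mult_right_zero)
    then show "integral\<^sup>L lborel (f d) = (if d = N then of_real (2 * pi * x ^ N) * fps_nth P N else 0)"
      unfolding integral_cis_period by auto
  qed
  finally have "(\<lambda>d. if d = N then of_real (2 * pi * x ^ N) * fps_nth P N else 0) sums
     (LBINT \<theta>:{-pi..pi}. eval_fps P (of_real x * cis \<theta>) * cis (- (real N * \<theta>)))"
    by (simp add: set_lebesgue_integral_def)
  then show ?thesis
    using sums_single[of N "\<lambda>d. of_real (2 * pi * x ^ N) * fps_nth P N"] sums_unique2 by blast
qed

section \<open>Decay of the generating function away from the positive real axis\<close>

definition cDelta :: "nat set \<Rightarrow> complex \<Rightarrow> complex" where
  "cDelta S = eval_fps (egf S)"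

lemma cDelta_sums: "(\<lambda>d. fps_nth (egf S) d * z ^ d) sums cDelta S z"
  unfolding cDelta_def by (rule sums_eval_fps) simp

lemma cDelta_of_real: "cDelta S (of_real x) = of_real (Delta S x)"
proof -
  have "(\<lambda>d. complex_of_real (fps_nth (egf S) d * x ^ d)) sums of_real (Delta S x)"
    by (rule sums_of_real) (rule Delta_sums)
  also have "(\<lambda>d. complex_of_real (fps_nth (egf S) d * x ^ d)) = (\<lambda>d. fps_nth (egf S) d * of_real x ^ d)"
    by (auto simp: fun_eq_iff)
  finally show ?thesis using cDelta_sums sums_unique2 by blast
qed

lemma norm_cDelta_le: "0 \<le> x \<Longrightarrow> norm (cDelta S (of_real x * cis \<theta>)) \<le> Delta S x"
  unfolding sums_unique[OF cDelta_sums] sums_unique[OF Delta_sums]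
  by (rule norm_suminf_le[OF _ sums_summable[OF Delta_sums]])
     (auto simp: norm_mult norm_power norm_divide)

text \<open>Triangle inequality with an explicit gain. The squared norm is exactly (p + q)^2 - 4 p q
  s, where s is the squared sine of half the angle; adding the square of the correction term
  completes it to the square of the claimed bound.\<close>

lemma norm_cis_combination_le:
  assumes "0 < p" "0 < q"
  shows "norm (of_real p * cis \<alpha> + of_real q * cis \<beta>) \<le> p + q - 2 * p * q / (p + q) * (sin ((\<alpha> - \<beta>) / 2))\<^sup>2"
proof -
  define s where "s = (sin ((\<alpha> - \<beta>) / 2))\<^sup>2"
  have s: "0 \<le> s" "s \<le> 1" by (simp_all add: s_def abs_square_le_1)
  have "cos (\<alpha> - \<beta>) = 1 - 2 * s"
    using cos_double_sin[of "(\<alpha> - \<beta>) / 2"] unfolding s_def by (simp only: mult_2 field_sum_of_halves)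
  then have cs: "cos \<alpha> * cos \<beta> + sin \<alpha> * sin \<beta> = 1 - 2 * s"
    by (simp add: cos_diff)
  have "(norm (of_real p * cis \<alpha> + of_real q * cis \<beta>))\<^sup>2 = (p * cos \<alpha> + q * cos \<beta>)\<^sup>2 + (p * sin \<alpha> + q * sin \<beta>)\<^sup>2"
    by (simp add: cmod_power2)
  also have "\<dots> = p\<^sup>2 * ((sin \<alpha>)\<^sup>2 + (cos \<alpha>)\<^sup>2) + q\<^sup>2 * ((sin \<beta>)\<^sup>2 + (cos \<beta>)\<^sup>2) + 2 * p * q * (cos \<alpha> * cos \<beta> + sin \<alpha> * sin \<beta>)"
    by algebra
  also have "\<dots> = (p + q)\<^sup>2 - 4 * p * q * s"
    by (simp only: cs sin_cos_squared_add) (simp add: power2_eq_square algebra_simps)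
  also have "\<dots> \<le> (p + q - 2 * p * q / (p + q) * s)\<^sup>2"
  proof -
    have "(p + q - 2 * p * q / (p + q) * s)\<^sup>2 = (p + q)\<^sup>2 - 4 * p * q * s + (2 * p * q / (p + q) * s)\<^sup>2"
    proof -
      have "(p + q) * (2 * p * q / (p + q) * s) = 2 * p * q * s" using assms by simp
      then show ?thesis unfolding power2_diff by (simp only: mult.assoc)
    qed
    then show ?thesis by simp
  qed
  finally have "(norm (of_real p * cis \<alpha> + of_real q * cis \<beta>))\<^sup>2 \<le> (p + q - 2 * p * q / (p + q) * s)\<^sup>2" .
  \<comment> \<open>Passing from squares to norms requires a nonnegative bound. It is one because s
    \<le> 1 and 2 p q \<le> (p + q)^2.\<close>
  moreover have "0 \<le> p + q - 2 * p * q / (p + q) * s"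
  proof -
    have "2 * p * q / (p + q) * s \<le> 2 * p * q / (p + q) * 1"
      using assms s by (intro mult_left_mono) auto
    also have "\<dots> \<le> p + q"
      using assms by (simp add: divide_le_eq power2_eq_square[symmetric] power2_sum mult.assoc)
    finally show ?thesis by simp
  qed
  ultimately show ?thesis unfolding s_def[symmetric] by (rule power2_le_imp_le)
qed

text \<open>Isolate the two terms of degrees a and b and estimate the rest by the plain triangle
  inequality; the gain from these two vectors already bounds the defect from below.\<close>

lemma sin_squared_le_defect:
  assumes ab: "a \<in> D" "b \<in> D" and lo: "0 < lo"
  shows "\<exists>C\<ge>0. \<forall>x\<ge>lo. \<forall>\<theta>. (sin (of_int (int a - int b) * \<theta> / 2))\<^sup>2 \<le> C * (Delta D x - norm (cDelta D (of_real x * cis \<theta>)))"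
proof (cases "a = b")
  case True
  then show ?thesis by (auto intro!: exI[of _ 0])
next
  case False
  \<comment> \<open>A lower bound for both weights at every x \<ge> lo, which makes the constant
    uniform in x.\<close>
  define r where "r = min (lo ^ a / fact a) (lo ^ b / fact b)"
  have r: "r > 0" using lo by (simp add: r_def)
  show ?thesis
  proof (intro exI[of _ "1 / r"] conjI allI impI)
    fix x \<theta> :: real assume x: "lo \<le> x"
    define p q where "p = x ^ a / fact a" and "q = x ^ b / fact b"
    have "r \<le> p" "r \<le> q"
      unfolding r_def p_def q_def
      using x lo by (simp_all add: min.coboundedI1 min.coboundedI2 divide_right_mono power_mono)
    then have pq: "0 < p" "0 < q" using r by auto
    define g where "g = (\<lambda>d. fps_nth (egf D) d * (of_real x * cis \<theta>) ^ d)"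
    define h where "h = (\<lambda>d. fps_nth (egf D) d * x ^ d)"
    have ngh: "norm (g d) = h d" for d
      using lo x by (simp add: g_def h_def norm_mult norm_power norm_divide)
    have gs: "g sums cDelta D (of_real x * cis \<theta>)" and hs: "h sums Delta D x"
      unfolding g_def h_def by (rule cDelta_sums Delta_sums)+
    have g1: "(\<lambda>d. if d \<in> {a,b} then 0 else g d) sums (cDelta D (of_real x * cis \<theta>) - (g a + g b))"
    proof -
      have "(\<lambda>d. g d - (if d \<in> {a,b} then g d else 0)) sums (cDelta D (of_real x * cis \<theta>) - sum g {a,b})"
        by (intro sums_diff gs sums_If_finite_set) auto
      then show ?thesis using False by (simp add: if_distrib cong: if_cong)
    qed
    have h1: "(\<lambda>d. if d \<in> {a,b} then 0 else h d) sums (Delta D x - (h a + h b))"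
    proof -
      have "(\<lambda>d. h d - (if d \<in> {a,b} then h d else 0)) sums (Delta D x - sum h {a,b})"
        by (intro sums_diff hs sums_If_finite_set) auto
      then show ?thesis using False by (simp add: if_distrib cong: if_cong)
    qed
    have "norm (cDelta D (of_real x * cis \<theta>) - (g a + g b)) \<le> Delta D x - (h a + h b)"
      unfolding sums_unique[OF g1] sums_unique[OF h1]
      by (rule norm_suminf_le[OF _ sums_summable[OF h1]]) (auto simp: ngh)
    moreover have "h a = p" "h b = q" using ab by (auto simp: h_def p_def q_def)
    moreover have "g a = of_real p * cis (a * \<theta>)" "g b = of_real q * cis (b * \<theta>)"
      using ab by (auto simp: g_def p_def q_def power_mult_distrib Complex.DeMoivre)
    moreover have "norm (of_real p * cis (a * \<theta>) + of_real q * cis (b * \<theta>)) \<le> p + q - 2 * p * q / (p + q) * (sin ((a * \<theta> - b * \<theta>) / 2))\<^sup>2"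
      by (rule norm_cis_combination_le[OF pq])
    moreover have "norm (cDelta D (of_real x * cis \<theta>)) \<le> norm (cDelta D (of_real x * cis \<theta>) - (g a + g b)) + norm (g a + g b)"
      by (metis diff_add_cancel norm_triangle_ineq)
    ultimately have 1: "2 * p * q / (p + q) * (sin ((a * \<theta> - b * \<theta>) / 2))\<^sup>2 \<le> Delta D x - norm (cDelta D (of_real x * cis \<theta>))"
      by simp
    \<comment> \<open>The harmonic mean 2 p q / (p + q) is at least the minimum of p and q, hence at
      least r.\<close>
    have "r * (p + q) \<le> 2 * p * q"
    proof -
      have "r * q \<le> p * q" "r * p \<le> q * p" using \<open>r \<le> p\<close> \<open>r \<le> q\<close> pq by auto
      moreover have "r * (p + q) = r * p + r * q" "2 * p * q = p * q + q * p" by (simp_all add: distrib_left)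
      ultimately show ?thesis by linarith
    qed
    then have "r \<le> 2 * p * q / (p + q)" using pq by (simp add: pos_le_divide_eq)
    then have "r * (sin ((a * \<theta> - b * \<theta>) / 2))\<^sup>2 \<le> 2 * p * q / (p + q) * (sin ((a * \<theta> - b * \<theta>) / 2))\<^sup>2"
      by (intro mult_right_mono) auto
    with 1 have "r * (sin ((a * \<theta> - b * \<theta>) / 2))\<^sup>2 \<le> Delta D x - norm (cDelta D (of_real x * cis \<theta>))"
      by linarith
    then show "(sin (of_int (int a - int b) * \<theta> / 2))\<^sup>2 \<le> 1 / r * (Delta D x - norm (cDelta D (of_real x * cis \<theta>)))"
      using r by (simp add: field_simps)
  qed (use r in auto)
qed

text \<open>Subadditivity up to a factor: bounds for two frequencies combine into one for their
  difference, which turns the controlled frequencies into a group.\<close>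

lemma sin_squared_diff_le: "(sin (\<alpha> - \<beta>))\<^sup>2 \<le> 2 * (sin \<alpha>)\<^sup>2 + 2 * (sin \<beta> :: real)\<^sup>2"
proof -
  have "\<bar>sin (\<alpha> - \<beta>)\<bar> \<le> \<bar>sin \<alpha>\<bar> * \<bar>cos \<beta>\<bar> + \<bar>cos \<alpha>\<bar> * \<bar>sin \<beta>\<bar>"
    unfolding sin_diff by (metis abs_mult abs_triangle_ineq4)
  also have "\<dots> \<le> \<bar>sin \<alpha>\<bar> * 1 + 1 * \<bar>sin \<beta>\<bar>"
    by (intro add_mono mult_mono) auto
  finally have "(sin (\<alpha> - \<beta>))\<^sup>2 \<le> (\<bar>sin \<alpha>\<bar> + \<bar>sin \<beta>\<bar>)\<^sup>2"
    by (simp add: abs_le_square_iff[symmetric])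
  also have "\<dots> \<le> 2 * (sin \<alpha>)\<^sup>2 + 2 * (sin \<beta>)\<^sup>2"
    using zero_le_power2[of "\<bar>sin \<alpha>\<bar> - \<bar>sin \<beta>\<bar>"] by (simp add: power2_sum power2_diff)
  finally show ?thesis .
qed

text \<open>Bezout by division with remainder: the least positive member g of Q divides every
  element of A, since a nonzero remainder would be a smaller positive member. So g divides the
  gcd.\<close>

lemma one_in_int_subgroup:
  fixes Q :: "int set"
  assumes diff: "\<And>x y. x \<in> Q \<Longrightarrow> y \<in> Q \<Longrightarrow> x - y \<in> Q" and A: "int ` A \<subseteq> Q" and gcd: "Gcd A = (1::nat)"
  shows "1 \<in> Q"
proof -
  have "\<exists>a\<in>A. a \<noteq> 0"
  proof (rule ccontr)
    assume "\<not> (\<exists>a\<in>A. a \<noteq> 0)"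
    then have "Gcd A = 0" by (auto simp: Gcd_0_iff)
    then show False using gcd by simp
  qed
  then obtain a where a: "a \<in> A" "0 < a" by auto
  have ex: "\<exists>g. 0 < g \<and> int g \<in> Q" using a A by auto
  define g where "g = (LEAST g. 0 < g \<and> int g \<in> Q)"
  have g: "0 < g" "int g \<in> Q" using LeastI_ex[OF ex] by (auto simp: g_def)
  have gmin: "h \<ge> g" if "0 < h" "int h \<in> Q" for h
    unfolding g_def using that by (intro Least_le) auto
  have mult: "int d - int (k * g) \<in> Q" if "int d \<in> Q" for d k
  proof (induction k)
    case (Suc k)
    then have "(int d - int (k * g)) - int g \<in> Q" by (rule diff[OF _ g(2)])
    then show ?case by (simp add: algebra_simps)
  qed (use that in simp)
  have "g dvd d" if "d \<in> A" for d
  proof (rule ccontr)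
    assume "\<not> g dvd d"
    then have "0 < d mod g" by (simp add: dvd_eq_mod_eq_0)
    moreover have "int (d mod g) \<in> Q"
      using mult[of d "d div g"] A that by (auto simp: minus_div_mult_eq_mod[symmetric] of_nat_diff)
    ultimately have "g \<le> d mod g" by (rule gmin)
    then show False using g(1) mod_less_divisor[of g d] by linarith
  qed
  then have "g dvd Gcd A" by (rule Gcd_greatest)
  then show ?thesis using gcd g by simp
qed

text \<open>For |y| \<le> 2 the Taylor error |y|^3 / 6 is at most 2 |y| / 3, which leaves |y| / 3.
  The range covers y = \<theta> / 2 for |\<theta>| \<le> \<pi>.\<close>

lemma sin_squared_ge: "\<bar>y\<bar> \<le> 2 \<Longrightarrow> (y / 3)\<^sup>2 \<le> (sin y)\<^sup>2" for y :: real
proof -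
  assume y: "\<bar>y\<bar> \<le> 2"
  have "\<bar>sin y - y\<bar> \<le> \<bar>y\<bar> ^ 3 / 6"
    using Maclaurin_sin_bound[of y 3] by (simp add: numeral_3_eq_3 sin_coeff_def field_simps)
  moreover have "\<bar>y\<bar> ^ 3 \<le> \<bar>y\<bar> * 4"
    using mult_left_mono[of "\<bar>y\<bar>^2" 4 "\<bar>y\<bar>"] power_mono[OF y, of 2] by (simp add: power3_eq_cube power2_eq_square)
  ultimately have "\<bar>y / 3\<bar> \<le> \<bar>sin y\<bar>" by (simp add: abs_if split: if_splits)
  then show ?thesis by (simp only: abs_le_square_iff)
qed

text \<open>
  The integers \<open>e\<close> for which \<open>sin(e \<theta> / 2)^2\<close> is bounded by a multiple of the defect
  \<open>\<Delta>(x) - |\<Delta>(x e^(i \<theta>))|\<close> form a group containing all differences of elements of \<open>D\<close>. By the gcd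
  condition this group contains 1.
\<close>

lemma norm_cDelta_le_exp:
  assumes D: "D \<noteq> {}" and gcd: "Gcd ((\<lambda>d. d - Inf D) ` D) = 1" and lo: "0 < lo"
  shows "\<exists>c>0. \<forall>x \<theta>. lo \<le> x \<longrightarrow> x \<le> hi \<longrightarrow> \<bar>\<theta>\<bar> \<le> pi \<longrightarrow>
     norm (cDelta D (of_real x * cis \<theta>)) \<le> Delta D x * exp (- c * \<theta>\<^sup>2)"
proof -
  define Q where "Q = {e::int. \<exists>C\<ge>0. \<forall>x\<ge>lo. \<forall>\<theta>. (sin (of_int e * \<theta> / 2))\<^sup>2 \<le> C * (Delta D x - norm (cDelta D (of_real x * cis \<theta>)))}"
  have "1 \<in> Q"
  proof (rule one_in_int_subgroup[OF _ _ gcd])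
    fix e1 e2 assume "e1 \<in> Q" "e2 \<in> Q"
    then obtain C1 C2 where C: "C1 \<ge> 0" "C2 \<ge> 0"
      "\<And>x \<theta>. x\<ge>lo \<Longrightarrow> (sin (of_int e1 * \<theta> / 2))\<^sup>2 \<le> C1 * (Delta D x - norm (cDelta D (of_real x * cis \<theta>)))"
      "\<And>x \<theta>. x\<ge>lo \<Longrightarrow> (sin (of_int e2 * \<theta> / 2))\<^sup>2 \<le> C2 * (Delta D x - norm (cDelta D (of_real x * cis \<theta>)))"
      by (auto simp: Q_def)
    show "e1 - e2 \<in> Q"
      unfolding Q_def
    proof (safe intro!: exI[of _ "2 * C1 + 2 * C2"])
      fix x \<theta> :: real assume x: "lo \<le> x"
      have "(sin (of_int (e1 - e2) * \<theta> / 2))\<^sup>2 = (sin (of_int e1 * \<theta> / 2 - of_int e2 * \<theta> / 2))\<^sup>2"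
        by (simp add: algebra_simps diff_divide_distrib)
      also have "\<dots> \<le> 2 * (sin (of_int e1 * \<theta> / 2))\<^sup>2 + 2 * (sin (of_int e2 * \<theta> / 2))\<^sup>2"
        by (rule sin_squared_diff_le)
      also have "\<dots> \<le> 2 * (C1 * (Delta D x - norm (cDelta D (of_real x * cis \<theta>)))) + 2 * (C2 * (Delta D x - norm (cDelta D (of_real x * cis \<theta>))))"
        by (intro add_mono mult_left_mono C x) auto
      finally show "(sin (of_int (e1 - e2) * \<theta> / 2))\<^sup>2 \<le> (2 * C1 + 2 * C2) * (Delta D x - norm (cDelta D (of_real x * cis \<theta>)))"
        by (simp add: algebra_simps)
    qed (use C in auto)
  next
    have "int (d - Inf D) \<in> Q" if d: "d \<in> D" for d
    proof -
      have "Inf D \<in> D" "Inf D \<le> d" using D Inf_nat_def1 d by (auto intro: cInf_lower)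
      then show ?thesis
        using sin_squared_le_defect[OF d \<open>Inf D \<in> D\<close> lo] by (simp add: Q_def of_nat_diff)
    qed
    then show "int ` (\<lambda>d. d - Inf D) ` D \<subseteq> Q" by auto
  qed
  then obtain C where C: "C \<ge> 0" "\<And>x \<theta>. x\<ge>lo \<Longrightarrow> (sin (\<theta> / 2))\<^sup>2 \<le> C * (Delta D x - norm (cDelta D (of_real x * cis \<theta>)))"
    by (auto simp: Q_def)
  \<comment> \<open>36 comes from the square of \<theta> / 2 / 3, and C + 1 replaces C to keep B
    positive. The value at \<open>max lo hi\<close> bounds \<open>Delta D x\<close> on the interval
    and is positive even if the interval is empty.\<close>
  define B where "B = 36 * (C + 1) * Delta D (max lo hi)"
  have "B > 0" unfolding B_def using C lo D by (intro mult_pos_pos Delta_pos) auto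
  show ?thesis
  proof (intro exI[of _ "1 / B"] conjI allI impI)
    show "1 / B > 0" using \<open>B > 0\<close> by simp
    fix x \<theta> :: real assume x: "lo \<le> x" "x \<le> hi" and \<theta>: "\<bar>\<theta>\<bar> \<le> pi"
    define y where "y = Delta D x - norm (cDelta D (of_real x * cis \<theta>))"
    have "y \<ge> 0" using norm_cDelta_le[of x D \<theta>] x lo by (simp add: y_def)
    have "\<bar>\<theta> / 2\<bar> \<le> 2" using \<theta> pi_less_4 by auto
    then have "(\<theta> / 2 / 3)\<^sup>2 \<le> C * y" using sin_squared_ge[of "\<theta> / 2"] C(2)[OF x(1), of \<theta>] by (simp add: y_def)
    also have "\<dots> \<le> (C + 1) * y" using \<open>y \<ge> 0\<close> by (simp add: distrib_right)
    finally have "\<theta>\<^sup>2 \<le> 36 * (C + 1) * y" by (simp add: power2_eq_square algebra_simps)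
    moreover have px: "Delta D x > 0" "Delta D x \<le> Delta D (max lo hi)" using x lo D by (auto intro!: Delta_pos Delta_mono)
    ultimately have "\<theta>\<^sup>2 * Delta D x \<le> (36 * (C + 1) * y) * Delta D (max lo hi)"
      using \<open>y \<ge> 0\<close> C(1) by (intro mult_mono) auto
    then have "\<theta>\<^sup>2 * Delta D x \<le> y * B" by (simp add: B_def mult_ac)
    then have "Delta D x * (\<theta>\<^sup>2 / B) \<le> y" using \<open>B > 0\<close> by (simp add: field_simps)
    then have "norm (cDelta D (of_real x * cis \<theta>)) \<le> Delta D x * (1 + (- (\<theta>\<^sup>2 / B)))"
      by (simp add: y_def algebra_simps)
    also have "\<dots> \<le> Delta D x * exp (- (\<theta>\<^sup>2 / B))"
      using px by (intro mult_left_mono exp_ge_add_one_self) auto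
    finally show "norm (cDelta D (of_real x * cis \<theta>)) \<le> Delta D x * exp (- (1 / B) * \<theta>\<^sup>2)" by simp
  qed
qed

section \<open>A local limit theorem\<close>

text \<open>Variance of the same tilted distribution: second factorial moment plus mean minus
  squared mean. In this form it is visibly continuous in x.\<close>

definition var :: "nat set \<Rightarrow> real \<Rightarrow> real" where
  "var D x = x\<^sup>2 * Delta {d. Suc (Suc d) \<in> D} x / Delta D x + mean D x - (mean D x)\<^sup>2"

lemma sums_second_factorial_moment:
  "(\<lambda>d. real d * (real d - 1) * (fps_nth (egf S) d * x ^ d)) sums (x\<^sup>2 * Delta {d. Suc (Suc d) \<in> S} x)"
proof -
  have "(\<lambda>d. x * (real d * (fps_nth (egf {d. Suc d \<in> S}) d * x ^ d))) sums (x * (x * Delta {d. Suc d \<in> {d. Suc d \<in> S}} x))"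
    by (intro sums_mult sums_first_moment)
  also have "(\<lambda>d. x * (real d * (fps_nth (egf {d. Suc d \<in> S}) d * x ^ d))) = 
     (\<lambda>d. real (Suc d) * (real (Suc d) - 1) * (fps_nth (egf S) (Suc d) * x ^ (Suc d)))"
    by (auto simp: fun_eq_iff divide_simps)
  finally show ?thesis
    by (subst (asm) sums_Suc_iff) (simp add: power2_eq_square mult.assoc)
qed

lemma sums_variance:
  assumes "0 < x" "D \<noteq> {}"
  shows "(\<lambda>d. (real d - mean D x)\<^sup>2 * (fps_nth (egf D) d * x ^ d)) sums (Delta D x * var D x)"
proof -
  define \<mu> where "\<mu> = mean D x"
  have p: "Delta D x > 0" by (rule Delta_pos[OF assms])
  have "(\<lambda>d. real d * (real d - 1) * (fps_nth (egf D) d * x ^ d) + (1 - 2 * \<mu>) * (real d * (fps_nth (egf D) d * x ^ d))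
      + \<mu>\<^sup>2 * (fps_nth (egf D) d * x ^ d)) sums 
      (x\<^sup>2 * Delta {d. Suc (Suc d) \<in> D} x + (1 - 2 * \<mu>) * (x * Delta {d. Suc d \<in> D} x) + \<mu>\<^sup>2 * Delta D x)"
    by (intro sums_add sums_mult sums_first_moment Delta_sums sums_second_factorial_moment)
  also have "x * Delta {d. Suc d \<in> D} x = \<mu> * Delta D x"
    using p by (simp add: \<mu>_def mean_def)
  also have "x\<^sup>2 * Delta {d. Suc (Suc d) \<in> D} x + (1 - 2 * \<mu>) * (\<mu> * Delta D x) + \<mu>\<^sup>2 * Delta D x = Delta D x * var D x"
    using p by (simp add: var_def \<mu>_def[symmetric] power2_eq_square algebra_simps)
  also have "(\<lambda>d. real d * (real d - 1) * (fps_nth (egf D) d * x ^ d) + (1 - 2 * \<mu>) * (real d * (fps_nth (egf D) d * x ^ d))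
      + \<mu>\<^sup>2 * (fps_nth (egf D) d * x ^ d)) = (\<lambda>d. (real d - \<mu>)\<^sup>2 * (fps_nth (egf D) d * x ^ d))"
    by (auto simp: fun_eq_iff power2_eq_square field_simps)
  finally show ?thesis unfolding \<mu>_def .
qed

lemma var_pos:
  assumes D: "a \<in> D" "b \<in> D" "a \<noteq> b" and x: "0 < x"
  shows "0 < var D x"
proof -
  have Dne: "D \<noteq> {}" using D by auto
  obtain c where c: "c \<in> D" "real c \<noteq> mean D x" using D by (metis of_nat_eq_iff)
  have "0 < suminf (\<lambda>d. (real d - mean D x)\<^sup>2 * (fps_nth (egf D) d * x ^ d))"
    using sums_summable[OF sums_variance[OF x Dne]] by (rule suminf_pos2[where i = c]) (use x c in auto)
  then have "0 < Delta D x * var D x" using sums_unique[OF sums_variance[OF x Dne]] by simp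
  then show ?thesis using Delta_pos[OF x Dne] by (simp add: zero_less_mult_iff)
qed

lemma cube_le_exp: "0 \<le> y \<Longrightarrow> y ^ 3 \<le> 6 * exp y" for y :: real
proof -
  assume y: "0 \<le> y"
  have "(\<lambda>n. y ^ n / fact n) sums exp y" using exp_converges[of y] by (simp add: divide_inverse mult.commute)
  then have s: "summable (\<lambda>n. y ^ n / fact n)" "exp y = (\<Sum>n. y ^ n / fact n)" by (auto simp: sums_iff)
  have "(\<Sum>n\<in>{3}. y ^ n / fact n) \<le> exp y"
    unfolding s(2) by (rule sum_le_suminf[OF s(1)]) (use y in auto)
  then show ?thesis by (simp add: fact_numeral)
qed

text \<open>Second-order expansion of the characteristic function of the centered degree; the linear
  term vanishes by centering. The third absolute moment is absorbed by |d - \<mu>|^3 \<le> 6 exp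
  (\<mu> + d): the factor exp d replaces x by exp 1 * x, so the error constant is again continuous
  in x.\<close>

lemma cDelta_taylor:
  assumes x: "0 < x" and D: "D \<noteq> {}"
  shows "norm (cDelta D (of_real x * cis \<theta>) * cis (- (mean D x * \<theta>)) - of_real (Delta D x * (1 - var D x * \<theta>\<^sup>2 / 2)))
    \<le> \<bar>\<theta>\<bar> ^ 3 * (exp (mean D x) * Delta D (exp 1 * x))"
proof -
  define \<mu> where "\<mu> = mean D x"
  have "\<mu> \<ge> 0" unfolding \<mu>_def mean_def using x by (intro divide_nonneg_nonneg mult_nonneg_nonneg Delta_nonneg) auto
  define p where "p = (\<lambda>d. fps_nth (egf D) d * x ^ d)"
  have p0: "p d \<ge> 0" for d using x by (simp add: p_def)
  have p_complex: "fps_nth (egf D) d * complex_of_real x ^ d = of_real (p d)" for d by (simp add: p_def)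
  have A: "(\<lambda>d. of_real (p d) * cis ((real d - \<mu>) * \<theta>)) sums (cDelta D (of_real x * cis \<theta>) * cis (- (\<mu> * \<theta>)))"
  proof -
    have "(\<lambda>d. fps_nth (egf D) d * (of_real x * cis \<theta>) ^ d * cis (- (\<mu> * \<theta>))) sums (cDelta D (of_real x * cis \<theta>) * cis (- (\<mu> * \<theta>)))"
      by (intro sums_mult2 cDelta_sums)
    also have "(\<lambda>d. fps_nth (egf D) d * (of_real x * cis \<theta>) ^ d * cis (- (\<mu> * \<theta>))) = (\<lambda>d. of_real (p d) * cis ((real d - \<mu>) * \<theta>))"
      unfolding power_mult_distrib mult.assoc[symmetric] p_complex Complex.DeMoivre
      unfolding mult.assoc cis_mult by (simp add: left_diff_distrib)
    finally show ?thesis .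
  qed
  have B: "(\<lambda>d. of_real (p d) * (\<Sum>k\<le>2. (\<i> * of_real ((real d - \<mu>) * \<theta>)) ^ k / fact k)) sums of_real (Delta D x * (1 - var D x * \<theta>\<^sup>2 / 2))"
  proof -
    have "(\<lambda>d. complex_of_real (p d) + \<i> * of_real \<theta> * of_real ((real d - \<mu>) * p d) - of_real (\<theta>\<^sup>2 / 2) * of_real ((real d - \<mu>)\<^sup>2 * p d)) sums
       (of_real (Delta D x) + \<i> * of_real \<theta> * of_real 0 - of_real (\<theta>\<^sup>2 / 2) * of_real (Delta D x * var D x))"
      unfolding p_def \<mu>_def using Delta_sums sums_centered[OF assms] sums_variance[OF assms]
      by (intro sums_diff sums_add sums_mult sums_of_real) auto
    also have "(\<lambda>d. complex_of_real (p d) + \<i> * of_real \<theta> * of_real ((real d - \<mu>) * p d) - of_real (\<theta>\<^sup>2 / 2) * of_real ((real d - \<mu>)\<^sup>2 * p d)) =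
      (\<lambda>d. of_real (p d) * (\<Sum>k\<le>2. (\<i> * of_real ((real d - \<mu>) * \<theta>)) ^ k / fact k))"
    proof
      fix d
      have key: "complex_of_real q + \<i> * of_real \<theta> * of_real (z * q) - of_real (\<theta>\<^sup>2 / 2) * of_real (z\<^sup>2 * q) =
         of_real q * (1 + \<i> * of_real (z * \<theta>) - of_real ((z * \<theta>)\<^sup>2 / 2))" for q z
        by (rule complex_eqI) (simp_all add: power_mult_distrib right_diff_distrib)
      have "(\<Sum>k\<le>2. (\<i> * of_real ((real d - \<mu>) * \<theta>)) ^ k / fact k) = 1 + \<i> * of_real ((real d - \<mu>) * \<theta>) - of_real (((real d - \<mu>) * \<theta>)\<^sup>2 / 2)"
        by (simp add: numeral_2_eq_2 power_mult_distrib)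
      then show "complex_of_real (p d) + \<i> * of_real \<theta> * of_real ((real d - \<mu>) * p d) - of_real (\<theta>\<^sup>2 / 2) * of_real ((real d - \<mu>)\<^sup>2 * p d) =
         of_real (p d) * (\<Sum>k\<le>2. (\<i> * of_real ((real d - \<mu>) * \<theta>)) ^ k / fact k)"
        by (simp only: key)
    qed
    finally show ?thesis by (simp add: algebra_simps)
  qed
  have C: "(\<lambda>d. \<bar>\<theta>\<bar> ^ 3 * (exp \<mu> * (fps_nth (egf D) d * (exp 1 * x) ^ d))) sums (\<bar>\<theta>\<bar> ^ 3 * (exp \<mu> * Delta D (exp 1 * x)))"
    by (intro sums_mult Delta_sums)
  have "norm (of_real (p d) * cis ((real d - \<mu>) * \<theta>) - of_real (p d) * (\<Sum>k\<le>2. (\<i> * of_real ((real d - \<mu>) * \<theta>)) ^ k / fact k))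
     \<le> \<bar>\<theta>\<bar> ^ 3 * (exp \<mu> * (fps_nth (egf D) d * (exp 1 * x) ^ d))" for d
  proof -
    have "norm (cis ((real d - \<mu>) * \<theta>) - (\<Sum>k\<le>2. (\<i> * of_real ((real d - \<mu>) * \<theta>)) ^ k / fact k)) \<le> \<bar>(real d - \<mu>) * \<theta>\<bar> ^ 3 / 6"
      using iexp_approx1[of "(real d - \<mu>) * \<theta>" 2] by (simp add: cis_conv_exp fact_numeral numeral_3_eq_3)
    also have "\<dots> = \<bar>\<theta>\<bar> ^ 3 * (\<bar>real d - \<mu>\<bar> ^ 3 / 6)" by (simp add: abs_mult power_mult_distrib)
    also have "\<dots> \<le> \<bar>\<theta>\<bar> ^ 3 * exp (\<mu> + real d)"
    proof (intro mult_left_mono)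
      have "\<bar>real d - \<mu>\<bar> ^ 3 \<le> (\<mu> + real d) ^ 3" using \<open>\<mu> \<ge> 0\<close> by (intro power_mono) auto
      also have "\<dots> \<le> 6 * exp (\<mu> + real d)" using \<open>\<mu> \<ge> 0\<close> by (intro cube_le_exp) auto
      finally show "\<bar>real d - \<mu>\<bar> ^ 3 / 6 \<le> exp (\<mu> + real d)" by simp
    qed auto
    finally have *: "norm (cis ((real d - \<mu>) * \<theta>) - (\<Sum>k\<le>2. (\<i> * of_real ((real d - \<mu>) * \<theta>)) ^ k / fact k)) \<le> \<bar>\<theta>\<bar> ^ 3 * exp (\<mu> + real d)" .
    have "norm (of_real (p d) * cis ((real d - \<mu>) * \<theta>) - of_real (p d) * (\<Sum>k\<le>2. (\<i> * of_real ((real d - \<mu>) * \<theta>)) ^ k / fact k))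
      = p d * norm (cis ((real d - \<mu>) * \<theta>) - (\<Sum>k\<le>2. (\<i> * of_real ((real d - \<mu>) * \<theta>)) ^ k / fact k))"
      unfolding right_diff_distrib[symmetric] norm_mult using p0[of d] by simp
    also have "\<dots> \<le> p d * (\<bar>\<theta>\<bar> ^ 3 * exp (\<mu> + real d))" using * p0 by (rule mult_left_mono)
    also have "\<dots> = \<bar>\<theta>\<bar> ^ 3 * (exp \<mu> * (fps_nth (egf D) d * (exp 1 * x) ^ d))"
      by (simp add: p_def exp_add power_mult_distrib exp_of_nat_mult[of _ 1, simplified])
    finally show ?thesis .
  qed
  then have "norm (\<Sum>d. of_real (p d) * cis ((real d - \<mu>) * \<theta>) - of_real (p d) * (\<Sum>k\<le>2. (\<i> * of_real ((real d - \<mu>) * \<theta>)) ^ k / fact k))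
     \<le> (\<Sum>d. \<bar>\<theta>\<bar> ^ 3 * (exp \<mu> * (fps_nth (egf D) d * (exp 1 * x) ^ d)))"
    by (rule norm_suminf_le) (rule sums_summable[OF C])
  then show ?thesis
    unfolding \<mu>_def[symmetric] sums_unique[OF C, symmetric] sums_unique[OF sums_diff[OF A B], symmetric] .
qed

lemma exp_minus_bound: "0 \<le> y \<Longrightarrow> \<bar>exp (- y) - (1 - y)\<bar> \<le> y\<^sup>2" for y :: real
proof -
  assume y: "0 \<le> y"
  have "1 - y \<le> exp (- y)" using exp_ge_add_one_self[of "-y"] by simp
  moreover have "exp (- y) \<le> 1 / (1 + y)"
    using exp_ge_add_one_self[of y] y by (simp add: exp_minus field_simps)
  moreover have "1 / (1 + y) \<le> 1 - y + y\<^sup>2"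
  proof -
    have "(1 - y + y\<^sup>2) * (1 + y) = 1 + y ^ 3" by algebra
    then show ?thesis using y by (simp add: pos_divide_le_eq)
  qed
  ultimately show ?thesis by simp
qed

lemma var_tendsto:
  assumes "D \<noteq> {}" "0 < x0" "(x \<longlongrightarrow> x0) F"
  shows "((\<lambda>n. mean D (x n)) \<longlongrightarrow> mean D x0) F" "((\<lambda>n. var D (x n)) \<longlongrightarrow> var D x0) F"
proof -
  have p: "Delta D x0 \<noteq> 0" using Delta_pos[OF assms(2,1)] by simp
  show *: "((\<lambda>n. mean D (x n)) \<longlongrightarrow> mean D x0) F"
    unfolding mean_def by (intro tendsto_intros tendsto_Delta assms p)
  show "((\<lambda>n. var D (x n)) \<longlongrightarrow> var D x0) F"
    unfolding var_def by (intro tendsto_intros tendsto_Delta assms p *)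
qed

text \<open>Central limit theorem for a distribution that changes with n. The normalized
  characteristic value and exp (- y) both lie in the unit disc, so their powers differ by at most n
  times the difference of the bases, which is of order n^(-3/2). Replacing the exponent n by n - v
  does not change the limit.\<close>

lemma char_power_tendsto:
  fixes x :: "nat \<Rightarrow> real"
  assumes D: "a \<in> D" "b \<in> D" "a \<noteq> b" and x0: "0 < x0" and x: "x \<longlonglongrightarrow> x0"
  shows "(\<lambda>n. (cDelta D (of_real (x n) * cis (u / sqrt n)) / of_real (Delta D (x n)) * cis (- (mean D (x n) * (u / sqrt n)))) ^ (n - v))
     \<longlonglongrightarrow> of_real (exp (- (var D x0 * u\<^sup>2 / 2)))"
proof -
  have Dne: "D \<noteq> {}" using D by auto
  define \<phi> where "\<phi> = (\<lambda>n. cDelta D (of_real (x n) * cis (u / sqrt n)) / of_real (Delta D (x n)) * cis (- (mean D (x n) * (u / sqrt n))))"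
  define y where "y = (\<lambda>n. var D (x n) * u\<^sup>2 / 2 / real n)"
  define C where "C = (\<lambda>n. exp (mean D (x n)) * Delta D (exp 1 * x n) / Delta D (x n))"
  have vt: "(\<lambda>n. var D (x n)) \<longlonglongrightarrow> var D x0" by (rule var_tendsto(2)[OF Dne x0 x])
  have Ct: "C \<longlonglongrightarrow> exp (mean D x0) * Delta D (exp 1 * x0) / Delta D x0"
    unfolding C_def using Delta_pos[OF x0 Dne]
    by (intro tendsto_intros tendsto_Delta var_tendsto(1)[OF Dne x0] x) auto
  have ev: "\<forall>\<^sub>F n in sequentially. norm (\<phi> n ^ (n - v) - of_real (exp (- y n)) ^ (n - v)) \<le>
     C n * \<bar>u\<bar> ^ 3 / sqrt n + (var D (x n) * u\<^sup>2 / 2)\<^sup>2 / real n"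
    using order_tendstoD(1)[OF x x0] eventually_gt_at_top[of 0]
  proof eventually_elim
    case (elim n)
    then have xn: "0 < x n" and n: "0 < n" by auto
    have p: "Delta D (x n) > 0" by (rule Delta_pos[OF xn Dne])
    have vp: "0 < var D (x n)" by (rule var_pos[OF D xn])
    have y0: "0 \<le> y n" using vp by (simp add: y_def)
    have nphi: "norm (\<phi> n) \<le> 1"
      unfolding \<phi>_def using norm_cDelta_le[of "x n" D "u / sqrt n"] p xn by (simp add: norm_mult norm_divide)
    have nexp: "norm (complex_of_real (exp (- y n))) \<le> 1" using y0 by simp
    have "norm (\<phi> n ^ (n - v) - of_real (exp (- y n)) ^ (n - v)) \<le> real (n - v) * norm (\<phi> n - of_real (exp (- y n)))"
      by (rule norm_power_diff[OF nphi nexp])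
    also have "\<dots> \<le> real n * norm (\<phi> n - of_real (exp (- y n)))"
      by (intro mult_right_mono) auto
    also have "\<dots> \<le> real n * (norm (\<phi> n - of_real (1 - y n)) + norm (complex_of_real (1 - y n) - of_real (exp (- y n))))"
      by (intro mult_left_mono) (auto intro: norm_triangle_ineq[of "\<phi> n - of_real (1 - y n)" "complex_of_real (1 - y n) - of_real (exp (- y n))", simplified])
    also have "\<dots> \<le> real n * (\<bar>u / sqrt n\<bar> ^ 3 * C n + (y n)\<^sup>2)"
    proof (intro mult_left_mono add_mono)
      have "\<phi> n - of_real (1 - y n) = (cDelta D (of_real (x n) * cis (u / sqrt n)) * cis (- (mean D (x n) * (u / sqrt n))) - 
          of_real (Delta D (x n) * (1 - var D (x n) * (u / sqrt n)\<^sup>2 / 2))) / of_real (Delta D (x n))"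
        using p n by (simp add: \<phi>_def y_def diff_divide_distrib power_divide)
      also have "norm \<dots> \<le> \<bar>u / sqrt n\<bar> ^ 3 * (exp (mean D (x n)) * Delta D (exp 1 * x n)) / Delta D (x n)"
        unfolding norm_divide using divide_right_mono[OF cDelta_taylor[OF xn Dne, of "u / sqrt n"], of "Delta D (x n)"] p
        by (simp only: norm_of_real abs_of_pos less_imp_le)
      finally show "norm (\<phi> n - of_real (1 - y n)) \<le> \<bar>u / sqrt n\<bar> ^ 3 * C n" by (simp add: C_def)
      show "norm (complex_of_real (1 - y n) - of_real (exp (- y n))) \<le> (y n)\<^sup>2"
        using exp_minus_bound[OF y0] unfolding of_real_diff[symmetric] norm_of_real by (simp add: abs_minus_commute)
    qed auto
    also have "\<dots> = C n * \<bar>u\<bar> ^ 3 / sqrt n + (var D (x n) * u\<^sup>2 / 2)\<^sup>2 / real n"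
    proof -
      have "real n = sqrt n * sqrt n" by simp
      then have "real n * \<bar>u / sqrt n\<bar> ^ 3 = \<bar>u\<bar> ^ 3 / sqrt n"
        using n by (simp add: power3_eq_cube)
      moreover have "real n * (y n)\<^sup>2 = (var D (x n) * u\<^sup>2 / 2)\<^sup>2 / real n"
        using n by (simp add: y_def power_divide power2_eq_square[of "real n"])
      moreover have "real n * (X * C n + Y) = C n * (real n * X) + real n * Y" for X Y by algebra
      ultimately show ?thesis by (simp only: times_divide_eq_right)
    qed
    finally show ?case .
  qed
  have s: "(\<lambda>n. 1 / sqrt (real n)) \<longlonglongrightarrow> 0" "(\<lambda>n. 1 / real n) \<longlonglongrightarrow> 0" by real_asymp+
  have "(\<lambda>n. C n * \<bar>u\<bar> ^ 3 * (1 / sqrt n) + (var D (x n) * u\<^sup>2 / 2)\<^sup>2 * (1 / real n)) \<longlonglongrightarrow>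
     (exp (mean D x0) * Delta D (exp 1 * x0) / Delta D x0) * \<bar>u\<bar> ^ 3 * 0 + (var D x0 * u\<^sup>2 / 2)\<^sup>2 * 0"
    by (intro tendsto_intros Ct vt s) auto
  then have "(\<lambda>n. C n * \<bar>u\<bar> ^ 3 / sqrt n + (var D (x n) * u\<^sup>2 / 2)\<^sup>2 / real n) \<longlonglongrightarrow> 0" by simp
  then have "(\<lambda>n. \<phi> n ^ (n - v) - of_real (exp (- y n)) ^ (n - v)) \<longlonglongrightarrow> 0"
    by (rule Lim_null_comparison[OF ev])
  moreover have "(\<lambda>n. complex_of_real (exp (- y n)) ^ (n - v)) \<longlonglongrightarrow> of_real (exp (- (var D x0 * u\<^sup>2 / 2)))"
  proof -
    have "(\<lambda>n. real (n - v) / real n) \<longlonglongrightarrow> 1"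
    proof (rule Lim_transform_eventually)
      show "(\<lambda>n. (real n - real v) / real n) \<longlonglongrightarrow> 1" by real_asymp
      show "\<forall>\<^sub>F n in sequentially. (real n - real v) / real n = real (n - v) / real n"
        using eventually_ge_at_top[of v] by eventually_elim (simp add: of_nat_diff)
    qed
    then have "(\<lambda>n. exp (- (var D (x n) * u\<^sup>2 / 2 * (real (n - v) / real n)))) \<longlonglongrightarrow> exp (- (var D x0 * u\<^sup>2 / 2 * 1))"
      by (intro tendsto_intros vt) auto
    also have "(\<lambda>n. exp (- (var D (x n) * u\<^sup>2 / 2 * (real (n - v) / real n)))) = (\<lambda>n. exp (- y n) ^ (n - v))"
      by (simp add: fun_eq_iff y_def exp_of_nat_mult[symmetric] mult_ac)
    finally have "(\<lambda>n. complex_of_real (exp (- y n) ^ (n - v))) \<longlonglongrightarrow> of_real (exp (- (var D x0 * u\<^sup>2 / 2)))"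
      by (intro tendsto_of_real) simp
    then show ?thesis by simp
  qed
  ultimately have "(\<lambda>n. \<phi> n ^ (n - v)) \<longlonglongrightarrow> of_real (exp (- (var D x0 * u\<^sup>2 / 2)))"
    by (rule Lim_transform[rotated])
  then show ?thesis by (simp only: \<phi>_def)
qed

lemma gaussian_integral:
  assumes "0 < c"
  shows "integrable lborel (\<lambda>u::real. exp (- (c * u\<^sup>2)))" "0 < (LBINT u. exp (- (c * u\<^sup>2)))"
proof -
  define \<sigma> where "\<sigma> = sqrt (1 / (2 * c))"
  have s: "\<sigma> > 0" "2 * \<sigma>\<^sup>2 = 1 / c" using assms by (simp_all add: \<sigma>_def)
  have eq: "exp (- (c * u\<^sup>2)) = sqrt (2 * pi * \<sigma>\<^sup>2) * normal_density 0 \<sigma> u" for u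
    using s assms by (simp add: normal_density_def mult.commute)
  show "integrable lborel (\<lambda>u::real. exp (- (c * u\<^sup>2)))"
    unfolding eq using s by (intro integrable_mult_right integrable_normal_density) auto
  have "(LBINT u. exp (- (c * u\<^sup>2))) = sqrt (2 * pi * \<sigma>\<^sup>2) * 1"
    unfolding eq using s by (simp add: integral_normal_density)
  then show "0 < (LBINT u. exp (- (c * u\<^sup>2)))" using s by simp
qed

text \<open>K is obtained before H, v and s, so quotients of two such coefficients have a limit free
  of K. After the substitution \<theta> = u / sqrt n the integrand converges to a Gaussian times H
  at x0, and \<open>norm_cDelta_le_exp\<close> provides the integrable majorant.\<close>

theorem local_limit:
  fixes x :: "nat \<Rightarrow> real" and N :: "nat \<Rightarrow> nat" and x0 :: real
  assumes D: "a \<in> D" "b \<in> D" "a \<noteq> b" and gcd: "Gcd ((\<lambda>d. d - Inf D) ` D) = 1"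
    and x0: "0 < x0" and x: "x \<longlonglongrightarrow> x0"
    and mean: "\<forall>\<^sub>F n in sequentially. mean D (x n) * n = N n"
    and N: "filterlim N at_top sequentially"
  obtains K where "0 < K"
    "\<And>H v s. fps_conv_radius H = \<infinity> \<Longrightarrow>
       (\<lambda>n. of_real (sqrt n * x n ^ (N n - s) / Delta D (x n) ^ (n - v)) * fps_nth (egf D ^ (n - v) * H) (N n - s))
         \<longlonglongrightarrow> of_real K * eval_fps H (of_real x0 :: complex)"
proof -
  have Dne: "D \<noteq> {}" using D by auto
  define w where "w = var D x0 / 2"
  have "w > 0" using var_pos[OF D x0] by (simp add: w_def)
  define K where "K = (LBINT u. exp (- (w * u\<^sup>2))) / (2 * pi)"
  have "K > 0" using gaussian_integral(2)[OF \<open>w > 0\<close>] by (simp add: K_def)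
  \<comment> \<open>The window from x0 / 2 to 2 * x0 contains x n for all large n, so one decay
    constant serves the whole tail of the sequence.\<close>
  obtain c where c: "c > 0" "\<And>y \<theta>. x0 / 2 \<le> y \<Longrightarrow> y \<le> 2 * x0 \<Longrightarrow> \<bar>\<theta>\<bar> \<le> pi \<Longrightarrow>
     norm (cDelta D (of_real y * cis \<theta>)) \<le> Delta D y * exp (- c * \<theta>\<^sup>2)"
    using norm_cDelta_le_exp[OF Dne gcd, of "x0 / 2" "2 * x0"] x0 by auto
  have "(\<lambda>n. of_real (sqrt n * x n ^ (N n - s) / Delta D (x n) ^ (n - v)) * fps_nth (egf D ^ (n - v) * H) (N n - s))
         \<longlonglongrightarrow> of_real K * eval_fps H (of_real x0 :: complex)" if H: "fps_conv_radius H = \<infinity>" for H v s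
  proof -
    have contH: "continuous_on UNIV (eval_fps H)"
      using continuous_on_eval_fps[of H] H by simp
    have contD: "continuous_on UNIV (cDelta D)"
      using continuous_on_eval_fps[of "egf D :: complex fps"] by (simp add: cDelta_def)
    have "bounded (eval_fps H ` cball 0 (2 * x0))"
      by (intro compact_imp_bounded compact_continuous_image continuous_on_subset[OF contH]) auto
    then obtain B where "\<forall>z\<in>cball 0 (2 * x0). norm (eval_fps H z) \<le> B"
      unfolding bounded_iff by auto
    then have B: "\<And>z. norm z \<le> 2 * x0 \<Longrightarrow> norm (eval_fps H z) \<le> B" by auto
    have "B \<ge> 0" using order_trans[OF norm_ge_zero B[of 0]] x0 by simp
    define F where "F = (\<lambda>n u. indicator {-pi..pi} (u / sqrt (real n)) *\<^sub>R
       ((cDelta D (of_real (x n) * cis (u / sqrt n)) / of_real (Delta D (x n))) ^ (n - v) *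
        eval_fps H (of_real (x n) * cis (u / sqrt n)) * cis (- (real (N n - s) * (u / sqrt n)))))"
    define f where "f = (\<lambda>u::real. complex_of_real (exp (- (w * u\<^sup>2))) * eval_fps H (of_real x0))"
    have meas: "F n \<in> borel_measurable lborel" for n
    proof -
      have g: "(\<lambda>u::real. of_real (x n) * cis (u / sqrt n)) \<in> borel_measurable borel"
        unfolding cis_conv_exp by measurable
      have "(\<lambda>u. cDelta D (of_real (x n) * cis (u / sqrt n))) \<in> borel_measurable borel"
        "(\<lambda>u. eval_fps H (of_real (x n) * cis (u / sqrt n))) \<in> borel_measurable borel"
        by (rule measurable_compose[OF g borel_measurable_continuous_onI], rule contD contH)+
      then show ?thesis unfolding F_def cis_conv_exp[of "- _"] by measurable
    qed
    have ev_x: "\<forall>\<^sub>F n in sequentially. x0 / 2 \<le> x n \<and> x n \<le> 2 * x0"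
      using order_tendstoD(1)[OF x, of "x0 / 2"] order_tendstoD(2)[OF x, of "2 * x0"] x0
      by (auto elim: eventually_elim2)
    have "\<forall>\<^sub>F n in sequentially. \<forall>u. norm (F n u) \<le> B * exp (- (c / 2 * u\<^sup>2))"
      using ev_x eventually_ge_at_top[of "2 * v"] eventually_gt_at_top[of 0]
    proof eventually_elim
      case (elim n)
      have xn: "0 < x n" using elim x0 by auto
      have p: "Delta D (x n) > 0" by (rule Delta_pos[OF xn Dne])
      show ?case
      proof
        fix u
        define \<theta> where "\<theta> = u / sqrt n"
        show "norm (F n u) \<le> B * exp (- (c / 2 * u\<^sup>2))"
        proof (cases "\<bar>\<theta>\<bar> \<le> pi")
          case False
          then have "indicator {-pi..pi} \<theta> = (0::real)" by (auto simp: indicator_def)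
          then show ?thesis using \<open>B \<ge> 0\<close> by (simp add: F_def \<theta>_def)
        next
          case True
          then have "norm (F n u) = (norm (cDelta D (of_real (x n) * cis \<theta>)) / Delta D (x n)) ^ (n - v) * norm (eval_fps H (of_real (x n) * cis \<theta>))"
            using p by (auto simp: F_def \<theta>_def[symmetric] norm_mult norm_power norm_divide indicator_def abs_le_iff)
          also have "\<dots> \<le> exp (- c * \<theta>\<^sup>2) ^ (n - v) * B"
            using c(2)[of "x n" \<theta>] elim True p xn
            by (intro mult_mono power_mono B) (auto simp: norm_mult pos_divide_le_eq mult.commute)
          also have "exp (- c * \<theta>\<^sup>2) ^ (n - v) = exp (- (c * u\<^sup>2 * (real (n - v) / real n)))"
            by (simp add: exp_of_nat_mult[symmetric] \<theta>_def power_divide mult_ac)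
          also have "\<dots> \<le> exp (- (c / 2 * u\<^sup>2))"
          proof -
            \<comment> \<open>For n \<ge> 2 v at least half of the factors remain, so halving c
              gives a majorant that does not depend on n.\<close>
            have "1 / 2 \<le> real (n - v) / real n"
              using elim by (simp add: of_nat_diff field_simps)
            then have "c * u\<^sup>2 * (1 / 2) \<le> c * u\<^sup>2 * (real (n - v) / real n)"
              by (rule mult_left_mono) (use c(1) in simp)
            moreover have "c / 2 * u\<^sup>2 = c * u\<^sup>2 * (1 / 2)" by simp
            ultimately show ?thesis by (simp only: exp_le_cancel_iff neg_le_iff_le)
          qed
          finally show ?thesis using \<open>B \<ge> 0\<close> by (simp add: mult.commute mult_right_mono)
        qed
      qed
    qed
    then obtain n0 where n0: "\<And>n u. n \<ge> n0 \<Longrightarrow> norm (F n u) \<le> B * exp (- (c / 2 * u\<^sup>2))"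
      unfolding eventually_sequentially by auto
    have lim: "(\<lambda>n. F n u) \<longlonglongrightarrow> f u" for u
    proof -
      have u0: "(\<lambda>n. u / sqrt (real n)) \<longlonglongrightarrow> 0" by real_asymp
      have "\<forall>\<^sub>F n in sequentially. \<bar>u / sqrt (real n)\<bar> < pi"
        using order_tendstoD[OF u0, of pi] order_tendstoD(1)[OF u0, of "-pi"] by (auto elim: eventually_elim2)
      moreover have "\<forall>\<^sub>F n in sequentially. s \<le> N n" using N unfolding filterlim_at_top by auto
      moreover note mean eventually_ge_at_top[of v]
      ultimately have "\<forall>\<^sub>F n in sequentially. 
         (cDelta D (of_real (x n) * cis (u / sqrt n)) / of_real (Delta D (x n)) * cis (- (mean D (x n) * (u / sqrt n)))) ^ (n - v)
         * (eval_fps H (of_real (x n) * cis (u / sqrt n)) * cis ((real s - real v * mean D (x n)) * (u / sqrt n))) = F n u"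
      proof eventually_elim
        case (elim n)
        \<comment> \<open>Split N - s as (n - v) * mean + (v * mean - s). The first part centers
          each of the n - v factors; the second is multiplied by u / sqrt n and disappears in the
          limit.\<close>
        have "cis (- (mean D (x n) * (u / sqrt n))) ^ (n - v) * cis ((real s - real v * mean D (x n)) * (u / sqrt n)) =
           cis (- (real (N n - s) * (u / sqrt n)))"
        proof -
          have "real (n - v) * (- (mean D (x n) * t)) + (real s - real v * mean D (x n)) * t = - (real (N n - s) * t)" for t
            using elim by (simp add: of_nat_diff elim(3)[symmetric] algebra_simps)
          then show ?thesis unfolding Complex.DeMoivre cis_mult by (simp only:)
        qed
        moreover have "u / sqrt n \<in> {-pi..pi}"
          using elim(1) unfolding abs_less_iff atLeastAtMost_iff by linarith
        moreover have "(p * q) ^ k * (e * g) = p ^ k * e * (q ^ k * g)" for p q e g :: complex and k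
          by (simp add: power_mult_distrib mult_ac)
        ultimately show ?case by (simp only: F_def indicator_simps scaleR_one)
      qed
      moreover have "(\<lambda>n. (cDelta D (of_real (x n) * cis (u / sqrt n)) / of_real (Delta D (x n)) * cis (- (mean D (x n) * (u / sqrt n)))) ^ (n - v)
         * (eval_fps H (of_real (x n) * cis (u / sqrt n)) * cis ((real s - real v * mean D (x n)) * (u / sqrt n))))
         \<longlonglongrightarrow> of_real (exp (- (var D x0 * u\<^sup>2 / 2))) * (eval_fps H (of_real x0 * cis 0) * cis ((real s - real v * mean D x0) * 0))"
        by (intro tendsto_mult char_power_tendsto[OF D x0 x] continuous_on_tendsto_compose[OF contH]
             tendsto_of_real x tendsto_cis u0 tendsto_diff tendsto_const var_tendsto(1)[OF Dne x0]) auto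
      ultimately show ?thesis
        by (rule Lim_transform_eventually[rotated, THEN tendsto_eq_rhs]) (simp_all add: f_def w_def)
    qed
    \<comment> \<open>The majorant is valid only from n0 on: shift the sequence for dominated
      convergence, then shift back.\<close>
    have "(\<lambda>n. LBINT u. F (n + n0) u) \<longlonglongrightarrow> (LBINT u. f u)"
    proof (rule integral_dominated_convergence)
      show "integrable lborel (\<lambda>u. B * exp (- (c / 2 * u\<^sup>2)))"
        using c by (intro integrable_mult_right gaussian_integral) auto
      show "AE u in lborel. (\<lambda>n. F (n + n0) u) \<longlonglongrightarrow> f u"
        using LIMSEQ_ignore_initial_segment[OF lim] by auto
    qed (use n0 meas in \<open>auto simp: f_def\<close>)
    then have "(\<lambda>n. LBINT u. F n u) \<longlonglongrightarrow> (LBINT u. f u)" by (rule LIMSEQ_offset)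
    then have "(\<lambda>n. (LBINT u. F n u) / of_real (2 * pi)) \<longlonglongrightarrow> (LBINT u. f u) / of_real (2 * pi)"
      by (intro tendsto_divide) auto
    also have "(LBINT u. f u) / of_real (2 * pi) = of_real K * eval_fps H (of_real x0)"
      unfolding f_def K_def by (simp add: integral_complex_of_real)
    finally have "(\<lambda>n. (LBINT u. F n u) / of_real (2 * pi)) \<longlonglongrightarrow> of_real K * eval_fps H (of_real x0)" .
    moreover have "\<forall>\<^sub>F n in sequentially. (LBINT u. F n u) / of_real (2 * pi) = 
       of_real (sqrt n * x n ^ (N n - s) / Delta D (x n) ^ (n - v)) * fps_nth (egf D ^ (n - v) * H) (N n - s)"
      using ev_x eventually_gt_at_top[of 0]
    proof eventually_elim
      case (elim n)
      have xn: "0 < x n" using elim x0 by auto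
      have p: "Delta D (x n) > 0" by (rule Delta_pos[OF xn Dne])
      have rn: "sqrt (real n) > 0" using elim by simp
      define P where "P = egf D ^ (n - v) * H"
      have rad: "fps_conv_radius (egf D ^ (n - v) :: complex fps) = \<infinity>"
        using fps_conv_radius_power[of "egf D :: complex fps" "n - v"] by simp
      have radP: "fps_conv_radius P = \<infinity>"
        using fps_conv_radius_mult[of "egf D ^ (n - v)" H] by (simp add: P_def rad H)
      have evP: "eval_fps P z = cDelta D z ^ (n - v) * eval_fps H z" for z
        unfolding P_def cDelta_def by (simp add: eval_fps_mult eval_fps_power rad H)
      have "of_real (2 * pi * x n ^ (N n - s)) * fps_nth P (N n - s) = 
        (LBINT \<theta>. indicator {-pi..pi} \<theta> *\<^sub>R (eval_fps P (of_real (x n) * cis \<theta>) * cis (- (real (N n - s) * \<theta>))))"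
        using fps_nth_eq_integral[OF radP, of "x n" "N n - s"] xn by (simp add: set_lebesgue_integral_def)
      \<comment> \<open>Substitution \<theta> = u / sqrt n; its Jacobian is the source of the
        normalization by sqrt n.\<close>
      also have "\<dots> = \<bar>1 / sqrt n\<bar> *\<^sub>R (LBINT u. indicator {-pi..pi} (0 + 1 / sqrt n * u) *\<^sub>R (eval_fps P (of_real (x n) * cis (0 + 1 / sqrt n * u)) * cis (- (real (N n - s) * (0 + 1 / sqrt n * u)))))"
        using rn by (intro lborel_integral_real_affine) auto
      also have "(\<lambda>u. indicator {-pi..pi} (0 + 1 / sqrt n * u) *\<^sub>R (eval_fps P (of_real (x n) * cis (0 + 1 / sqrt n * u)) * cis (- (real (N n - s) * (0 + 1 / sqrt n * u)))))
         = (\<lambda>u. of_real (Delta D (x n) ^ (n - v)) * F n u)"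
        using p by (auto simp: fun_eq_iff F_def evP power_divide)
      also have "(LBINT u. of_real (Delta D (x n) ^ (n - v)) * F n u) = of_real (Delta D (x n) ^ (n - v)) * (LBINT u. F n u)"
        by (rule integral_mult_right_zero)
      finally have "of_real (2 * pi * x n ^ (N n - s)) * fps_nth P (N n - s) = of_real (1 / sqrt n) * (of_real (Delta D (x n) ^ (n - v)) * (LBINT u. F n u))"
        using rn by (simp add: scaleR_conv_of_real)
      then show ?case
        unfolding P_def[symmetric] using p rn by (simp add: field_simps)
    qed
    ultimately show ?thesis by (rule Lim_transform_eventually)
  qed
  then show thesis using that \<open>K > 0\<close> by blast
qed

section \<open>Counting multigraphs with prescribed edges\<close>

lemma sum_Pow_card:
  fixes h :: "nat \<Rightarrow> 'b::comm_semiring_1"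
  assumes "finite A"
  shows "(\<Sum>U\<in>Pow A. h (card U)) = (\<Sum>i\<le>card A. of_nat (card A choose i) * h i)"
proof -
  have "(\<Sum>U\<in>Pow A. h (card U)) = (\<Sum>i\<le>card A. \<Sum>U\<in>{U\<in>Pow A. card U = i}. h (card U))"
    using assms by (intro sum.group[symmetric]) (auto intro: card_mono)
  also have "\<dots> = (\<Sum>i\<le>card A. of_nat (card A choose i) * h i)"
    using assms by (intro sum.cong) (simp_all add: n_subsets)
  finally show ?thesis .
qed

text \<open>Product rule for exponential generating functions: choosing the fibre U over one value b
  and then a function on the complement of U is a binomial convolution, which after division by
  factorials becomes a product of series.\<close>

lemma card_functions_with_fibre_sizes:
  assumes "finite B" "finite A"
  shows "of_nat (card {\<phi> \<in> A \<rightarrow>\<^sub>E B. \<forall>w\<in>B. card {a\<in>A. \<phi> a = w} \<in> S w})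
    = fact (card A) * (fps_nth (\<Prod>w\<in>B. egf (S w)) (card A) :: complex)"
  using assms
proof (induction B arbitrary: A rule: finite_induct)
  case empty
  show ?case
  proof (cases "A = {}")
    case True
    then show ?thesis by (simp add: card_1_singleton_iff Collect_conv_if)
  next
    case False
    then have e: "A \<rightarrow>\<^sub>E {} = {}" by auto
    show ?thesis unfolding e using False empty by simp
  qed
next
  case (insert b B A)
  define X where "X = {\<phi> \<in> A \<rightarrow>\<^sub>E insert b B. \<forall>w\<in>insert b B. card {a\<in>A. \<phi> a = w} \<in> S w}"
  define Y where "Y = (\<lambda>U. {\<phi> \<in> A - U \<rightarrow>\<^sub>E B. \<forall>w\<in>B. card {a\<in>A - U. \<phi> a = w} \<in> S w})"
  define Us where "Us = {U\<in>Pow A. card U \<in> S b}"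
  have finY: "finite (Y U)" for U
    unfolding Y_def by (rule finite_subset[of _ "A - U \<rightarrow>\<^sub>E B"]) (use insert in \<open>auto intro: finite_PiE\<close>)
  have finUs: "finite Us" unfolding Us_def using insert.prems by simp
  \<comment> \<open>A function is its fibre over b glued to the rest; the fibre can be recovered
    because b is not in B.\<close>
  have "bij_betw (\<lambda>(U, \<psi>) a. if a \<in> U then b else \<psi> a) (SIGMA U:Us. Y U) X"
  proof (rule bij_betw_byWitness[where f' = "\<lambda>\<phi>. ({a\<in>A. \<phi> a = b}, restrict \<phi> (A - {a\<in>A. \<phi> a = b}))"])
    show "\<forall>p\<in>SIGMA U:Us. Y U. (\<lambda>\<phi>. ({a\<in>A. \<phi> a = b}, restrict \<phi> (A - {a\<in>A. \<phi> a = b}))) ((\<lambda>(U, \<psi>) a. if a \<in> U then b else \<psi> a) p) = p"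
    proof
      fix p assume "p \<in> (SIGMA U:Us. Y U)"
      then obtain U \<psi> where p: "p = (U, \<psi>)" and U: "U \<in> Us" and \<psi>: "\<psi> \<in> Y U" by auto
      have 1: "{a \<in> A. (if a \<in> U then b else \<psi> a) = b} = U"
        using U \<psi> insert.hyps(2) unfolding Us_def Y_def by auto
      have "restrict (\<lambda>a. if a \<in> U then b else \<psi> a) (A - U) = \<psi>"
        using \<psi> by (auto simp: Y_def PiE_def intro!: extensionalityI[of _ "A - U"])
      with 1 show "(\<lambda>\<phi>. ({a\<in>A. \<phi> a = b}, restrict \<phi> (A - {a\<in>A. \<phi> a = b}))) ((\<lambda>(U, \<psi>) a. if a \<in> U then b else \<psi> a) p) = p"
        by (simp add: p)
    qed
    show "\<forall>\<phi>\<in>X. (\<lambda>(U, \<psi>) a. if a \<in> U then b else \<psi> a) ({a\<in>A. \<phi> a = b}, restrict \<phi> (A - {a\<in>A. \<phi> a = b})) = \<phi>"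
    proof
      fix \<phi> assume "\<phi> \<in> X"
      then have "\<phi> \<in> A \<rightarrow>\<^sub>E insert b B" by (simp add: X_def)
      from PiE_arb[OF this] show "(\<lambda>(U, \<psi>) a. if a \<in> U then b else \<psi> a) ({a\<in>A. \<phi> a = b}, restrict \<phi> (A - {a\<in>A. \<phi> a = b})) = \<phi>"
        by (intro ext) (auto simp add: restrict_def)
    qed
    show "(\<lambda>(U, \<psi>) a. if a \<in> U then b else \<psi> a) ` (SIGMA U:Us. Y U) \<subseteq> X"
    proof (rule image_subsetI)
      fix p assume "p \<in> (SIGMA U:Us. Y U)"
      then obtain U \<psi> where p: "p = (U, \<psi>)" and U: "U \<in> Us" and \<psi>: "\<psi> \<in> Y U" by auto
      have "{a \<in> A. (if a \<in> U then b else \<psi> a) = b} = U"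
        using U \<psi> insert.hyps(2) unfolding Us_def Y_def by auto
      moreover have "{a \<in> A. (if a \<in> U then b else \<psi> a) = w} = {a \<in> A - U. \<psi> a = w}" if "w \<in> B" for w
        using that insert.hyps(2) by auto
      moreover have "(\<lambda>a. if a \<in> U then b else \<psi> a) \<in> A \<rightarrow>\<^sub>E insert b B"
        using U \<psi> by (auto simp: Us_def Y_def PiE_def extensional_def Pi_def)
      ultimately show "(\<lambda>(U, \<psi>) a. if a \<in> U then b else \<psi> a) p \<in> X"
        using U \<psi> by (auto simp: p X_def Us_def Y_def)
    qed
    show "(\<lambda>\<phi>. ({a\<in>A. \<phi> a = b}, restrict \<phi> (A - {a\<in>A. \<phi> a = b}))) ` X \<subseteq> (SIGMA U:Us. Y U)"
    proof (rule image_subsetI)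
      fix \<phi> assume \<phi>: "\<phi> \<in> X"
      let ?U = "{a\<in>A. \<phi> a = b}"
      have "{a \<in> A - ?U. restrict \<phi> (A - ?U) a = w} = {a\<in>A. \<phi> a = w}" if "w \<in> B" for w
        using that insert.hyps(2) by auto
      moreover have "restrict \<phi> (A - ?U) \<in> (A - ?U) \<rightarrow>\<^sub>E B" using \<phi> by (auto simp: X_def)
      ultimately have "restrict \<phi> (A - ?U) \<in> Y ?U" using \<phi> by (auto simp: X_def Y_def)
      moreover have "?U \<in> Us" using \<phi> by (auto simp: X_def Us_def)
      ultimately show "(?U, restrict \<phi> (A - ?U)) \<in> (SIGMA U:Us. Y U)" by simp
    qed
  qed
  then have "card X = card (SIGMA U:Us. Y U)" by (rule bij_betw_same_card[symmetric])
  also have "\<dots> = (\<Sum>U\<in>Us. card (Y U))"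
    using finUs finY insert.prems by (intro card_SigmaI) auto
  finally have "of_nat (card X) = (\<Sum>U\<in>Us. of_nat (card (Y U)) :: complex)" by simp
  also have "\<dots> = (\<Sum>U\<in>Us. fact (card A - card U) * fps_nth (\<Prod>w\<in>B. egf (S w)) (card A - card U))"
  proof (rule sum.cong[OF refl])
    fix U assume U: "U \<in> Us"
    have "card (A - U) = card A - card U"
      using U insert.prems by (auto simp: Us_def card_Diff_subset finite_subset)
    then show "of_nat (card (Y U)) = fact (card A - card U) * (fps_nth (\<Prod>w\<in>B. egf (S w)) (card A - card U) :: complex)"
      using insert.IH[of "A - U"] insert.prems unfolding Y_def by simp
  qed
  also have "\<dots> = (\<Sum>U\<in>Pow A. if card U \<in> S b then fact (card A - card U) * fps_nth (\<Prod>w\<in>B. egf (S w)) (card A - card U) else 0)"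
    unfolding Us_def using insert.prems by (intro sum.inter_filter) auto
  also have "\<dots> = (\<Sum>i\<le>card A. of_nat (card A choose i) * (if i \<in> S b then fact (card A - i) * fps_nth (\<Prod>w\<in>B. egf (S w)) (card A - i) else 0))"
    by (rule sum_Pow_card) (rule insert.prems)
  also have "\<dots> = (\<Sum>i\<le>card A. fact (card A) * (fps_nth (egf (S b)) i * fps_nth (\<Prod>w\<in>B. egf (S w)) (card A - i)))"
    by (intro sum.cong) (auto simp: binomial_fact)
  also have "\<dots> = fact (card A) * fps_nth (\<Prod>w\<in>insert b B. egf (S w)) (card A)"
    using insert.hyps by (simp add: fps_mult_nth sum_distrib_left atMost_atLeast0)
  finally show ?case unfolding X_def .
qed

section \<open>Placements of a pattern and the multigraphs that realize them\<close>

lemma card_inj_PiE: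
  "finite A \<Longrightarrow> finite B \<Longrightarrow> card {f \<in> A \<rightarrow>\<^sub>E B. inj_on f A} = (\<Prod>i<card A. card B - i)"
  by (subst card_inj_on_subset_funcset) (auto simp: atLeast0LessThan)

text \<open>Placements of labels without any incidence condition, so that their number depends only
  on the sizes of J; incidence is left to \<open>realizes\<close>.\<close>

definition embeddings :: "('a, 'b) pre_digraph \<Rightarrow> nat \<Rightarrow> nat \<Rightarrow> (('a \<Rightarrow> nat) \<times> ('b \<Rightarrow> nat)) set" where
  "embeddings J n m = {f \<in> verts J \<rightarrow>\<^sub>E {1..n}. inj_on f (verts J)} \<times> {g \<in> arcs J \<rightarrow>\<^sub>E {1..m}. inj_on g (arcs J)}"

definition realizes :: "(nat, nat) pre_digraph \<Rightarrow> ('a, 'b) pre_digraph \<Rightarrow> ('a \<Rightarrow> nat) \<times> ('b \<Rightarrow> nat) \<Rightarrow> bool" where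
  "realizes G J = (\<lambda>(f, g). \<forall>e\<in>arcs J. tail G (g e) = f (tail J e) \<and> head G (g e) = f (head J e))"

text \<open>Counts the further half-edges that the pattern vertices may receive. By
  \<open>higher_deriv_Delta\<close> its value is the product of the derivatives of
  \<open>\<Delta>\<close> of the orders given by the degrees.\<close>

definition residual_egf :: "nat set \<Rightarrow> ('a, 'b) pre_digraph \<Rightarrow> complex fps" where
  "residual_egf D J = (\<Prod>v\<in>verts J. egf {d. d + vdeg J v \<in> D})"

text \<open>A half-edge is an edge with a Boolean, \<open>True\<close> for its tail, so a loop
  counts twice. The degree splits into free half-edges and those forced by the pattern.\<close>

lemma vdeg_realizes:
  assumes G: "arcs G = {1..m}" and r: "realizes G J (f, g)" and fin: "finite (arcs J)"
    and g: "inj_on g (arcs J)" "g ` arcs J \<subseteq> {1..m}"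
  shows "vdeg G w = card {a \<in> ({1..m} - g ` arcs J) \<times> UNIV. (case a of (e, b) \<Rightarrow> if b then tail G e else head G e) = w}
     + (card {e \<in> arcs J. f (head J e) = w} + card {e \<in> arcs J. f (tail J e) = w})"
proof -
  have split: "card {e \<in> {1..m}. h e = w} = card {e \<in> {1..m} - g ` arcs J. h e = w} + card {e \<in> arcs J. h (g e) = w}" for h
  proof -
    have "{e \<in> {1..m}. h e = w} = {e \<in> {1..m} - g ` arcs J. h e = w} \<union> g ` {e \<in> arcs J. h (g e) = w}"
      using g by auto
    moreover have "card (g ` {e \<in> arcs J. h (g e) = w}) = card {e \<in> arcs J. h (g e) = w}"
      using g by (intro card_image) (auto intro: inj_on_subset)
    moreover have "card ({e \<in> {1..m} - g ` arcs J. h e = w} \<union> g ` {e \<in> arcs J. h (g e) = w}) =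
       card {e \<in> {1..m} - g ` arcs J. h e = w} + card (g ` {e \<in> arcs J. h (g e) = w})"
      using fin by (intro card_Un_disjoint) auto
    ultimately show ?thesis by (simp only:)
  qed
  let ?R = "{1..m} - g ` arcs J"
  have "{a \<in> ?R \<times> UNIV. (case a of (e, b) \<Rightarrow> if b then tail G e else head G e) = w} = 
     {e \<in> ?R. tail G e = w} \<times> {True} \<union> {e \<in> ?R. head G e = w} \<times> {False}" by (auto split: if_splits)
  then have A: "card {a \<in> ?R \<times> UNIV. (case a of (e, b) \<Rightarrow> if b then tail G e else head G e) = w}
     = card {e \<in> ?R. tail G e = w} + card {e \<in> ?R. head G e = w}"
    by (simp add: card_Un_disjoint card_cartesian_product disjoint_iff)
  have "{e \<in> arcs J. head G (g e) = w} = {e \<in> arcs J. f (head J e) = w}"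
    "{e \<in> arcs J. tail G (g e) = w} = {e \<in> arcs J. f (tail J e) = w}" using r by (auto simp: realizes_def)
  then show ?thesis
    unfolding A vdeg_def in_degree_def out_degree_def in_arcs_def out_arcs_def G split by simp
qed

text \<open>Realizing a placement leaves free exactly the half-edges of the other m - e edges.
  Assigning them to vertices is a function with restricted fibre sizes: in D at untouched vertices,
  in D lowered by the pattern degree elsewhere. The count is therefore the same for all
  placements.\<close>

lemma card_multigraphs_realizing:
  assumes wf: "wf_digraph J" and fin: "finite (verts J)" "finite (arcs J)"
    and fg: "(f, g) \<in> embeddings J n m"
  shows "of_nat (card {G \<in> multigraphs_deg_in n m D. realizes G J (f, g)}) =
     fact (2 * m - 2 * card (arcs J)) * (fps_nth (egf D ^ (n - card (verts J)) * residual_egf D J) (2 * m - 2 * card (arcs J)) :: complex)"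
proof -
  interpret wf_digraph J by (rule wf)
  have f: "f \<in> verts J \<rightarrow>\<^sub>E {1..n}" "inj_on f (verts J)" and g: "g \<in> arcs J \<rightarrow>\<^sub>E {1..m}" "inj_on g (arcs J)"
    using fg by (auto simp: embeddings_def)
  define R where "R = {1..m} - g ` arcs J"
  define A where "A = R \<times> (UNIV :: bool set)"
  define c where "c = (\<lambda>w. card {e \<in> arcs J. f (head J e) = w} + card {e \<in> arcs J. f (tail J e) = w})"
  define S where "S = (\<lambda>w. {d. d + c w \<in> D})"
  define X where "X = {\<phi> \<in> A \<rightarrow>\<^sub>E {1..n}. \<forall>w\<in>{1..n}. card {a\<in>A. \<phi> a = w} \<in> S w}"
  define Y where "Y = {G \<in> multigraphs_deg_in n m D. realizes G J (f, g)}"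
  define gi where "gi = inv_into (arcs J) g"
  have gi: "gi (g e) = e" if "e \<in> arcs J" for e using that g(2) by (simp add: gi_def)
  \<comment> \<open>Pattern edges take their ends from the placement, all other half-edges take
    theirs from \<phi>.\<close>
  define \<Phi> where "\<Phi> = (\<lambda>\<phi> :: nat \<times> bool \<Rightarrow> nat. \<lparr>verts = {1..n}, arcs = {1..m},
     tail = (\<lambda>e. if e \<in> g ` arcs J then f (tail J (gi e)) else \<phi> (e, True)),
     head = (\<lambda>e. if e \<in> g ` arcs J then f (head J (gi e)) else \<phi> (e, False))\<rparr>)"
  define \<Psi> where "\<Psi> = (\<lambda>G :: (nat, nat) pre_digraph. restrict (\<lambda>(e, b). if b then tail G e else head G e) A)"
  have gsub: "g ` arcs J \<subseteq> {1..m}" using g by auto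
  have deg: "vdeg G w = card {a\<in>A. \<Psi> G a = w} + c w" if "arcs G = {1..m}" "realizes G J (f, g)" for G w
  proof -
    have "{a\<in>A. \<Psi> G a = w} = {a \<in> ({1..m} - g ` arcs J) \<times> UNIV. (case a of (e, b) \<Rightarrow> if b then tail G e else head G e) = w}"
      by (auto simp: \<Psi>_def A_def R_def)
    then show ?thesis unfolding c_def using vdeg_realizes[OF that fin(2) g(2) gsub, of w] by simp
  qed
  \<comment> \<open>Outside the edge labels an extensional \<phi> has the default value, exactly
    what \<open>multigraphs\<close> requires of tail and head there.\<close>
  have arb: "\<phi> (e, b) = undefined" if "\<phi> \<in> A \<rightarrow>\<^sub>E {1..n}" "e \<notin> {1..m}" for \<phi> e b
    by (rule PiE_arb[OF that(1)]) (use that in \<open>auto simp: A_def R_def\<close>)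
  have \<Psi>\<Phi>: "\<Psi> (\<Phi> \<phi>) = \<phi>" if "\<phi> \<in> A \<rightarrow>\<^sub>E {1..n}" for \<phi>
  proof
    fix a show "\<Psi> (\<Phi> \<phi>) a = \<phi> a"
      using PiE_arb[OF that, of a] by (cases a) (auto simp: \<Psi>_def \<Phi>_def A_def R_def)
  qed
  have real\<Phi>: "realizes (\<Phi> \<phi>) J (f, g)" for \<phi>
    by (auto simp: realizes_def \<Phi>_def gi)
  have arcs\<Phi>: "arcs (\<Phi> \<phi>) = {1..m}" for \<phi> by (simp add: \<Phi>_def)
  have "bij_betw \<Phi> X Y"
  proof (rule bij_betw_byWitness[where f' = \<Psi>])
    show "\<forall>\<phi>\<in>X. \<Psi> (\<Phi> \<phi>) = \<phi>" using \<Psi>\<Phi> by (auto simp: X_def)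
    show "\<forall>G\<in>Y. \<Phi> (\<Psi> G) = G"
    proof
      fix G assume "G \<in> Y"
      then have G: "verts G = {1..n}" "arcs G = {1..m}" "tail G \<in> {1..m} \<rightarrow>\<^sub>E {1..n}" "head G \<in> {1..m} \<rightarrow>\<^sub>E {1..n}"
        "realizes G J (f, g)" by (auto simp: Y_def multigraphs_deg_in_def multigraphs_def)
      have "tail (\<Phi> (\<Psi> G)) = tail G" "head (\<Phi> (\<Psi> G)) = head G"
        using G(5) PiE_arb[OF G(3)] PiE_arb[OF G(4)] 
        by (auto simp: fun_eq_iff \<Phi>_def \<Psi>_def A_def R_def realizes_def gi)
      moreover have "verts (\<Phi> (\<Psi> G)) = verts G" "arcs (\<Phi> (\<Psi> G)) = arcs G" using G by (simp_all add: \<Phi>_def)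
      ultimately show "\<Phi> (\<Psi> G) = G" by (intro pre_digraph.equality) simp_all
    qed
    show "\<Phi> ` X \<subseteq> Y"
    proof (rule image_subsetI)
      fix \<phi> assume "\<phi> \<in> X"
      then have \<phi>: "\<phi> \<in> A \<rightarrow>\<^sub>E {1..n}" "\<And>w. w \<in> {1..n} \<Longrightarrow> card {a\<in>A. \<phi> a = w} \<in> S w" by (auto simp: X_def)
      have "vdeg (\<Phi> \<phi>) w \<in> D" if "w \<in> {1..n}" for w
        using deg[OF arcs\<Phi> real\<Phi>, of \<phi> w] \<phi>(2)[OF that] by (simp add: \<Psi>\<Phi>[OF \<phi>(1)] S_def)
      moreover have "\<Phi> \<phi> \<in> multigraphs n m"
      proof -
        have fv: "f v \<in> {1..n}" if "v \<in> verts J" for v using that f by auto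
        have ph: "\<phi> (e, b) \<in> {1..n}" if "e \<in> {1..m}" "e \<notin> g ` arcs J" for e b
          using that \<phi>(1) by (auto simp: A_def R_def)
        have "tail (\<Phi> \<phi>) \<in> {1..m} \<rightarrow>\<^sub>E {1..n}"
        proof (rule PiE_I)
          fix e assume "e \<in> {1..m}"
          then show "tail (\<Phi> \<phi>) e \<in> {1..n}" using ph[of e] fv by (auto simp: \<Phi>_def gi simp del: atLeastAtMost_iff)
        next
          fix e assume "e \<notin> {1..m}"
          then show "tail (\<Phi> \<phi>) e = undefined" using gsub arb[OF \<phi>(1), of e] by (auto simp: \<Phi>_def)
        qed
        moreover have "head (\<Phi> \<phi>) \<in> {1..m} \<rightarrow>\<^sub>E {1..n}"
        proof (rule PiE_I)
          fix e assume "e \<in> {1..m}"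
          then show "head (\<Phi> \<phi>) e \<in> {1..n}" using ph[of e] fv by (auto simp: \<Phi>_def gi simp del: atLeastAtMost_iff)
        next
          fix e assume "e \<notin> {1..m}"
          then show "head (\<Phi> \<phi>) e = undefined" using gsub arb[OF \<phi>(1), of e] by (auto simp: \<Phi>_def)
        qed
        ultimately show ?thesis by (simp add: multigraphs_def) (simp add: \<Phi>_def)
      qed
      ultimately show "\<Phi> \<phi> \<in> Y" using real\<Phi> by (auto simp: Y_def multigraphs_deg_in_def multigraphs_def)
    qed
    show "\<Psi> ` Y \<subseteq> X"
    proof (rule image_subsetI)
      fix G assume "G \<in> Y"
      then have G: "verts G = {1..n}" "arcs G = {1..m}" "tail G \<in> {1..m} \<rightarrow>\<^sub>E {1..n}" "head G \<in> {1..m} \<rightarrow>\<^sub>E {1..n}"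
        "realizes G J (f, g)" "\<And>w. w \<in> {1..n} \<Longrightarrow> vdeg G w \<in> D" by (auto simp: Y_def multigraphs_deg_in_def multigraphs_def)
      have "\<Psi> G \<in> A \<rightarrow>\<^sub>E {1..n}"
        using PiE_mem[OF G(3)] PiE_mem[OF G(4)] by (auto simp: \<Psi>_def A_def R_def)
      then show "\<Psi> G \<in> X" using G(6) deg[OF G(2,5)] by (auto simp: X_def S_def)
    qed
  qed
  then have "card Y = card X" by (rule bij_betw_same_card[symmetric])
  then have "of_nat (card Y) = fact (card A) * (fps_nth (\<Prod>w\<in>{1..n}. egf (S w)) (card A) :: complex)"
    unfolding X_def by (simp only:) (rule card_functions_with_fibre_sizes; simp add: A_def R_def)
  moreover have "card A = 2 * m - 2 * card (arcs J)"
    using gsub fin card_image[OF g(2)] by (simp add: A_def R_def card_cartesian_product card_Diff_subset diff_mult_distrib)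
  moreover have "(\<Prod>w\<in>{1..n}. egf (S w)) = egf D ^ (n - card (verts J)) * residual_egf D J"
  proof -
    have fsub: "f ` verts J \<subseteq> {1..n}" using f by auto
    have "(\<Prod>w\<in>{1..n}. egf (S w) :: complex fps) = (\<Prod>w\<in>{1..n} - f ` verts J. egf (S w)) * (\<Prod>w\<in>f ` verts J. egf (S w))"
      using fsub by (intro prod.subset_diff) auto
    also have "(\<Prod>w\<in>{1..n} - f ` verts J. egf (S w)) = (\<Prod>w\<in>{1..n} - f ` verts J. egf D :: complex fps)"
    proof (rule prod.cong)
      fix w assume w: "w \<in> {1..n} - f ` verts J"
      have "{e \<in> arcs J. f (head J e) = w} = {}" "{e \<in> arcs J. f (tail J e) = w} = {}" using w by auto
      then have "c w = 0" unfolding c_def by (metis card.empty add_0)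
      then show "egf (S w) = (egf D :: complex fps)" by (simp add: S_def)
    qed simp
    also have "\<dots> = egf D ^ (n - card (verts J))"
      using fsub fin card_image[OF f(2)] by (simp add: card_Diff_subset)
    also have "(\<Prod>w\<in>f ` verts J. egf (S w)) = residual_egf D J"
      unfolding residual_egf_def prod.reindex[OF f(2)] comp_def
    proof (rule prod.cong)
      fix v assume v: "v \<in> verts J"
      have "{e \<in> arcs J. f (head J e) = f v} = in_arcs J v" "{e \<in> arcs J. f (tail J e) = f v} = out_arcs J v"
        using v inj_on_eq_iff[OF f(2)] by (auto simp: in_arcs_def out_arcs_def)
      then have "c (f v) = vdeg J v" by (simp add: c_def vdeg_def in_degree_def out_degree_def)
      then show "egf (S (f v)) = (egf {d. d + vdeg J v \<in> D} :: complex fps)" by (simp add: S_def)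
    qed simp
    finally show ?thesis .
  qed
  ultimately show ?thesis by (simp add: Y_def)
qed

section \<open>Expected number of embeddings\<close>

lemma prod_diff_mult_fact: "k \<le> N \<Longrightarrow> (\<Prod>i<k. N - i) * fact (N - k) = (fact N :: nat)"
proof (induction k)
  case (Suc k)
  then have "fact (N - k) = (N - k) * fact (N - Suc k)"
    by (metis Suc_diff_Suc Suc_le_lessD fact_Suc of_nat_id)
  then show ?case using Suc by (simp add: mult.assoc)
qed simp

lemma prod_diff_asymp:
  assumes "filterlim f at_top sequentially"
  shows "(\<lambda>n. real (\<Prod>i<k. f n - i) / real (f n) ^ k) \<longlonglongrightarrow> 1"
proof -
  have "(\<lambda>n. \<Prod>i<k. real (f n - i) / real (f n)) \<longlonglongrightarrow> (\<Prod>i<k. 1)"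
  proof (rule tendsto_prod)
    fix i
    have "(\<lambda>N. real (N - i) / real N) \<longlonglongrightarrow> 1"
    proof (rule Lim_transform_eventually)
      show "(\<lambda>N. (real N - real i) / real N) \<longlonglongrightarrow> 1" by real_asymp
      show "\<forall>\<^sub>F N in sequentially. (real N - real i) / real N = real (N - i) / real N"
        using eventually_ge_at_top[of i] by eventually_elim (simp add: of_nat_diff)
    qed
    then show "(\<lambda>n. real (f n - i) / real (f n)) \<longlonglongrightarrow> 1"
      using assms by (rule filterlim_compose)
  qed
  then show ?thesis by (simp add: prod_dividef)
qed

lemma finite_multigraphs: "finite (multigraphs n m)"
proof (rule finite_imageD)
  show "finite ((\<lambda>G. (tail G, head G)) ` multigraphs n m)"
    by (rule finite_subset[of _ "({1..m} \<rightarrow>\<^sub>E {1..n}) \<times> ({1..m} \<rightarrow>\<^sub>E {1..n})"])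
       (auto simp: multigraphs_def intro!: finite_PiE)
  show "inj_on (\<lambda>G. (tail G, head G)) (multigraphs n m)"
    by (rule inj_onI, rule pre_digraph.equality) (auto simp: multigraphs_def)
qed

lemma finite_multigraphs_deg_in: "finite (multigraphs_deg_in n m D)"
  by (rule finite_subset[OF _ finite_multigraphs]) (auto simp: multigraphs_deg_in_def)

lemma finite_embeddings:
  assumes "finite (verts J)" "finite (arcs J)"
  shows "finite (embeddings J n m)"
  by (rule finite_subset[of _ "(verts J \<rightarrow>\<^sub>E {1..n}) \<times> (arcs J \<rightarrow>\<^sub>E {1..m})"])
     (use assms in \<open>auto simp: embeddings_def intro!: finite_PiE\<close>)

lemma residual_egf_eval:
  assumes "finite (verts J)"
  shows "fps_conv_radius (residual_egf D J) = \<infinity>"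
    "eval_fps (residual_egf D J) (of_real x) = of_real (\<Prod>v\<in>verts J. Delta {d. d + vdeg J v \<in> D} x)"
proof -
  have "fps_conv_radius (\<Prod>v\<in>V. egf (S v) :: complex fps) = \<infinity> \<and>
     eval_fps (\<Prod>v\<in>V. egf (S v)) (of_real x) = complex_of_real (\<Prod>v\<in>V. Delta (S v) x)" if "finite V" for V :: "'a set" and S
    using that
  proof (induction V rule: finite_induct)
    case (insert v V)
    have "fps_conv_radius (egf (S v) * (\<Prod>v\<in>V. egf (S v) :: complex fps)) = \<infinity>"
      using fps_conv_radius_mult[of "egf (S v) :: complex fps" "\<Prod>v\<in>V. egf (S v)"] insert by simp
    then show ?case using insert cDelta_of_real[of "S v" x]
      by (simp add: eval_fps_mult cDelta_def)
  qed simp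
  from this[OF assms] show "fps_conv_radius (residual_egf D J) = \<infinity>"
    "eval_fps (residual_egf D J) (of_real x) = of_real (\<Prod>v\<in>verts J. Delta {d. d + vdeg J v \<in> D} x)"
    unfolding residual_egf_def by auto
qed

section \<open>Averages over the multigraphs of a fixed degree regime\<close>

locale degree_regime =
  fixes D :: "nat set" and m :: "nat \<Rightarrow> nat" and L :: real
  assumes D_two: "\<exists>a\<in>D. \<exists>b\<in>D. a \<noteq> b"
    and D_gcd: "Gcd ((\<lambda>d. d - Inf D) ` D) = 1"
    and m_lim: "filterlim m at_top sequentially"
    and ratio_lim: "(\<lambda>n. 2 * real (m n) / real n) \<longlonglongrightarrow> L"
    and L_gt: "real (Inf D) < L"
    and L_lt: "ereal L < (SUP d\<in>D. ereal (real d))"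
begin

definition graphs :: "nat \<Rightarrow> (nat, nat) pre_digraph set" where
  "graphs n = multigraphs_deg_in n (m n) D"

text \<open>Expectation under the uniform law. On an empty set of graphs it is 0 by the convention
  for division; by \<open>graphs_nonempty\<close> this concerns only finitely many n.\<close>

definition avg :: "nat \<Rightarrow> ((nat, nat) pre_digraph \<Rightarrow> real) \<Rightarrow> real" where
  "avg n X = (\<Sum>G\<in>graphs n. X G) / real (card (graphs n))"

definition x where "x n = chi D (real (m n) / real n)"

text \<open>The argument of \<open>chi\<close> is m / n, half of the mean degree, hence L / 2 in the
  limit.\<close>

definition x0 where "x0 = chi D (L / 2)"

lemma finite_graphs: "finite (graphs n)"
  unfolding graphs_def by (rule finite_multigraphs_deg_in)

lemma L_pos: "0 < L" using L_gt by (meson le_less_trans of_nat_0_le_iff)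

lemma D_nonempty: "D \<noteq> {}" using D_two by auto

lemma x_tendsto: "x \<longlonglongrightarrow> x0" and x0_pos: "0 < x0"
  and mean_x: "\<forall>\<^sub>F n in sequentially. mean D (x n) = 2 * (real (m n) / real n)"
proof -
  obtain a b where ab: "a \<in> D" "b \<in> D" "a \<noteq> b" using D_two by auto
  have r: "(\<lambda>n. 2 * (real (m n) / real n)) \<longlonglongrightarrow> L" using ratio_lim by simp
  have ex: "\<exists>d\<in>D. L < real d" using L_lt by (simp add: less_SUP_iff)
  obtain z where z: "0 < z" "mean D z = L" "(\<lambda>n. chi D (real (m n) / real n)) \<longlonglongrightarrow> z"
    "\<forall>\<^sub>F n in sequentially. mean D (chi D (real (m n) / real n)) = 2 * (real (m n) / real n)"
    using chi_tendsto[OF ab r L_gt ex] by auto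
  have "x0 = z" unfolding x0_def using z by (intro chi_eqI[OF ab]) auto
  then show "x \<longlonglongrightarrow> x0" "0 < x0" "\<forall>\<^sub>F n in sequentially. mean D (x n) = 2 * (real (m n) / real n)"
    using z by (simp_all add: x_def[abs_def])
qed

lemma Delta_x0_pos: "0 < Delta D x0"
  by (rule Delta_pos[OF x0_pos D_nonempty])

text \<open>Double counting of pairs of a graph and a placement; every placement is realized by the
  same number of graphs.\<close>

lemma sum_realizations:
  assumes "wf_digraph J" "finite (verts J)" "finite (arcs J)"
  shows "of_nat (\<Sum>G\<in>graphs n. card {p \<in> embeddings J n (m n). realizes G J p}) =
    of_nat (card (embeddings J n (m n))) * (fact (2 * m n - 2 * card (arcs J)) *
      (fps_nth (egf D ^ (n - card (verts J)) * residual_egf D J) (2 * m n - 2 * card (arcs J)) :: complex))"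
proof -
  note fin = finite_graphs[of n] finite_embeddings[OF assms(2,3), of n "m n"]
  have "(\<Sum>G\<in>graphs n. card {p \<in> embeddings J n (m n). realizes G J p}) =
     (\<Sum>p\<in>embeddings J n (m n). card {G \<in> graphs n. realizes G J p})"
    using sum_multicount_gen[of "graphs n" "embeddings J n (m n)" "\<lambda>G p. realizes G J p"] fin
    by (simp add: sum_multicount_gen)
  also have "of_nat \<dots> = (\<Sum>p\<in>embeddings J n (m n). fact (2 * m n - 2 * card (arcs J)) *
      (fps_nth (egf D ^ (n - card (verts J)) * residual_egf D J) (2 * m n - 2 * card (arcs J)) :: complex))"
    unfolding of_nat_sum
  proof (rule sum.cong[OF refl])
    fix p assume "p \<in> embeddings J n (m n)"
    then show "of_nat (card {G \<in> graphs n. realizes G J p}) = fact (2 * m n - 2 * card (arcs J)) *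
      (fps_nth (egf D ^ (n - card (verts J)) * residual_egf D J) (2 * m n - 2 * card (arcs J)) :: complex)"
      using card_multigraphs_realizing[OF assms, of "fst p" "snd p" n "m n" D] by (simp add: graphs_def)
  qed
  finally show ?thesis by simp
qed

lemma card_graphs:
  "of_nat (card (graphs n)) = fact (2 * m n) * (fps_nth (egf D ^ n) (2 * m n) :: complex)"
proof -
  \<comment> \<open>The empty pattern: every graph realizes it and its residual series is the empty
    product 1, so the count of realizations becomes the count of all graphs.\<close>
  define J :: "(nat, nat) pre_digraph" where "J = \<lparr>verts = {}, arcs = {}, tail = id, head = id\<rparr>"
  have "wf_digraph J" by unfold_locales (auto simp: J_def)
  moreover have "(\<lambda>_. undefined, \<lambda>_. undefined) \<in> embeddings J n (m n)"
    by (auto simp: embeddings_def J_def)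
  ultimately show ?thesis
    using card_multigraphs_realizing[of J "\<lambda>_. undefined" "\<lambda>_. undefined" n "m n" D]
    by (simp add: J_def realizes_def graphs_def residual_egf_def)
qed

text \<open>The average is the coefficient for J over that for the empty pattern, times the ratio of
  the factorials and the number of placements; \<open>local_limit\<close> gives both coefficients
  with the same K. The limit \<rho> of the power factor stays a hypothesis, so one statement covers
  patterns with as many edges as vertices and patterns with more.\<close>

lemma
  shows graphs_nonempty: "\<forall>\<^sub>F n in sequentially. graphs n \<noteq> {}"
    and avg_realizations: "wf_digraph J \<Longrightarrow> finite (verts J) \<Longrightarrow> finite (arcs J) \<Longrightarrow>
     (\<lambda>n. real n ^ card (verts J) * real (m n) ^ card (arcs J) / (2 * real (m n)) ^ (2 * card (arcs J))) \<longlonglongrightarrow> \<rho> \<Longrightarrow>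
     (\<lambda>n. avg n (\<lambda>G. real (card {p \<in> embeddings J n (m n). realizes G J p}))) \<longlonglongrightarrow>
        \<rho> * (x0 ^ (2 * card (arcs J)) * (\<Prod>v\<in>verts J. Delta {d. d + vdeg J v \<in> D} x0) / Delta D x0 ^ card (verts J))"
proof -
  obtain a b where ab: "a \<in> D" "b \<in> D" "a \<noteq> b" using D_two by auto
  have m2: "filterlim (\<lambda>n. 2 * m n) at_top sequentially"
    by (rule filterlim_at_top_mono[OF m_lim]) auto
  have mean: "\<forall>\<^sub>F n in sequentially. mean D (x n) * n = (2 * m n :: nat)"
    using mean_x eventually_gt_at_top[of 0] by eventually_elim auto
  obtain K where K: "0 < K"
    "\<And>H v s. fps_conv_radius H = \<infinity> \<Longrightarrow>
       (\<lambda>n. of_real (sqrt n * x n ^ (2 * m n - s) / Delta D (x n) ^ (n - v)) * fps_nth (egf D ^ (n - v) * H) (2 * m n - s))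
         \<longlonglongrightarrow> of_real K * eval_fps H (of_real x0 :: complex)"
    using local_limit[OF ab D_gcd x0_pos x_tendsto mean m2] by blast
  \<comment> \<open>Normalized coefficient of the empty pattern. Its limit K is nonzero, which makes
    the set of graphs eventually nonempty and the later division legitimate.\<close>
  define T0 where "T0 = (\<lambda>n. of_real (sqrt n * x n ^ (2 * m n) / Delta D (x n) ^ n) * (fps_nth (egf D ^ n) (2 * m n) :: complex))"
  have T0: "T0 \<longlonglongrightarrow> of_real K" using K(2)[of 1 0 0] by (simp add: T0_def)
  then have ev_T0: "\<forall>\<^sub>F n in sequentially. T0 n \<noteq> 0"
    using K(1) by (intro tendsto_imp_eventually_ne) auto
  have ev_nth: "\<forall>\<^sub>F n in sequentially. fps_nth (egf D ^ n) (2 * m n) \<noteq> (0::complex)"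
    using ev_T0 by eventually_elim (auto simp: T0_def)
  show "\<forall>\<^sub>F n in sequentially. graphs n \<noteq> {}"
    using ev_nth
  proof eventually_elim
    case (elim n)
    then have "of_nat (card (graphs n)) \<noteq> (0::complex)" unfolding card_graphs by simp
    then show ?case by auto
  qed
  assume J: "wf_digraph J" "finite (verts J)" "finite (arcs J)"
    and \<rho>: "(\<lambda>n. real n ^ card (verts J) * real (m n) ^ card (arcs J) / (2 * real (m n)) ^ (2 * card (arcs J))) \<longlonglongrightarrow> \<rho>"
  define v e where "v = card (verts J)" and "e = card (arcs J)"
  define H where "H = residual_egf D J"
  define T where "T = (\<lambda>n. of_real (sqrt n * x n ^ (2 * m n - 2 * e) / Delta D (x n) ^ (n - v)) * (fps_nth (egf D ^ (n - v) * H) (2 * m n - 2 * e)))"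
  have T: "T \<longlonglongrightarrow> of_real K * of_real (\<Prod>v\<in>verts J. Delta {d. d + vdeg J v \<in> D} x0)"
    unfolding T_def H_def using K(2)[of "residual_egf D J" "2 * e" v] residual_egf_eval[OF J(2), of D] by simp
  \<comment> \<open>Number of placements times (2m - 2e)! / (2m)!, written with falling
    factorials.\<close>
  define q where "q = (\<lambda>n. real (\<Prod>i<v. n - i) * real (\<Prod>i<e. m n - i) / real (\<Prod>i<2 * e. 2 * m n - i))"
  have q: "q \<longlonglongrightarrow> \<rho>"
  proof -
    have "(\<lambda>n. (real (\<Prod>i<v. n - i) / real n ^ v) * (real (\<Prod>i<e. m n - i) / real (m n) ^ e) / (real (\<Prod>i<2 * e. 2 * m n - i) / real (2 * m n) ^ (2 * e))
       * (real n ^ v * real (m n) ^ e / (2 * real (m n)) ^ (2 * e))) \<longlonglongrightarrow> 1 * 1 / 1 * \<rho>"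
      using \<rho> unfolding v_def e_def
      by (intro tendsto_mult tendsto_divide prod_diff_asymp m_lim m2 filterlim_ident) auto
    then have "(\<lambda>n. (real (\<Prod>i<v. n - i) / real n ^ v) * (real (\<Prod>i<e. m n - i) / real (m n) ^ e) / (real (\<Prod>i<2 * e. 2 * m n - i) / real (2 * m n) ^ (2 * e))
       * (real n ^ v * real (m n) ^ e / (2 * real (m n)) ^ (2 * e))) \<longlonglongrightarrow> \<rho>" by simp
    moreover have "\<forall>\<^sub>F n in sequentially. (real (\<Prod>i<v. n - i) / real n ^ v) * (real (\<Prod>i<e. m n - i) / real (m n) ^ e) / (real (\<Prod>i<2 * e. 2 * m n - i) / real (2 * m n) ^ (2 * e))
       * (real n ^ v * real (m n) ^ e / (2 * real (m n)) ^ (2 * e)) = q n"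
      using eventually_gt_at_top[of 0] filterlim_at_top[THEN iffD1, OF m_lim, rule_format, of 1]
    proof eventually_elim
      case (elim n)
      have "(A / B) * (C / E) / (F / G) * (B * E / G) = A * C / F" if "B \<noteq> 0" "E \<noteq> 0" "G \<noteq> 0" for A B C E F G :: real
        using that by (simp add: field_simps)
      from this[of "real n ^ v" "real (m n) ^ e" "(2 * real (m n)) ^ (2 * e)"] show ?case
        using elim by (simp add: q_def)
    qed
    ultimately show ?thesis by (rule Lim_transform_eventually)
  qed
  have "(\<lambda>n. of_real (q n * (x n ^ (2 * e) / Delta D (x n) ^ v)) * (T n / T0 n)) \<longlonglongrightarrow>
     of_real (\<rho> * (x0 ^ (2 * e) / Delta D x0 ^ v)) * ((of_real K * of_real (\<Prod>v\<in>verts J. Delta {d. d + vdeg J v \<in> D} x0)) / of_real K)"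
    using K(1) Delta_x0_pos by (intro tendsto_intros q x_tendsto tendsto_Delta T T0) auto
  also have "of_real (\<rho> * (x0 ^ (2 * e) / Delta D x0 ^ v)) * ((of_real K * of_real (\<Prod>v\<in>verts J. Delta {d. d + vdeg J v \<in> D} x0)) / of_real K) =
     complex_of_real (\<rho> * (x0 ^ (2 * e) * (\<Prod>v\<in>verts J. Delta {d. d + vdeg J v \<in> D} x0) / Delta D x0 ^ v))"
    using K(1) by simp
  finally have lim: "(\<lambda>n. of_real (q n * (x n ^ (2 * e) / Delta D (x n) ^ v)) * (T n / T0 n)) \<longlonglongrightarrow>
    complex_of_real (\<rho> * (x0 ^ (2 * e) * (\<Prod>v\<in>verts J. Delta {d. d + vdeg J v \<in> D} x0) / Delta D x0 ^ v))" .
  have "\<forall>\<^sub>F n in sequentially. of_real (q n * (x n ^ (2 * e) / Delta D (x n) ^ v)) * (T n / T0 n) =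
     of_real (avg n (\<lambda>G. real (card {p \<in> embeddings J n (m n). realizes G J p})))"
    using ev_nth eventually_ge_at_top[of v] eventually_gt_at_top[of 0] 
      filterlim_at_top[THEN iffD1, OF m_lim, rule_format, of e] order_tendstoD(1)[OF x_tendsto x0_pos]
  proof eventually_elim
    case (elim n)
    have d: "Delta D (x n) > 0" by (rule Delta_pos[OF elim(5) D_nonempty])
    define N1 where "N1 = fps_nth (egf D ^ (n - v) * H) (2 * m n - 2 * e)"
    define N0 where "N0 = (fps_nth (egf D ^ n) (2 * m n) :: complex)"
    have xe: "x n ^ (2 * m n) = x n ^ (2 * m n - 2 * e) * x n ^ (2 * e)"
      using elim by (simp flip: power_add)
    have de: "Delta D (x n) ^ n = Delta D (x n) ^ (n - v) * Delta D (x n) ^ v"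
      using elim by (simp flip: power_add)
    have TT: "of_real (x n ^ (2 * e) / Delta D (x n) ^ v) * (T n / T0 n) = N1 / N0"
      unfolding T_def T0_def xe de N1_def[symmetric] N0_def[symmetric] using elim d by (simp add: field_simps)
    have "complex_of_real (q n) = of_nat (card (embeddings J n (m n))) * fact (2 * m n - 2 * e) / fact (2 * m n)"
    proof -
      have "card (embeddings J n (m n)) = (\<Prod>i<v. n - i) * (\<Prod>i<e. m n - i)"
        unfolding embeddings_def card_cartesian_product v_def e_def using J by (simp add: card_inj_PiE)
      moreover have "(fact (2 * m n) :: complex) = of_nat (\<Prod>i<2 * e. 2 * m n - i) * fact (2 * m n - 2 * e)"
        using prod_diff_mult_fact[of "2 * e" "2 * m n"] elim(4) by (metis mult_le_mono2 of_nat_fact of_nat_mult)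
      ultimately show ?thesis by (simp add: q_def)
    qed
    moreover have "complex_of_real (avg n (\<lambda>G. real (card {p \<in> embeddings J n (m n). realizes G J p}))) =
       of_nat (card (embeddings J n (m n))) * (fact (2 * m n - 2 * e) * N1) / (fact (2 * m n) * N0)"
      using sum_realizations[OF J, of n] card_graphs[of n] 
      by (simp add: avg_def N1_def N0_def H_def e_def v_def)
    moreover have "of_real (q n * (x n ^ (2 * e) / Delta D (x n) ^ v)) * (T n / T0 n) = of_real (q n) * (N1 / N0)"
      unfolding TT[symmetric] by simp
    ultimately show ?case by simp
  qed
  from Lim_transform_eventually[OF lim this]
  show "(\<lambda>n. avg n (\<lambda>G. real (card {p \<in> embeddings J n (m n). realizes G J p}))) \<longlonglongrightarrow>
        \<rho> * (x0 ^ (2 * card (arcs J)) * (\<Prod>v\<in>verts J. Delta {d. d + vdeg J v \<in> D} x0) / Delta D x0 ^ card (verts J))"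
    unfolding v_def e_def by (simp only: tendsto_of_real_iff)
qed

end

section \<open>Embeddings and automorphisms\<close>

text \<open>A sub-multigraph represented by its vertex and edge sets alone, which makes unions and
  intersections of sub-multigraphs plain set operations.\<close>

definition closed_pair :: "('a, 'b) pre_digraph \<Rightarrow> 'a set \<times> 'b set \<Rightarrow> bool" where
  "closed_pair G = (\<lambda>(V, E). V \<subseteq> verts G \<and> E \<subseteq> arcs G \<and> (\<forall>e\<in>E. tail G e \<in> V \<and> head G e \<in> V))"

definition copies :: "('a, 'b) pre_digraph \<Rightarrow> ('c, 'd) pre_digraph \<Rightarrow> ('c, 'd) pre_digraph set" where
  "copies F G = {H. subgraph H G \<and> multigraph_iso H F}"

text \<open>Modelled on \<open>automorphism_triples\<close>: for a loop of F both choices of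
  membership in R are allowed, so both counts treat loops alike and their quotient is the number of
  copies.\<close>

definition embedding_triples ::
  "('a, 'b) pre_digraph \<Rightarrow> ('c, 'd) pre_digraph \<Rightarrow> (('a \<Rightarrow> 'c) \<times> ('b \<Rightarrow> 'd) \<times> 'b set) set" where
  "embedding_triples F G = {(f, g, R). f \<in> verts F \<rightarrow>\<^sub>E verts G \<and> inj_on f (verts F) \<and>
     g \<in> arcs F \<rightarrow>\<^sub>E arcs G \<and> inj_on g (arcs F) \<and> R \<subseteq> arcs F \<and>
     (\<forall>e\<in>arcs F. (tail G (g e), head G (g e)) =
        (if e \<in> R then (f (head F e), f (tail F e)) else (f (tail F e), f (head F e))))}"

definition image_subgraph ::
  "('a, 'b) pre_digraph \<Rightarrow> ('c, 'd) pre_digraph \<Rightarrow> ('a \<Rightarrow> 'c) \<times> ('b \<Rightarrow> 'd) \<times> 'b set \<Rightarrow> ('c, 'd) pre_digraph" where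
  "image_subgraph F G = (\<lambda>(f, g, R). \<lparr>verts = f ` verts F, arcs = g ` arcs F, tail = tail G, head = head G\<rparr>)"

lemma finite_embedding_triples:
  assumes "finite (verts F)" "finite (arcs F)" "finite (verts G)" "finite (arcs G)"
  shows "finite (embedding_triples F G)"
  by (rule finite_subset[of _ "(verts F \<rightarrow>\<^sub>E verts G) \<times> (arcs F \<rightarrow>\<^sub>E arcs G) \<times> Pow (arcs F)"])
     (use assms in \<open>auto simp: embedding_triples_def intro!: finite_PiE\<close>)

lemma copies_eqI:
  assumes "H \<in> copies F G" "H' \<in> copies F G" "verts H = verts H'" "arcs H = arcs H'"
  shows "H = H'"
  using assms by (intro pre_digraph.equality) (auto simp: copies_def subgraph_def compatible_def)

lemma finite_copies:
  assumes "finite (verts G)" "finite (arcs G)"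
  shows "finite (copies F G)"
proof (rule finite_imageD)
  show "finite ((\<lambda>H. (verts H, arcs H)) ` copies F G)"
    by (rule finite_subset[of _ "Pow (verts G) \<times> Pow (arcs G)"])
       (use assms in \<open>auto simp: copies_def subgraph_def\<close>)
  show "inj_on (\<lambda>H. (verts H, arcs H)) (copies F G)"
    by (rule inj_onI) (auto intro: copies_eqI)
qed

lemma image_subgraph_in_copies:
  assumes F: "wf_digraph F" and G: "wf_digraph G" and p: "p \<in> embedding_triples F G"
  shows "image_subgraph F G p \<in> copies F G"
proof -
  interpret F: wf_digraph F by (rule F)
  obtain f g R where p_eq: "p = (f, g, R)" by (cases p)
  have f: "f \<in> verts F \<rightarrow>\<^sub>E verts G" "inj_on f (verts F)" and g: "g \<in> arcs F \<rightarrow>\<^sub>E arcs G" "inj_on g (arcs F)"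
    and e: "\<And>e. e \<in> arcs F \<Longrightarrow> (tail G (g e), head G (g e)) =
        (if e \<in> R then (f (head F e), f (tail F e)) else (f (tail F e), f (head F e)))"
    using p by (auto simp: p_eq embedding_triples_def)
  let ?H = "image_subgraph F G p"
  have H: "verts ?H = f ` verts F" "arcs ?H = g ` arcs F" "tail ?H = tail G" "head ?H = head G"
    by (simp_all add: image_subgraph_def p_eq)
  have ends: "tail G (g e) \<in> f ` verts F \<and> head G (g e) \<in> f ` verts F" if "e \<in> arcs F" for e
    using e[OF that] that by (auto split: if_splits)
  have "wf_digraph ?H" by unfold_locales (use ends H in auto)
  then have "subgraph ?H G" using f g G by (auto simp: subgraph_def compatible_def H)
  moreover have "multigraph_iso ?H F"
    unfolding multigraph_iso_def
  proof (intro exI conjI ballI)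
    show "bij_betw (inv_into (verts F) f) (verts ?H) (verts F)" "bij_betw (inv_into (arcs F) g) (arcs ?H) (arcs F)"
      unfolding H using f g by (auto intro!: bij_betw_inv_into inj_on_imp_bij_betw)
    fix d assume "d \<in> arcs ?H"
    then obtain e' where d: "d = g e'" "e' \<in> arcs F" by (auto simp: H)
    have "inv_into (arcs F) g d = e'" using d g by simp
    then show "{tail F (inv_into (arcs F) g d), head F (inv_into (arcs F) g d)} =
       {inv_into (verts F) f (tail ?H d), inv_into (verts F) f (head ?H d)}"
      using e[OF d(2)] d f by (auto simp: H split: if_splits)
  qed
  ultimately show ?thesis by (simp add: copies_def)
qed

lemma copy_embedding_exists:
  assumes F: "wf_digraph F" and H: "H \<in> copies F G"
  shows "\<exists>p\<in>embedding_triples F G. image_subgraph F G p = H"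
proof -
  interpret F: wf_digraph F by (rule F)
  obtain f g where f: "bij_betw f (verts H) (verts F)" and g: "bij_betw g (arcs H) (arcs F)"
    and fg: "\<And>e. e \<in> arcs H \<Longrightarrow> {tail F (g e), head F (g e)} = {f (tail H e), f (head H e)}"
    using H by (auto simp: copies_def multigraph_iso_def)
  have sub: "verts H \<subseteq> verts G" "arcs H \<subseteq> arcs G" "tail H = tail G" "head H = head G" "wf_digraph H"
    using H by (auto simp: copies_def subgraph_def compatible_def)
  interpret H: wf_digraph H by (rule sub(5))
  define f0 where "f0 = restrict (inv_into (verts H) f) (verts F)"
  define g0 where "g0 = restrict (inv_into (arcs H) g) (arcs F)"
  have f0: "bij_betw f0 (verts F) (verts H)"
    using bij_betw_inv_into[OF f] by (simp add: f0_def bij_betw_def inj_on_restrict_eq image_restrict_eq)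
  have g0: "bij_betw g0 (arcs F) (arcs H)"
    using bij_betw_inv_into[OF g] by (simp add: g0_def bij_betw_def inj_on_restrict_eq image_restrict_eq)
  have f0f: "f0 (f v) = v" if "v \<in> verts H" for v
    using that f bij_betwE[OF f] by (auto simp: f0_def bij_betw_def)
  \<comment> \<open>Reverse an edge only if its orientation does not already match; in particular
    loops are left out of R.\<close>
  define R where "R = {e\<in>arcs F. \<not> (tail G (g0 e) = f0 (tail F e) \<and> head G (g0 e) = f0 (head F e))}"
  have ends: "(tail G (g0 e) = f0 (tail F e) \<and> head G (g0 e) = f0 (head F e)) \<or>
      (tail G (g0 e) = f0 (head F e) \<and> head G (g0 e) = f0 (tail F e))" if "e \<in> arcs F" for e
  proof -
    have e': "g0 e \<in> arcs H" using bij_betwE[OF g0] that by auto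
    have "g (g0 e) = e" using that g by (simp add: g0_def bij_betw_def f_inv_into_f)
    then have "{tail F e, head F e} = {f (tail H (g0 e)), f (head H (g0 e))}" using fg[OF e'] by simp
    then show ?thesis
      using f0f[OF H.tail_in_verts[OF e']] f0f[OF H.head_in_verts[OF e']] by (auto simp: doubleton_eq_iff sub)
  qed
  have "(f0, g0, R) \<in> embedding_triples F G"
    unfolding embedding_triples_def
  proof (clarsimp, intro conjI ballI impI)
    show "f0 \<in> verts F \<rightarrow>\<^sub>E verts G" "g0 \<in> arcs F \<rightarrow>\<^sub>E arcs G"
      using bij_betwE[OF f0] bij_betwE[OF g0] sub by (auto simp: f0_def g0_def)
    show "inj_on f0 (verts F)" "inj_on g0 (arcs F)" using f0 g0 by (auto simp: bij_betw_def)
    show "R \<subseteq> arcs F" by (auto simp: R_def)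
  qed (use ends in \<open>auto simp: R_def\<close>)
  moreover have "image_subgraph F G (f0, g0, R) = H"
    using f0 g0 sub by (intro pre_digraph.equality) (auto simp: image_subgraph_def bij_betw_def)
  ultimately show ?thesis by blast
qed

text \<open>The automorphisms act simply transitively on the embeddings with a given image.\<close>

lemma card_embeddings_of_copy:
  assumes F: "wf_digraph F" and H: "H \<in> copies F G"
  shows "card {p \<in> embedding_triples F G. image_subgraph F G p = H} = card (automorphism_triples F)"
proof -
  interpret F: wf_digraph F by (rule F)
  obtain f0 g0 R0 where p0: "(f0, g0, R0) \<in> embedding_triples F G" "image_subgraph F G (f0, g0, R0) = H"
    using copy_embedding_exists[OF F H] by auto
  define V E where "V = verts F" and "E = arcs F"
  have f0: "f0 \<in> V \<rightarrow>\<^sub>E verts G" "inj_on f0 V" and g0: "g0 \<in> E \<rightarrow>\<^sub>E arcs G" "inj_on g0 E" and R0: "R0 \<subseteq> E"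
    and e0: "\<And>e. e \<in> E \<Longrightarrow> (tail G (g0 e), head G (g0 e)) =
        (if e \<in> R0 then (f0 (head F e), f0 (tail F e)) else (f0 (tail F e), f0 (head F e)))"
    using p0(1) by (auto simp: embedding_triples_def V_def E_def)
  have HV: "verts H = f0 ` V" and HE: "arcs H = g0 ` E"
    using p0(2) by (auto simp: image_subgraph_def V_def E_def)
  define Q where "Q = {p \<in> embedding_triples F G. image_subgraph F G p = H}"
  \<comment> \<open>Precompose the fixed embedding with an automorphism. An edge ends up reversed if
    exactly one of the two steps reverses it, hence the exclusive or with R0 at the image
    edge.\<close>
  define \<Phi> where "\<Phi> = (\<lambda>(\<sigma>, \<tau>, R). (restrict (f0 \<circ> \<sigma>) V, restrict (g0 \<circ> \<tau>) E, {e\<in>E. (e \<in> R) \<noteq> (\<tau> e \<in> R0)}))"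
  have ends: "tail F e \<in> V" "head F e \<in> V" if "e \<in> E" for e using that by (auto simp: V_def E_def)
  have "bij_betw \<Phi> (automorphism_triples F) Q"
    unfolding bij_betw_def
  proof (intro conjI equalityI subsetI)
    show "inj_on \<Phi> (automorphism_triples F)"
    proof (rule inj_onI)
      fix a a' assume a: "a \<in> automorphism_triples F" "a' \<in> automorphism_triples F" "\<Phi> a = \<Phi> a'"
      obtain \<sigma> \<tau> R \<sigma>' \<tau>' R' where eq: "a = (\<sigma>, \<tau>, R)" "a' = (\<sigma>', \<tau>', R')" by (cases a, cases a')
      have p: "\<sigma> permutes V" "\<tau> permutes E" "R \<subseteq> E" "\<sigma>' permutes V" "\<tau>' permutes E" "R' \<subseteq> E"
        using a by (auto simp: eq automorphism_triples_def V_def E_def)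
      have "restrict (f0 \<circ> \<sigma>) V = restrict (f0 \<circ> \<sigma>') V" "restrict (g0 \<circ> \<tau>) E = restrict (g0 \<circ> \<tau>') E"
        and R: "{e\<in>E. (e \<in> R) \<noteq> (\<tau> e \<in> R0)} = {e\<in>E. (e \<in> R') \<noteq> (\<tau>' e \<in> R0)}"
        using a(3) by (auto simp: \<Phi>_def eq)
      then have 1: "f0 (\<sigma> v) = f0 (\<sigma>' v)" if "v \<in> V" for v using that by (metis comp_apply restrict_apply')
      have 2: "g0 (\<tau> e) = g0 (\<tau>' e)" if "e \<in> E" for e
        using \<open>restrict (g0 \<circ> \<tau>) E = restrict (g0 \<circ> \<tau>') E\<close> that by (metis comp_apply restrict_apply')
      have s: "\<sigma> v = \<sigma>' v" for v
        using 1[of v] inj_onD[OF f0(2)] permutes_in_image[OF p(1)] permutes_in_image[OF p(4)]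
          permutes_not_in[OF p(1), of v] permutes_not_in[OF p(4), of v] by (cases "v \<in> V") auto
      have t: "\<tau> e = \<tau>' e" for e
        using 2[of e] inj_onD[OF g0(2)] permutes_in_image[OF p(2)] permutes_in_image[OF p(5)]
          permutes_not_in[OF p(2), of e] permutes_not_in[OF p(5), of e] by (cases "e \<in> E") auto
      have "R = R'" using R p(3,6) unfolding t by blast
      then show "a = a'" using s t by (simp add: eq fun_eq_iff)
    qed
  next
    fix q assume "q \<in> \<Phi> ` automorphism_triples F"
    then obtain \<sigma> \<tau> R where a: "(\<sigma>, \<tau>, R) \<in> automorphism_triples F" "q = \<Phi> (\<sigma>, \<tau>, R)" by auto
    have p: "\<sigma> permutes V" "\<tau> permutes E" "R \<subseteq> E" and
      e: "\<And>e. e \<in> E \<Longrightarrow> (tail F (\<tau> e), head F (\<tau> e)) =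
        (if e \<in> R then (\<sigma> (head F e), \<sigma> (tail F e)) else (\<sigma> (tail F e), \<sigma> (head F e)))"
      using a by (auto simp: automorphism_triples_def V_def E_def)
    have \<sigma>V: "\<sigma> ` V = V" and \<tau>E: "\<tau> ` E = E" using p by (auto simp: permutes_image)
    have ti: "\<tau> e \<in> E" if "e \<in> E" for e using that p(2) by (simp add: permutes_in_image)
    define f g where "f = restrict (f0 \<circ> \<sigma>) V" and "g = restrict (g0 \<circ> \<tau>) E"
    have q: "q = (f, g, {e\<in>E. (e \<in> R) \<noteq> (\<tau> e \<in> R0)})" by (simp add: a \<Phi>_def f_def g_def)
    have fV: "f ` V = f0 ` V" and gE: "g ` E = g0 ` E"
      unfolding f_def g_def image_restrict_eq image_comp[symmetric] \<sigma>V \<tau>E by simp_all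
    have "f \<in> V \<rightarrow>\<^sub>E verts G" "g \<in> E \<rightarrow>\<^sub>E arcs G"
      using f0 g0 p by (auto simp: f_def g_def permutes_in_image)
    moreover have "inj_on f V" "inj_on g E"
      unfolding f_def g_def inj_on_restrict_eq
      using f0 g0 p by (auto intro!: comp_inj_on permutes_inj_on simp: \<sigma>V \<tau>E)
    moreover have "(tail G (g e), head G (g e)) = (if e \<in> {e\<in>E. (e \<in> R) \<noteq> (\<tau> e \<in> R0)} 
       then (f (head F e), f (tail F e)) else (f (tail F e), f (head F e)))" if "e \<in> E" for e
      using e0[OF ti[OF that]] e[OF that] that ends[OF that] by (auto simp: f_def g_def split: if_splits)
    ultimately have "q \<in> embedding_triples F G"
      unfolding q embedding_triples_def V_def[symmetric] E_def[symmetric] by blast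
    moreover have "image_subgraph F G q = H"
      unfolding p0(2)[symmetric] by (simp add: image_subgraph_def q fV gE flip: V_def E_def)
    ultimately show "q \<in> Q" by (simp add: Q_def)
  next
    fix q assume q: "q \<in> Q"
    obtain f g R where q_eq: "q = (f, g, R)" by (cases q)
    have f: "f \<in> V \<rightarrow>\<^sub>E verts G" "inj_on f V" and g: "g \<in> E \<rightarrow>\<^sub>E arcs G" "inj_on g E" and R: "R \<subseteq> E"
      and e: "\<And>e. e \<in> E \<Longrightarrow> (tail G (g e), head G (g e)) =
          (if e \<in> R then (f (head F e), f (tail F e)) else (f (tail F e), f (head F e)))"
      and fV: "f ` V = f0 ` V" and gE: "g ` E = g0 ` E"
      using q HV HE by (auto simp: Q_def q_eq embedding_triples_def V_def E_def image_subgraph_def)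
    define \<sigma> where "\<sigma> = (\<lambda>v. if v \<in> V then inv_into V f0 (f v) else v)"
    define \<tau> where "\<tau> = (\<lambda>e. if e \<in> E then inv_into E g0 (g e) else e)"
    have s1: "\<sigma> v \<in> V" "f0 (\<sigma> v) = f v" if "v \<in> V" for v
      using that fV inv_into_into[of "f v" f0 V] f_inv_into_f[of "f v" f0 V] by (auto simp: \<sigma>_def)
    have t1: "\<tau> e \<in> E" "g0 (\<tau> e) = g e" if "e \<in> E" for e
      using that gE inv_into_into[of "g e" g0 E] f_inv_into_f[of "g e" g0 E] by (auto simp: \<tau>_def)
    have bf0: "bij_betw (inv_into V f0) (f0 ` V) V" and bg0: "bij_betw (inv_into E g0) (g0 ` E) E"
      using f0 g0 by (auto intro!: bij_betw_inv_into inj_on_imp_bij_betw)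
    have bf: "bij_betw f V (f0 ` V)" and bg: "bij_betw g E (g0 ` E)"
      using f g fV gE by (auto simp: bij_betw_def)
    have "bij_betw \<sigma> V V"
      using bij_betw_trans[OF bf bf0] by (rule bij_betw_cong[THEN iffD1, rotated]) (auto simp: \<sigma>_def)
    then have ps: "\<sigma> permutes V" by (rule bij_imp_permutes) (auto simp: \<sigma>_def)
    have "bij_betw \<tau> E E"
      using bij_betw_trans[OF bg bg0] by (rule bij_betw_cong[THEN iffD1, rotated]) (auto simp: \<tau>_def)
    then have pt: "\<tau> permutes E" by (rule bij_imp_permutes) (auto simp: \<tau>_def)
    \<comment> \<open>Exclusive or is its own inverse, so the reversal set of the automorphism is
      recovered by the same formula.\<close>
    define R' where "R' = {e\<in>E. (e \<in> R) \<noteq> (\<tau> e \<in> R0)}"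
    have "(tail F (\<tau> e), head F (\<tau> e)) =
        (if e \<in> R' then (\<sigma> (head F e), \<sigma> (tail F e)) else (\<sigma> (tail F e), \<sigma> (head F e)))" if "e \<in> E" for e
      using e0[OF t1(1)[OF that]] e[OF that] that t1(2)[OF that] s1[OF ends(1)[OF that]] s1[OF ends(2)[OF that]]
        inj_onD[OF f0(2)] ends[OF t1(1)[OF that]]
      by (simp add: R'_def split: if_splits)
    then have "(\<sigma>, \<tau>, R') \<in> automorphism_triples F"
      using ps pt by (auto simp: automorphism_triples_def R'_def V_def[symmetric] E_def[symmetric])
    moreover have "\<Phi> (\<sigma>, \<tau>, R') = q"
    proof -
      have "restrict (f0 \<circ> \<sigma>) V = f" using f s1 by (intro extensionalityI[of _ V]) (auto simp: PiE_def)
      moreover have "restrict (g0 \<circ> \<tau>) E = g" using g t1 by (intro extensionalityI[of _ E]) (auto simp: PiE_def)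
      moreover have "{e\<in>E. (e \<in> R') \<noteq> (\<tau> e \<in> R0)} = R" using R by (auto simp: R'_def)
      ultimately show ?thesis by (simp add: \<Phi>_def q_eq)
    qed
    ultimately show "q \<in> \<Phi> ` automorphism_triples F" by force
  qed
  then show ?thesis unfolding Q_def by (rule bij_betw_same_card[symmetric])
qed

text \<open>An embedding with image H pulls the pair back to a proper sub-multigraph of F with the
  same cardinalities, where strict balance applies with density 1.\<close>

lemma sub_of_copy_sparse:
  assumes F: "wf_digraph F" "finite (verts F)" "finite (arcs F)" and bal: "strictly_balanced F"
    and eq: "card (arcs F) = card (verts F)"
    and H: "H \<in> copies F G" and sub: "closed_pair H (V, E)" "V \<noteq> {}" "(V, E) \<noteq> (verts H, arcs H)"
  shows "card E < card V"
proof -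
  interpret F: wf_digraph F by (rule F)
  obtain p where p: "p \<in> embedding_triples F G" "image_subgraph F G p = H"
    using copy_embedding_exists[OF F(1) H] by auto
  obtain f g R where p_eq: "p = (f, g, R)" by (cases p)
  have f: "inj_on f (verts F)" and g: "inj_on g (arcs F)"
    and e: "\<And>e. e \<in> arcs F \<Longrightarrow> (tail G (g e), head G (g e)) =
        (if e \<in> R then (f (head F e), f (tail F e)) else (f (tail F e), f (head F e)))"
    using p by (auto simp: p_eq embedding_triples_def)
  have H': "verts H = f ` verts F" "arcs H = g ` arcs F" "tail H = tail G" "head H = head G"
    using p(2) by (auto simp: image_subgraph_def p_eq)
  define V' E' where "V' = {v\<in>verts F. f v \<in> V}" and "E' = {e\<in>arcs F. g e \<in> E}"
  have V: "V = f ` V'" and E: "E = g ` E'" using sub(1) H' by (auto simp: closed_pair_def V'_def E'_def)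
  have card: "card V = card V'" "card E = card E'"
    unfolding V E using f g by (auto intro!: card_image intro: inj_on_subset simp: V'_def E'_def)
  define F' where "F' = \<lparr>verts = V', arcs = E', tail = tail F, head = head F\<rparr>"
  have "tail F e \<in> V' \<and> head F e \<in> V'" if "e \<in> E'" for e
    using that sub(1) e[of e] by (auto simp: E'_def V'_def closed_pair_def H' split: if_splits)
  then have "wf_digraph F'" by unfold_locales (auto simp: F'_def)
  then have "subgraph F' F" using F by (auto simp: subgraph_def compatible_def F'_def V'_def E'_def)
  moreover have "F' \<noteq> F"
  proof
    assume "F' = F"
    from arg_cong[OF this, of verts] arg_cong[OF this, of arcs]
    have "V' = verts F" "E' = arcs F" by (simp_all add: F'_def)
    then show False using sub(3) unfolding V E H' by simp
  qed
  moreover have "V' \<noteq> {}" using sub(2) V by auto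
  ultimately have "density F' < density F" using bal by (auto simp: strictly_balanced_def F'_def)
  moreover have "card (verts F) > 0" using bal F by (auto simp: strictly_balanced_def card_gt_0_iff)
  moreover have "card V' > 0" using \<open>V' \<noteq> {}\<close> F by (auto simp: card_gt_0_iff V'_def)
  ultimately show ?thesis
    unfolding card by (simp add: density_def F'_def eq divide_less_eq)
qed

section \<open>Disjoint and overlapping copies\<close>

lemma copy_facts:
  assumes "H \<in> copies F G"
  shows "verts H \<subseteq> verts G" "arcs H \<subseteq> arcs G" "tail H = tail G" "head H = head G" "wf_digraph H"
    "card (verts H) = card (verts F)" "card (arcs H) = card (arcs F)"
  using assms by (auto simp: copies_def subgraph_def compatible_def multigraph_iso_def dest: bij_betw_same_card)

lemma closed_pair_copy: "H \<in> copies F G \<Longrightarrow> closed_pair G (verts H, arcs H)"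
  using copy_facts[of H F G] wf_digraph.tail_in_verts[of H] wf_digraph.head_in_verts[of H]
  by (auto simp: closed_pair_def)

lemma card_Un_eq: "finite A \<Longrightarrow> finite B \<Longrightarrow> int (card (A \<union> B)) = int (card A) + int (card B) - int (card (A \<inter> B))"
  using card_Un_Int[of A B] by linarith

section \<open>Sub-multigraphs with more edges than vertices, and unions of overlapping
  copies\<close>

definition dense_pairs :: "nat \<Rightarrow> ('c, 'd) pre_digraph \<Rightarrow> ('c set \<times> 'd set) set" where
  "dense_pairs b G = {(V, E). closed_pair G (V, E) \<and> card V < card E \<and> card E \<le> b}"

text \<open>Representatives of all dense pairs on standard labels, with repetitions. The bound on
  the edges also bounds the vertices, so there are finitely many.\<close>

definition dense_shapes :: "nat \<Rightarrow> (nat, nat) pre_digraph set" where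
  "dense_shapes b = (\<Union>e\<le>b. \<Union>v<e. multigraphs v e)"

lemma finite_dense_shapes: "finite (dense_shapes b)"
  by (auto simp: dense_shapes_def finite_multigraphs)

lemma multigraphs_wf:
  assumes "J \<in> multigraphs v e"
  shows "wf_digraph J" "verts J = {1..v}" "arcs J = {1..e}"
proof -
  have J: "verts J = {1..v}" "arcs J = {1..e}" "tail J \<in> {1..e} \<rightarrow>\<^sub>E {1..v}" "head J \<in> {1..e} \<rightarrow>\<^sub>E {1..v}"
    using assms by (auto simp: multigraphs_def)
  then show "verts J = {1..v}" "arcs J = {1..e}" by auto
  show "wf_digraph J" by unfold_locales (use J in \<open>auto dest: PiE_mem simp del: atLeastAtMost_iff\<close>)
qed

text \<open>Numbering the vertices and edges of a dense pair exhibits it as the image of a realized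
  placement of some shape. The same pair may arise many times, which is harmless for an upper
  bound.\<close>

lemma card_dense_pairs_le:
  assumes G: "G \<in> multigraphs n m"
  shows "card (dense_pairs b G) \<le> (\<Sum>J\<in>dense_shapes b. card {q \<in> embeddings J n m. realizes G J q})"
proof -
  define Q where "Q = (\<lambda>J :: (nat, nat) pre_digraph. {q \<in> embeddings J n m. realizes G J q})"
  define im where "im = (\<lambda>J :: (nat, nat) pre_digraph. \<lambda>q :: (nat \<Rightarrow> nat) \<times> (nat \<Rightarrow> nat). (fst q ` verts J, snd q ` arcs J))"
  note G' = multigraphs_wf[OF G]
  have finQ: "finite (Q J)" if J: "J \<in> dense_shapes b" for J
  proof -
    obtain v e where "J \<in> multigraphs v e" using J unfolding dense_shapes_def by blast
    then have "finite (verts J)" "finite (arcs J)" by (auto simp: multigraphs_wf)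
    then show ?thesis using finite_embeddings[of J n m] by (simp add: Q_def)
  qed
  have "dense_pairs b G \<subseteq> (\<Union>J\<in>dense_shapes b. im J ` Q J)"
  proof
    fix z assume z: "z \<in> dense_pairs b G"
    obtain V E where VE: "z = (V, E)" by (cases z)
    have V: "V \<subseteq> {1..n}" and E: "E \<subseteq> {1..m}" and ends: "\<And>e. e \<in> E \<Longrightarrow> tail G e \<in> V \<and> head G e \<in> V"
      and c: "card V < card E" "card E \<le> b"
      using z G' by (auto simp: VE dense_pairs_def closed_pair_def)
    have "finite V" "finite E" using V E by (auto intro: finite_subset)
    then obtain f0 g0 where f0: "bij_betw f0 {1..card V} V" and g0: "bij_betw g0 {1..card E} E"
      using ex_bij_betw_nat_finite_1 by meson
    define f g where "f = restrict f0 {1..card V}" and "g = restrict g0 {1..card E}"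
    have f: "bij_betw f {1..card V} V" and g: "bij_betw g {1..card E} E"
      using f0 g0 by (simp_all add: f_def g_def bij_betw_def inj_on_restrict_eq image_restrict_eq)
    define fi where "fi = inv_into {1..card V} f"
    have fi: "fi v \<in> {1..card V}" "f (fi v) = v" if "v \<in> V" for v
      using that f inv_into_into[of v f "{1..card V}"] f_inv_into_f[of v f "{1..card V}"]
      unfolding fi_def bij_betw_def by blast+
    define J where "J = \<lparr>verts = {1..card V}, arcs = {1..card E}, tail = restrict (\<lambda>e. fi (tail G (g e))) {1..card E},
       head = restrict (\<lambda>e. fi (head G (g e))) {1..card E}\<rparr>"
    have gE: "g e \<in> E" if "e \<in> {1..card E}" for e using that bij_betwE[OF g] by blast
    have "J \<in> multigraphs (card V) (card E)"
      using fi ends gE by (auto simp: multigraphs_def J_def simp del: atLeastAtMost_iff)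
    then have "J \<in> dense_shapes b" using c by (auto simp: dense_shapes_def)
    moreover have "(f, g) \<in> Q J"
    proof -
      have "f \<in> {1..card V} \<rightarrow>\<^sub>E {1..n}" "g \<in> {1..card E} \<rightarrow>\<^sub>E {1..m}"
        using bij_betwE[OF f] bij_betwE[OF g] V E by (auto simp: f_def g_def simp del: atLeastAtMost_iff)
      moreover have "realizes G J (f, g)" using fi ends gE by (auto simp: realizes_def J_def simp del: atLeastAtMost_iff)
      ultimately show ?thesis using f g by (auto simp: Q_def embeddings_def J_def bij_betw_def simp del: atLeastAtMost_iff)
    qed
    moreover have "im J (f, g) = z" using f g by (simp add: im_def J_def VE bij_betw_def)
    ultimately show "z \<in> (\<Union>J\<in>dense_shapes b. im J ` Q J)" by blast
  qed
  then have "card (dense_pairs b G) \<le> card (\<Union>J\<in>dense_shapes b. im J ` Q J)"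
    using finite_dense_shapes finQ by (intro card_mono) auto
  also have "\<dots> \<le> (\<Sum>J\<in>dense_shapes b. card (im J ` Q J))" by (rule card_UN_le[OF finite_dense_shapes])
  also have "\<dots> \<le> (\<Sum>J\<in>dense_shapes b. card (Q J))" using finQ by (intro sum_mono card_image_le)
  finally show ?thesis by (simp add: Q_def)
qed

text \<open>Such an F is a cycle: dropping a vertex of degree at most 1 would not lower the density,
  so all degrees equal 2, and a proper component would again have density 1. The arguments below
  work with edge counts alone.\<close>

locale balanced_unicyclic =
  fixes F :: "('a, 'b) pre_digraph"
  assumes F_wf: "wf_digraph F" and F_finite: "finite (verts F)" "finite (arcs F)"
    and F_bal: "strictly_balanced F" and F_eq: "card (arcs F) = card (verts F)"
begin

lemma verts_nonempty: "verts F \<noteq> {}"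
  using F_bal by (simp add: strictly_balanced_def)

lemma copy_finite: "H \<in> copies F G \<Longrightarrow> finite (verts H) \<and> finite (arcs H) \<and> verts H \<noteq> {}"
  using copy_facts[of H F G] verts_nonempty F_finite F_eq
  by (metis card_eq_0_iff card.empty card.infinite)

text \<open>Adding a copy keeps the excess of edges. What the copy shares with the pair is empty,
  the whole copy or a proper part, and in each case it has at most as many edges as vertices;
  inclusion-exclusion finishes.\<close>

lemma card_Un_copy:
  assumes G: "H \<in> copies F G" and VE: "closed_pair G (V, E)" "finite V" "finite E" and gt: "card V < card E"
  shows "card (V \<union> verts H) < card (E \<union> arcs H)"
proof -
  note H = copy_facts[OF G] copy_finite[OF G]
  have "card (E \<inter> arcs H) \<le> card (V \<inter> verts H)"
  proof -
    have cp: "closed_pair H (V \<inter> verts H, E \<inter> arcs H)"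
      using VE closed_pair_copy[OF G] H(3,4) by (auto simp: closed_pair_def)
    consider "V \<inter> verts H = {}" | "(V \<inter> verts H, E \<inter> arcs H) = (verts H, arcs H)"
      | "V \<inter> verts H \<noteq> {}" "(V \<inter> verts H, E \<inter> arcs H) \<noteq> (verts H, arcs H)" by blast
    then show ?thesis
    proof cases
      case 1
      then have "E \<inter> arcs H = {}" using cp by (auto simp: closed_pair_def)
      then show ?thesis by simp
    next
      case 2
      then show ?thesis using H(6,7) F_eq by simp
    next
      case 3
      then show ?thesis using sub_of_copy_sparse[OF F_wf F_finite F_bal F_eq G cp] by simp
    qed
  qed
  then show ?thesis
    using card_Un_eq[of V "verts H"] card_Un_eq[of E "arcs H"] VE gt H(6,7,8) F_eq by linarith
qed

lemma card_Un_overlapping: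
  assumes H1: "H1 \<in> copies F G" and H2: "H2 \<in> copies F G" and ne: "H1 \<noteq> H2" and int: "verts H1 \<inter> verts H2 \<noteq> {}"
  shows "card (verts H1 \<union> verts H2) < card (arcs H1 \<union> arcs H2)"
proof -
  note f1 = copy_facts[OF H1] copy_finite[OF H1] and f2 = copy_facts[OF H2] copy_finite[OF H2]
  have cp: "closed_pair H1 (verts H1 \<inter> verts H2, arcs H1 \<inter> arcs H2)"
    using closed_pair_copy[OF H1] closed_pair_copy[OF H2] f1(3,4) f2(3,4) by (auto simp: closed_pair_def)
  \<comment> \<open>Two distinct copies have equal sizes and so cannot be nested; their intersection
    is a proper part of H1.\<close>
  have "(verts H1 \<inter> verts H2, arcs H1 \<inter> arcs H2) \<noteq> (verts H1, arcs H1)"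
  proof
    assume "(verts H1 \<inter> verts H2, arcs H1 \<inter> arcs H2) = (verts H1, arcs H1)"
    then have "verts H1 \<subseteq> verts H2" "arcs H1 \<subseteq> arcs H2" by auto
    then have "verts H1 = verts H2" "arcs H1 = arcs H2"
      using f1(6,7) f2(6,7,8) card_subset_eq[of "verts H2" "verts H1"] card_subset_eq[of "arcs H2" "arcs H1"] by simp_all
    then show False using copies_eqI[OF H1 H2] ne by blast
  qed
  from sub_of_copy_sparse[OF F_wf F_finite F_bal F_eq H1 cp int this]
  show ?thesis
    using card_Un_eq[of "verts H1" "verts H2"] card_Un_eq[of "arcs H1" "arcs H2"] f1(6,7,8) f2(6,7,8) F_eq by linarith
qed

text \<open>The overlapping pair creates the excess and \<open>card_Un_copy\<close> preserves it.
  The induction starts from this pair and then adds all of Hs; adding H1 and H2 again does not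
  change the unions.\<close>

lemma card_Union_overlapping:
  assumes Hs: "finite Hs" "Hs \<subseteq> copies F G" and H: "H1 \<in> Hs" "H2 \<in> Hs" "H1 \<noteq> H2" "verts H1 \<inter> verts H2 \<noteq> {}"
  shows "card (\<Union>(verts ` Hs)) < card (\<Union>(arcs ` Hs))"
proof -
  have "card (verts H1 \<union> verts H2 \<union> \<Union>(verts ` T)) < card (arcs H1 \<union> arcs H2 \<union> \<Union>(arcs ` T))" if "finite T" "T \<subseteq> copies F G" for T
    using that
  proof (induction T rule: finite_induct)
    case empty
    then show ?case using card_Un_overlapping[of H1 G H2] H Hs by auto
  next
    case (insert H T)
    have cl: "closed_pair G (verts K, arcs K)" "finite (verts K)" "finite (arcs K)" if "K \<in> insert H T \<union> {H1, H2}" for K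
      using that insert.prems closed_pair_copy[of K F G] copy_finite[of K G] H Hs by auto
    have "card (verts H1 \<union> verts H2 \<union> \<Union>(verts ` T) \<union> verts H) < card (arcs H1 \<union> arcs H2 \<union> \<Union>(arcs ` T) \<union> arcs H)"
    proof (rule card_Un_copy)
      show "H \<in> copies F G" using insert by auto
      show "closed_pair G (verts H1 \<union> verts H2 \<union> \<Union>(verts ` T), arcs H1 \<union> arcs H2 \<union> \<Union>(arcs ` T))"
        using cl(1) unfolding closed_pair_def by (simp add: subset_iff) blast
      show "finite (verts H1 \<union> verts H2 \<union> \<Union>(verts ` T))" "finite (arcs H1 \<union> arcs H2 \<union> \<Union>(arcs ` T))"
        using cl insert.hyps by auto
    qed (use insert in auto)
    then show ?case by (simp add: Un_ac)
  qed
  from this[OF Hs] show ?thesis using H by (simp add: Un_absorb1 UN_upper)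
qed

section \<open>Ordered tuples of copies and their embeddings\<close>

definition copy_tuples :: "nat \<Rightarrow> ('c, 'd) pre_digraph \<Rightarrow> (nat \<Rightarrow> ('c, 'd) pre_digraph) set" where
  "copy_tuples t G = {h \<in> {..<t} \<rightarrow>\<^sub>E copies F G. inj_on h {..<t}}"

definition disjoint_copy_tuples :: "nat \<Rightarrow> ('c, 'd) pre_digraph \<Rightarrow> (nat \<Rightarrow> ('c, 'd) pre_digraph) set" where
  "disjoint_copy_tuples t G = {h \<in> {..<t} \<rightarrow>\<^sub>E copies F G. disjoint_family_on (\<lambda>i. verts (h i)) {..<t}}"

lemma disjoint_copy_tuples_subset: "disjoint_copy_tuples t G \<subseteq> copy_tuples t G"
proof
  fix h assume h: "h \<in> disjoint_copy_tuples t G"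
  have "inj_on h {..<t}"
  proof (rule inj_onI, rule ccontr)
    fix i j assume ij: "i \<in> {..<t}" "j \<in> {..<t}" "h i = h j" "i \<noteq> j"
    then have "verts (h i) \<inter> verts (h j) = {}"
      using h unfolding disjoint_copy_tuples_def disjoint_family_on_def by blast
    moreover have "h i \<in> copies F G" using h ij by (auto simp: disjoint_copy_tuples_def)
    ultimately show False using ij(3) copy_finite[of "h i" G] by simp
  qed
  then show "h \<in> copy_tuples t G" using h by (simp add: copy_tuples_def disjoint_copy_tuples_def)
qed

text \<open>All members of an overlapping tuple lie in their union, a dense pair with at most t k
  edges and fewer vertices. Such a pair contains at most 2^(2 t k) copies, and the tuple has t
  entries.\<close>

lemma card_overlapping_tuples_le:
  assumes G: "finite (verts G)" "finite (arcs G)"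
  shows "card (copy_tuples t G - disjoint_copy_tuples t G) \<le> card (dense_pairs (t * card (verts F)) G) * (2 ^ (2 * t * card (verts F))) ^ t"
proof -
  define b where "b = t * card (verts F)"
  define Z where "Z = dense_pairs b G"
  have finZ: "finite Z"
    by (rule finite_subset[of _ "Pow (verts G) \<times> Pow (arcs G)"])
       (use G in \<open>auto simp: Z_def dense_pairs_def closed_pair_def\<close>)
  define S where "S = (\<lambda>(V, E). {H \<in> copies F G. verts H \<subseteq> V \<and> arcs H \<subseteq> E})"
  have S: "finite (S z)" "card (S z) \<le> 2 ^ (2 * t * card (verts F))" if z: "z \<in> Z" for z
  proof -
    obtain V E where VE: "z = (V, E)" by (cases z)
    have fin: "finite V" "finite E" and c: "card V \<le> b" "card E \<le> b"
      using z G by (auto simp: VE Z_def dense_pairs_def closed_pair_def intro: finite_subset)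
    show "finite (S z)" using finite_copies[OF G, of F] by (simp add: S_def VE)
    have "card (S z) \<le> card (Pow V \<times> Pow E)"
    proof (rule card_inj_on_le)
      show "inj_on (\<lambda>H. (verts H, arcs H)) (S z)" by (rule inj_onI) (auto simp: S_def VE intro: copies_eqI)
    qed (use fin in \<open>auto simp: S_def VE\<close>)
    also have "\<dots> = 2 ^ (card V + card E)" using fin by (simp add: card_cartesian_product card_Pow power_add)
    also have "\<dots> \<le> 2 ^ (2 * t * card (verts F))" using c by (intro power_increasing) (auto simp: b_def)
    finally show "card (S z) \<le> 2 ^ (2 * t * card (verts F))" .
  qed
  have "copy_tuples t G - disjoint_copy_tuples t G \<subseteq> (\<Union>z\<in>Z. {..<t} \<rightarrow>\<^sub>E S z)"
  proof
    fix h assume h: "h \<in> copy_tuples t G - disjoint_copy_tuples t G"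
    then have h1: "h \<in> {..<t} \<rightarrow>\<^sub>E copies F G" "inj_on h {..<t}" by (auto simp: copy_tuples_def)
    then obtain i j where ij: "i < t" "j < t" "i \<noteq> j" "verts (h i) \<inter> verts (h j) \<noteq> {}"
      using h by (auto simp: disjoint_copy_tuples_def disjoint_family_on_def)
    define Hs where "Hs = h ` {..<t}"
    have Hs: "finite Hs" "Hs \<subseteq> copies F G" using h1 by (auto simp: Hs_def)
    have "h i \<noteq> h j" using ij h1(2) by (auto simp: inj_on_def)
    then have lt: "card (\<Union>(verts ` Hs)) < card (\<Union>(arcs ` Hs))"
      using ij by (intro card_Union_overlapping[OF Hs, of "h i" "h j"]) (auto simp: Hs_def)
    have "card (\<Union>(arcs ` Hs)) \<le> (\<Sum>H\<in>Hs. card (arcs H))" by (rule card_UN_le[OF Hs(1)])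
    also have "\<dots> = (\<Sum>H\<in>Hs. card (verts F))" by (intro sum.cong refl) (metis Hs(2) copy_facts(7) F_eq subsetD)
    also have "\<dots> \<le> b" unfolding b_def Hs_def by (simp add: card_image_le[of "{..<t}" h, simplified])
    finally have "card (\<Union>(arcs ` Hs)) \<le> b" .
    moreover have "closed_pair G (\<Union>(verts ` Hs), \<Union>(arcs ` Hs))"
      using Hs(2) closed_pair_copy[of _ F G] by (fastforce simp: closed_pair_def)
    ultimately have "(\<Union>(verts ` Hs), \<Union>(arcs ` Hs)) \<in> Z" using lt by (simp add: Z_def dense_pairs_def)
    moreover have "h \<in> {..<t} \<rightarrow>\<^sub>E S (\<Union>(verts ` Hs), \<Union>(arcs ` Hs))"
      using h1 by (auto simp: S_def Hs_def)
    ultimately show "h \<in> (\<Union>z\<in>Z. {..<t} \<rightarrow>\<^sub>E S z)" by blast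
  qed
  then have "card (copy_tuples t G - disjoint_copy_tuples t G) \<le> card (\<Union>z\<in>Z. {..<t} \<rightarrow>\<^sub>E S z)"
    using finZ S by (intro card_mono) (auto intro!: finite_PiE)
  also have "\<dots> \<le> (\<Sum>z\<in>Z. card ({..<t} \<rightarrow>\<^sub>E S z))" by (rule card_UN_le[OF finZ])
  also have "\<dots> \<le> (\<Sum>z\<in>Z. (2 ^ (2 * t * card (verts F))) ^ t)"
    using S by (intro sum_mono) (auto simp: card_funcsetE intro!: power_mono)
  finally show ?thesis by (simp add: Z_def b_def)
qed

text \<open>Send a tuple of embeddings to the tuple of its images. Each fibre is a product of t sets
  of embeddings with a given image, each as large as the set of automorphisms.\<close>

lemma card_disjoint_copy_tuples:
  assumes G: "wf_digraph G" "finite (verts G)" "finite (arcs G)"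
  shows "card {p \<in> {..<t} \<rightarrow>\<^sub>E embedding_triples F G. disjoint_family_on (\<lambda>i. fst (p i) ` verts F) {..<t}}
    = card (disjoint_copy_tuples t G) * card (automorphism_triples F) ^ t"
proof -
  define P where "P = {p \<in> {..<t} \<rightarrow>\<^sub>E embedding_triples F G. disjoint_family_on (\<lambda>i. fst (p i) ` verts F) {..<t}}"
  define Q where "Q = (\<lambda>H. {q \<in> embedding_triples F G. image_subgraph F G q = H})"
  define Y where "Y = disjoint_copy_tuples t G"
  have finET: "finite (embedding_triples F G)" by (rule finite_embedding_triples[OF F_finite G(2,3)])
  have finY: "finite Y"
    by (rule finite_subset[of _ "{..<t} \<rightarrow>\<^sub>E copies F G"])
       (use finite_copies[OF G(2,3)] in \<open>auto simp: Y_def disjoint_copy_tuples_def intro!: finite_PiE\<close>)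
  have vi: "verts (image_subgraph F G q) = fst q ` verts F" for q
    by (auto simp: image_subgraph_def split: prod.splits)
  have P_eq: "P = (\<Union>h\<in>Y. Pi\<^sub>E {..<t} (\<lambda>i. Q (h i)))"
  proof (intro equalityI subsetI)
    fix p assume p: "p \<in> P"
    define h where "h = restrict (\<lambda>i. image_subgraph F G (p i)) {..<t}"
    have "disjoint_family_on (\<lambda>i. verts (h i)) {..<t}"
      using p by (auto simp: P_def h_def vi disjoint_family_on_def)
    moreover have "h \<in> {..<t} \<rightarrow>\<^sub>E copies F G"
    proof (unfold h_def, rule restrict_PiE_iff[THEN iffD2], rule ballI)
      fix i assume "i \<in> {..<t}"
      then have "p i \<in> embedding_triples F G" using p by (auto simp: P_def simp del: split_paired_All)
      then show "image_subgraph F G (p i) \<in> copies F G" by (rule image_subgraph_in_copies[OF F_wf G(1)])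
    qed
    ultimately have "h \<in> Y" by (simp add: Y_def disjoint_copy_tuples_def)
    moreover have "p \<in> Pi\<^sub>E {..<t} (\<lambda>i. Q (h i))"
      using p by (auto simp: P_def Q_def h_def PiE_def)
    ultimately show "p \<in> (\<Union>h\<in>Y. Pi\<^sub>E {..<t} (\<lambda>i. Q (h i)))" by blast
  next
    fix p assume "p \<in> (\<Union>h\<in>Y. Pi\<^sub>E {..<t} (\<lambda>i. Q (h i)))"
    then obtain h where h: "h \<in> Y" "p \<in> Pi\<^sub>E {..<t} (\<lambda>i. Q (h i))" by blast
    have i: "p i \<in> embedding_triples F G" "fst (p i) ` verts F = verts (h i)" if "i < t" for i
      using h(2) that by (auto simp: Q_def vi[symmetric] dest!: PiE_mem[of _ _ _ i])
    then show "p \<in> P" using h by (auto simp: P_def Y_def disjoint_copy_tuples_def disjoint_family_on_def PiE_def)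
  qed
  have "card P = (\<Sum>h\<in>Y. card (Pi\<^sub>E {..<t} (\<lambda>i. Q (h i))))"
    unfolding P_eq
  proof (rule card_UN_disjoint[OF finY])
    show "\<forall>h\<in>Y. finite (Pi\<^sub>E {..<t} (\<lambda>i. Q (h i)))"
      using finET by (auto simp: Q_def intro!: finite_PiE)
    show "\<forall>h\<in>Y. \<forall>h'\<in>Y. h \<noteq> h' \<longrightarrow> Pi\<^sub>E {..<t} (\<lambda>i. Q (h i)) \<inter> Pi\<^sub>E {..<t} (\<lambda>i. Q (h' i)) = {}"
    proof (intro ballI impI, rule ccontr)
      fix h h' assume h: "h \<in> Y" "h' \<in> Y" "h \<noteq> h'" and "Pi\<^sub>E {..<t} (\<lambda>i. Q (h i)) \<inter> Pi\<^sub>E {..<t} (\<lambda>i. Q (h' i)) \<noteq> {}"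
      then obtain p where p: "p \<in> Pi\<^sub>E {..<t} (\<lambda>i. Q (h i))" "p \<in> Pi\<^sub>E {..<t} (\<lambda>i. Q (h' i))" by blast
      have "h i = h' i" if "i \<in> {..<t}" for i
        using PiE_mem[OF p(1) that] PiE_mem[OF p(2) that] by (auto simp: Q_def)
      then have "h = h'"
        using h(1,2) by (intro extensionalityI[of h "{..<t}"]) (auto simp: Y_def disjoint_copy_tuples_def PiE_def)
      then show False using h(3) by blast
    qed
  qed
  also have "\<dots> = (\<Sum>h\<in>Y. card (automorphism_triples F) ^ t)"
  proof (rule sum.cong[OF refl])
    fix h assume "h \<in> Y"
    then have hi: "h i \<in> copies F G" if "i < t" for i using that by (auto simp: Y_def disjoint_copy_tuples_def)
    have "card (Q (h i)) = card (automorphism_triples F)" if "i < t" for i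
      unfolding Q_def by (rule card_embeddings_of_copy[OF F_wf hi[OF that]])
    then show "card (Pi\<^sub>E {..<t} (\<lambda>i. Q (h i))) = card (automorphism_triples F) ^ t"
      by (simp add: card_PiE)
  qed
  finally show ?thesis by (simp add: P_def Y_def)
qed

text \<open>\<open>t\<close> disjoint copies of \<open>F\<close>, with the edges in \<open>R\<close> reversed.\<close>

definition blowup :: "nat \<Rightarrow> (nat \<times> 'b) set \<Rightarrow> (nat \<times> 'a, nat \<times> 'b) pre_digraph" where
  "blowup t R = \<lparr>verts = {..<t} \<times> verts F, arcs = {..<t} \<times> arcs F,
     tail = (\<lambda>(i, e). (i, if (i, e) \<in> R then head F e else tail F e)),
     head = (\<lambda>(i, e). (i, if (i, e) \<in> R then tail F e else head F e))\<rparr>"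

lemma blowup_sel [simp]:
  "verts (blowup t R) = {..<t} \<times> verts F" "arcs (blowup t R) = {..<t} \<times> arcs F"
  "tail (blowup t R) (i, e) = (i, if (i, e) \<in> R then head F e else tail F e)"
  "head (blowup t R) (i, e) = (i, if (i, e) \<in> R then tail F e else head F e)"
  by (simp_all add: blowup_def)

lemma blowup_wf: "wf_digraph (blowup t R)"
  by unfold_locales (auto simp: wf_digraph.tail_in_verts[OF F_wf] wf_digraph.head_in_verts[OF F_wf])

text \<open>Reversal only moves half-edges between in-degree and out-degree, so all choices of R
  lead to the same limit.\<close>

lemma vdeg_blowup: "i < t \<Longrightarrow> vdeg (blowup t R) (i, v) = vdeg F v"
proof -
  assume i: "i < t"
  let ?A = "\<lambda>b. {e \<in> arcs F. (i, e) \<in> R \<and> b e = v}" and ?B = "\<lambda>b. {e \<in> arcs F. (i, e) \<notin> R \<and> b e = v}"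
  have in_eq: "in_arcs (blowup t R) (i, v) = Pair i ` (?A (tail F) \<union> ?B (head F))"
    using i by (auto simp: in_arcs_def split: if_splits)
  have out_eq: "out_arcs (blowup t R) (i, v) = Pair i ` (?A (head F) \<union> ?B (tail F))"
    using i by (auto simp: out_arcs_def split: if_splits)
  have un: "card (?A b \<union> ?B c) = card (?A b) + card (?B c)" for b c
    using F_finite by (intro card_Un_disjoint) auto
  have pc: "card (Pair i ` S) = card S" for S :: "'b set" by (rule card_image) (simp add: inj_on_def)
  have "{e \<in> arcs F. b e = v} = ?A b \<union> ?B b" for b by auto
  then have "card {e \<in> arcs F. b e = v} = card (?A b) + card (?B b)" for b using un by simp
  then show ?thesis
    unfolding vdeg_def in_degree_def out_degree_def in_eq out_eq
    by (simp only: pc un in_arcs_def out_arcs_def)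
qed

text \<open>Once the reversed edges of all t members are fixed as R, a tuple of embeddings with
  disjoint vertex images is one realized placement of a single pattern. This reduces unoriented
  embeddings to the oriented patterns whose averages are known.\<close>

lemma card_triple_tuples:
  assumes G: "verts G = {1..n}" "arcs G = {1..m}"
  shows "card {p \<in> {..<t} \<rightarrow>\<^sub>E embedding_triples F G. disjoint_family_on (\<lambda>i. fst (p i) ` verts F) {..<t}}
    = (\<Sum>R\<in>Pow ({..<t} \<times> arcs F). card {q \<in> embeddings (blowup t R) n m. realizes G (blowup t R) q})"
proof -
  define V E where "V = verts F" and "E = arcs F"
  define P where "P = {p \<in> {..<t} \<rightarrow>\<^sub>E embedding_triples F G. disjoint_family_on (\<lambda>i. fst (p i) ` verts F) {..<t}}"
  define Q where "Q = (\<lambda>R. {q \<in> embeddings (blowup t R) n m. realizes G (blowup t R) q})"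
  define \<Phi> where "\<Phi> = (\<lambda>(R :: (nat \<times> 'b) set, f :: nat \<times> 'a \<Rightarrow> nat, g :: nat \<times> 'b \<Rightarrow> nat). restrict (\<lambda>i. (restrict (\<lambda>v. f (i, v)) V, restrict (\<lambda>e. g (i, e)) E, {e. (i, e) \<in> R})) {..<t})"
  define \<Psi> where "\<Psi> = (\<lambda>p :: nat \<Rightarrow> ('a \<Rightarrow> nat) \<times> ('b \<Rightarrow> nat) \<times> 'b set. ({(i, e). i < t \<and> e \<in> snd (snd (p i))},
     restrict (\<lambda>(i, v). fst (p i) v) ({..<t} \<times> V), restrict (\<lambda>(i, e). fst (snd (p i)) e) ({..<t} \<times> E)))"
  have ends: "tail F e \<in> V" "head F e \<in> V" if "e \<in> E" for e
    using that wf_digraph.tail_in_verts[OF F_wf] wf_digraph.head_in_verts[OF F_wf] by (auto simp: V_def E_def)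
  have "bij_betw \<Phi> (SIGMA R:Pow ({..<t} \<times> E). Q R) P"
  proof (rule bij_betw_byWitness[where f' = \<Psi>])
    show "\<forall>a\<in>SIGMA R:Pow ({..<t} \<times> E). Q R. \<Psi> (\<Phi> a) = a"
    proof
      fix a assume "a \<in> (SIGMA R:Pow ({..<t} \<times> E). Q R)"
      then obtain R f g where a: "a = (R, f, g)" "R \<subseteq> {..<t} \<times> E" "(f, g) \<in> Q R" by auto
      have f: "f \<in> extensional ({..<t} \<times> V)" and g: "g \<in> extensional ({..<t} \<times> E)"
        using a(3) by (auto simp: Q_def embeddings_def PiE_def V_def E_def)
      have "restrict (\<lambda>(i, v). fst (\<Phi> a i) v) ({..<t} \<times> V) = f"
        by (rule extensionalityI[OF restrict_extensional f]) (auto simp: \<Phi>_def a)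
      moreover have "restrict (\<lambda>(i, e). fst (snd (\<Phi> a i)) e) ({..<t} \<times> E) = g"
        by (rule extensionalityI[OF restrict_extensional g]) (auto simp: \<Phi>_def a)
      moreover have "{(i, e). i < t \<and> e \<in> snd (snd (\<Phi> a i))} = R" using a(2) by (auto simp: \<Phi>_def a(1))
      ultimately show "\<Psi> (\<Phi> a) = a" unfolding \<Psi>_def by (simp add: a(1))
    qed
    show "\<forall>p\<in>P. \<Phi> (\<Psi> p) = p"
    proof
      fix p assume p: "p \<in> P"
      show "\<Phi> (\<Psi> p) = p"
      proof (rule extensionalityI[of _ "{..<t}"])
        show "\<Phi> (\<Psi> p) \<in> extensional {..<t}" by (simp add: \<Phi>_def \<Psi>_def)
        show "p \<in> extensional {..<t}" using p by (auto simp: P_def PiE_def)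
        fix i assume i: "i \<in> {..<t}"
        obtain f g R where pi: "p i = (f, g, R)" by (cases "p i")
        have "(f, g, R) \<in> embedding_triples F G" using p i pi by (auto simp: P_def PiE_def Pi_def) 
        then have "f \<in> extensional V" "g \<in> extensional E" by (auto simp: embedding_triples_def V_def E_def PiE_def)
        then have "restrict f V = f" "restrict g E = g" by (auto simp: extensional_restrict)
        then show "\<Phi> (\<Psi> p) i = p i" using i by (simp add: \<Phi>_def \<Psi>_def pi cong: restrict_cong)
      qed
    qed
    show "\<Phi> ` (SIGMA R:Pow ({..<t} \<times> E). Q R) \<subseteq> P"
    proof (rule image_subsetI)
      fix a assume "a \<in> (SIGMA R:Pow ({..<t} \<times> E). Q R)"
      then obtain R f g where a: "a = (R, f, g)" "R \<subseteq> {..<t} \<times> E" "(f, g) \<in> Q R" by auto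
      have f: "f \<in> {..<t} \<times> V \<rightarrow>\<^sub>E {1..n}" "inj_on f ({..<t} \<times> V)"
        and g: "g \<in> {..<t} \<times> E \<rightarrow>\<^sub>E {1..m}" "inj_on g ({..<t} \<times> E)"
        and r: "\<And>i e. i < t \<Longrightarrow> e \<in> E \<Longrightarrow> tail G (g (i, e)) = f (i, if (i, e) \<in> R then head F e else tail F e) \<and>
            head G (g (i, e)) = f (i, if (i, e) \<in> R then tail F e else head F e)"
        using a(3) by (auto simp: Q_def embeddings_def realizes_def V_def E_def)
      have "\<Phi> a i \<in> embedding_triples F G" if i: "i < t" for i
      proof -
        have "restrict (\<lambda>v. f (i, v)) V \<in> V \<rightarrow>\<^sub>E {1..n}" "restrict (\<lambda>e. g (i, e)) E \<in> E \<rightarrow>\<^sub>E {1..m}"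
          using f(1) g(1) i by (auto simp: Pi_def PiE_def)
        moreover have "inj_on (restrict (\<lambda>v. f (i, v)) V) V" "inj_on (restrict (\<lambda>e. g (i, e)) E) E"
          using f(2) g(2) i by (auto simp: inj_on_def)
        moreover have "{e. (i, e) \<in> R} \<subseteq> E" using a(2) by auto
        ultimately show ?thesis
          using r[OF i] ends i by (simp add: \<Phi>_def a(1) embedding_triples_def G flip: V_def E_def)
      qed
      moreover have "\<Phi> a \<in> extensional {..<t}" by (simp add: \<Phi>_def a(1))
      ultimately have "\<Phi> a \<in> {..<t} \<rightarrow>\<^sub>E embedding_triples F G" unfolding PiE_def by blast
      moreover have "disjoint_family_on (\<lambda>i. fst (\<Phi> a i) ` V) {..<t}"
        using f(2) by (auto simp: disjoint_family_on_def \<Phi>_def a(1) inj_on_def)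
      ultimately show "\<Phi> a \<in> P" unfolding P_def V_def by blast
    qed
    show "\<Psi> ` P \<subseteq> (SIGMA R:Pow ({..<t} \<times> E). Q R)"
    proof (rule image_subsetI)
      fix p assume p: "p \<in> P"
      define f g R where "f = (\<lambda>i. fst (p i))" and "g = (\<lambda>i. fst (snd (p i)))" and "R = (\<lambda>i. snd (snd (p i)))"
      have pt: "(f i, g i, R i) \<in> embedding_triples F G" if "i < t" for i
        using p that by (auto simp: P_def f_def g_def R_def PiE_def Pi_def)
      have f: "f i \<in> V \<rightarrow>\<^sub>E {1..n}" "inj_on (f i) V" and g: "g i \<in> E \<rightarrow>\<^sub>E {1..m}" "inj_on (g i) E" and R: "R i \<subseteq> E"
        and e: "\<And>e. e \<in> E \<Longrightarrow> (tail G (g i e), head G (g i e)) =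
          (if e \<in> R i then (f i (head F e), f i (tail F e)) else (f i (tail F e), f i (head F e)))" if "i < t" for i
        using pt[OF that] by (auto simp: embedding_triples_def V_def E_def G)
      have disj: "f i ` V \<inter> f j ` V = {}" if "i < t" "j < t" "i \<noteq> j" for i j
        using p that by (auto simp: P_def f_def V_def disjoint_family_on_def)
      have fV: "f i v \<in> {1..n}" if "i < t" "v \<in> V" for i v using f(1)[OF that(1)] that(2) by auto
      have gE: "g i e \<in> {1..m}" if "i < t" "e \<in> E" for i e using g(1)[OF that(1)] that(2) by auto
      \<comment> \<open>Gives disjointness of the edge images: an edge shared by two members would
        have its tail in both of their disjoint vertex images.\<close>
      have tl: "tail G (g i e) \<in> f i ` V" if "i < t" "e \<in> E" for i e
        using e[OF that] ends[OF that(2)] by (auto split: if_splits)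
      have \<Psi>: "\<Psi> p = ({(i, e). i < t \<and> e \<in> R i}, restrict (\<lambda>(i, v). f i v) ({..<t} \<times> V), restrict (\<lambda>(i, e). g i e) ({..<t} \<times> E))"
        by (simp add: \<Psi>_def f_def g_def R_def)
      have "inj_on (\<lambda>(i, v). f i v) ({..<t} \<times> V)"
      proof (rule inj_onI, clarsimp)
        fix i v j w assume *: "i < t" "v \<in> V" "j < t" "w \<in> V" "f i v = f j w"
        have "i = j" using disj[of i j] * by (metis IntI empty_iff imageI)
        then show "i = j \<and> v = w" using inj_onD[OF f(2)[OF *(1)]] * by auto
      qed
      moreover have "inj_on (\<lambda>(i, e). g i e) ({..<t} \<times> E)"
      proof (rule inj_onI, clarsimp)
        fix i v j w assume *: "i < t" "v \<in> E" "j < t" "w \<in> E" "g i v = g j w"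
        have "i = j" using disj[of i j] * tl[of i v] tl[of j w] by (metis IntI empty_iff)
        then show "i = j \<and> v = w" using inj_onD[OF g(2)[OF *(1)]] * by auto
      qed
      moreover have "restrict (\<lambda>(i, v). f i v) ({..<t} \<times> V) \<in> {..<t} \<times> V \<rightarrow>\<^sub>E {1..n}"
        "restrict (\<lambda>(i, e). g i e) ({..<t} \<times> E) \<in> {..<t} \<times> E \<rightarrow>\<^sub>E {1..m}"
        using fV gE by (auto simp del: atLeastAtMost_iff)
      moreover have "{(i, e). i < t \<and> e \<in> R i} \<subseteq> {..<t} \<times> E" using R by auto
      moreover have "realizes G (blowup t {(i, e). i < t \<and> e \<in> R i}) (restrict (\<lambda>(i, v). f i v) ({..<t} \<times> V), restrict (\<lambda>(i, e). g i e) ({..<t} \<times> E))"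
      proof -
        have "tail G (g i e) = f i (if e \<in> R i then head F e else tail F e)"
          "head G (g i e) = f i (if e \<in> R i then tail F e else head F e)" if "i < t" "e \<in> E" for i e
          using e[OF that] by (simp_all split: if_splits)
        then show ?thesis using ends by (auto simp: realizes_def V_def[symmetric] E_def[symmetric])
      qed
      ultimately show "\<Psi> p \<in> (SIGMA R:Pow ({..<t} \<times> E). Q R)"
        unfolding \<Psi> Q_def embeddings_def by (simp add: inj_on_restrict_eq flip: V_def E_def)
    qed
  qed
  then have "card P = card (SIGMA R:Pow ({..<t} \<times> E). Q R)" by (rule bij_betw_same_card[symmetric])
  also have "\<dots> = (\<Sum>R\<in>Pow ({..<t} \<times> E). card (Q R))"
    using F_finite by (intro card_SigmaI) (auto simp: Q_def E_def intro!: finite_subset[OF _ finite_embeddings])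
  finally show ?thesis by (simp add: P_def Q_def E_def)
qed

end

section \<open>Poisson limit from binomial moments\<close>

lemma alternating_binomial_sum:
  "(\<Sum>j\<le>J. (- 1) ^ j * real (Suc z choose j)) = (- 1) ^ J * real (z choose J)"
  by (induction J) (auto simp: algebra_simps)

text \<open>Truncated inclusion-exclusion errs by at most the first omitted term. Factoring out the
  binomial (x choose t) leaves the alternating sum of the row x - t; its partial sums telescope by
  Pascal's rule, and Pascal's rule once more compares the result with the next binomial.\<close>

lemma bonferroni:
  fixes x t J :: nat
  shows "\<bar>of_bool (x = t) - (\<Sum>j\<le>J. (- 1) ^ j * (real (x choose (t + j)) * real ((t + j) choose t)))\<bar>
     \<le> real (x choose (t + Suc J)) * real ((t + Suc J) choose t)"
proof (cases "t \<le> x")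
  case False
  then have z: "x choose (t + j) = 0" for j by (intro binomial_eq_0) auto
  show ?thesis unfolding z using False by simp
next
  case True
  define y where "y = x - t"
  have x: "x = t + y" using True by (simp add: y_def)
  have ch: "real (x choose (t + j)) * real ((t + j) choose t) = real (x choose t) * real (y choose j)" for j
  proof (cases "j \<le> y")
    case True
    then show ?thesis
      using choose_mult[of t "t + j" x] unfolding x by (simp flip: of_nat_mult)
  qed (simp add: x binomial_eq_0)
  have "(\<Sum>j\<le>J. (- 1) ^ j * (real (x choose (t + j)) * real ((t + j) choose t))) = real (x choose t) * (\<Sum>j\<le>J. (- 1) ^ j * real (y choose j))"
    unfolding ch sum_distrib_left by (intro sum.cong) auto
  also have "\<bar>of_bool (x = t) - \<dots>\<bar> \<le> real (x choose t) * real (y choose Suc J)"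
  proof (cases y)
    case 0
    have "(\<Sum>j\<le>J. (- 1) ^ j * real (0 choose j)) = 1"
      by (induction J) auto
    then show ?thesis using 0 by (simp add: x)
  next
    case (Suc z)
    show ?thesis
      unfolding Suc alternating_binomial_sum using Suc
      by (simp add: x abs_mult power_abs distrib_left)
  qed
  finally show ?thesis unfolding ch .
qed

text \<open>Two successive limits: for fixed J, letting n grow confines the probability
  asymptotically to S' J plus or minus R' J; then J grows, and the terms lam^J / J! of the
  exponential series make the error vanish.\<close>

lemma poisson_limit_of_binomial_moments:
  fixes A :: "nat \<Rightarrow> 'a set" and X :: "nat \<Rightarrow> 'a \<Rightarrow> nat"
  assumes fin: "\<And>n. finite (A n)" and ne: "\<forall>\<^sub>F n in sequentially. A n \<noteq> {}"
    and mom: "\<And>t. (\<lambda>n. (\<Sum>a\<in>A n. real (X n a choose t)) / real (card (A n))) \<longlonglongrightarrow> lam ^ t / fact t"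
  shows "(\<lambda>n. real (card {a\<in>A n. X n a = t}) / real (card (A n))) \<longlonglongrightarrow> lam ^ t / fact t * exp (- lam)"
proof -
  define M where "M = (\<lambda>s n. (\<Sum>a\<in>A n. real (X n a choose s)) / real (card (A n)))"
  define p where "p = (\<lambda>n. real (card {a\<in>A n. X n a = t}) / real (card (A n)))"
  define S where "S = (\<lambda>J n. \<Sum>j\<le>J. (- 1) ^ j * (M (t + j) n * real ((t + j) choose t)))"
  define R where "R = (\<lambda>J n. M (t + Suc J) n * real ((t + Suc J) choose t))"
  define S' where "S' = (\<lambda>J. lam ^ t / fact t * (\<Sum>j\<le>J. (- lam) ^ j / fact j))"
  define R' where "R' = (\<lambda>J. lam ^ t / fact t * (lam ^ Suc J / fact (Suc J)))"
  have lim_term: "(\<lambda>n. M (t + j) n * real ((t + j) choose t)) \<longlonglongrightarrow> lam ^ t / fact t * (lam ^ j / fact j)" for j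
  proof -
    have "(\<lambda>n. M (t + j) n * real ((t + j) choose t)) \<longlonglongrightarrow> lam ^ (t + j) / fact (t + j) * real ((t + j) choose t)"
      unfolding M_def by (intro tendsto_intros mom)
    also have "lam ^ (t + j) / fact (t + j) * real ((t + j) choose t) = lam ^ t / fact t * (lam ^ j / fact j)"
      by (simp add: binomial_fact power_add)
    finally show ?thesis .
  qed
  have S: "S J \<longlonglongrightarrow> S' J" for J
  proof -
    have "S J \<longlonglongrightarrow> (\<Sum>j\<le>J. (- 1) ^ j * (lam ^ t / fact t * (lam ^ j / fact j)))"
      unfolding S_def by (intro tendsto_sum tendsto_mult tendsto_const lim_term)
    also have "(\<Sum>j\<le>J. (- 1) ^ j * (lam ^ t / fact t * (lam ^ j / fact j))) = S' J"
      unfolding S'_def sum_distrib_left by (intro sum.cong refl) (simp add: power_minus[of lam])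
    finally show ?thesis .
  qed
  have R: "R J \<longlonglongrightarrow> R' J" for J unfolding R_def R'_def by (rule lim_term)
  have bound: "\<forall>\<^sub>F n in sequentially. \<bar>p n - S J n\<bar> \<le> R J n" for J
    using ne
  proof eventually_elim
    case (elim n)
    have "p n - S J n = (\<Sum>a\<in>A n. of_bool (X n a = t) - (\<Sum>j\<le>J. (- 1) ^ j * (real (X n a choose (t + j)) * real ((t + j) choose t)))) / real (card (A n))"
    proof -
      have "real (card {a\<in>A n. X n a = t}) = (\<Sum>a\<in>A n. of_bool (X n a = t))"
        using fin by (simp add: of_bool_def sum.If_cases Int_def)
      moreover have "S J n = (\<Sum>a\<in>A n. \<Sum>j\<le>J. (- 1) ^ j * (real (X n a choose (t + j)) * real ((t + j) choose t))) / real (card (A n))"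
        unfolding S_def M_def
        by (subst sum.swap) (simp add: sum_distrib_left sum_distrib_right sum_divide_distrib mult_ac)
      ultimately show ?thesis by (simp add: p_def sum_subtractf diff_divide_distrib)
    qed
    also have "\<bar>\<dots>\<bar> \<le> (\<Sum>a\<in>A n. real (X n a choose (t + Suc J)) * real ((t + Suc J) choose t)) / real (card (A n))"
      unfolding abs_divide abs_of_nat
      by (rule divide_right_mono[OF order_trans[OF sum_abs sum_mono[OF bonferroni]] of_nat_0_le_iff])
    also have "\<dots> = R J n" unfolding R_def M_def by (simp add: sum_distrib_right)
    finally show ?case .
  qed
  have "(\<lambda>J. \<Sum>j\<le>J. (- lam) ^ j / fact j) \<longlonglongrightarrow> exp (- lam)"
    using exp_converges[of "- lam"] unfolding sums_def_le by (simp add: divide_inverse mult.commute)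
  then have S'lim: "S' \<longlonglongrightarrow> lam ^ t / fact t * exp (- lam)" unfolding S'_def by (intro tendsto_intros)
  have "(\<lambda>J. lam ^ J / fact J) \<longlonglongrightarrow> 0"
    using summable_LIMSEQ_zero[OF summable_exp[of lam]] by (simp add: divide_inverse mult.commute)
  then have "(\<lambda>J. lam ^ Suc J / fact (Suc J)) \<longlonglongrightarrow> 0" by (rule LIMSEQ_Suc)
  then have R'lim: "R' \<longlonglongrightarrow> 0" unfolding R'_def using tendsto_mult_right_zero by blast
  have "p \<longlonglongrightarrow> lam ^ t / fact t * exp (- lam)"
  proof (rule order_tendstoI)
    fix c assume c: "c < lam ^ t / fact t * exp (- lam)"
    have "(\<lambda>J. S' J - R' J) \<longlonglongrightarrow> lam ^ t / fact t * exp (- lam)" using tendsto_diff[OF S'lim R'lim] by simp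
    \<comment> \<open>J is fixed before n: already the limiting lower bound exceeds c, so the finite
      ones do for all large n.\<close>
    then obtain J where J: "c < S' J - R' J"
      using order_tendstoD(1)[OF _ c] eventually_happens[of _ sequentially] trivial_limit_sequentially by blast
    have "(\<lambda>n. S J n - R J n) \<longlonglongrightarrow> S' J - R' J" by (intro tendsto_diff S R)
    from order_tendstoD(1)[OF this J] bound[of J] show "\<forall>\<^sub>F n in sequentially. c < p n"
      by eventually_elim linarith
  next
    fix c assume c: "lam ^ t / fact t * exp (- lam) < c"
    have "(\<lambda>J. S' J + R' J) \<longlonglongrightarrow> lam ^ t / fact t * exp (- lam)" using tendsto_add[OF S'lim R'lim] by simp
    then obtain J where J: "S' J + R' J < c"
      using order_tendstoD(2)[OF _ c] eventually_happens[of _ sequentially] trivial_limit_sequentially by blast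
    have "(\<lambda>n. S J n + R J n) \<longlonglongrightarrow> S' J + R' J" by (intro tendsto_add S R)
    from order_tendstoD(2)[OF this J] bound[of J] show "\<forall>\<^sub>F n in sequentially. p n < c"
      by eventually_elim linarith
  qed
  then show ?thesis by (simp add: p_def)
qed

lemma fact_mult_choose_eq_prod: "fact t * (x choose t) = (\<Prod>i<t. x - i)"
proof (cases "t \<le> x")
  case True
  then have "(\<Prod>i<t. x - i) * fact (x - t) = fact t * (x choose t) * fact (x - t)"
    using prod_diff_mult_fact[OF True] binomial_fact_lemma[OF True] by (simp add: mult_ac)
  then show ?thesis by simp
next
  case False
  \<comment> \<open>The index i = x occurs among the factors, and its factor x - i is 0.\<close>
  then have "(\<Prod>i<t. x - i) = 0" by (intro prod_zero) auto
  then show ?thesis using False by (simp add: binomial_eq_0)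
qed

section \<open>Limits of the binomial moments of the number of copies\<close>

context degree_regime
begin

lemma avg_add: "avg n (\<lambda>G. X G + Y G) = avg n X + avg n Y"
  by (simp add: avg_def sum.distrib add_divide_distrib)

lemma avg_cmult: "avg n (\<lambda>G. c * X G) = c * avg n X"
  by (simp add: avg_def sum_distrib_left)

lemma avg_sum: "avg n (\<lambda>G. \<Sum>i\<in>I. X i G) = (\<Sum>i\<in>I. avg n (X i))"
  unfolding avg_def by (subst sum.swap) (simp add: sum_divide_distrib)

lemma avg_mono: "(\<And>G. G \<in> graphs n \<Longrightarrow> X G \<le> Y G) \<Longrightarrow> avg n X \<le> avg n Y"
  unfolding avg_def by (intro divide_right_mono sum_mono) auto

lemma avg_cong: "(\<And>G. G \<in> graphs n \<Longrightarrow> X G = Y G) \<Longrightarrow> avg n X = avg n Y"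
  unfolding avg_def by (simp cong: sum.cong)

lemma graphs_facts:
  assumes "G \<in> graphs n"
  shows "G \<in> multigraphs n (m n)" "wf_digraph G" "verts G = {1..n}" "arcs G = {1..m n}"
proof -
  show 1: "G \<in> multigraphs n (m n)" using assms by (simp add: graphs_def multigraphs_deg_in_def)
  show "wf_digraph G" "verts G = {1..n}" "arcs G = {1..m n}" by (rule multigraphs_wf[OF 1])+
qed

lemma inverse_ratio_lim: "(\<lambda>n. real n / (2 * real (m n))) \<longlonglongrightarrow> 1 / L"
  using tendsto_divide[OF tendsto_const[of 1] ratio_lim] L_pos by simp

lemma m_ge_1: "\<forall>\<^sub>F n in sequentially. 1 \<le> m n"
  using m_lim unfolding filterlim_at_top by blast

text \<open>Compared with (n / (2m))^v there is an extra factor 1/2 per edge. It is offset later by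
  the two possible orientations of each edge.\<close>

lemma weight_lim_unicyclic:
  "(\<lambda>n. real n ^ v * real (m n) ^ v / (2 * real (m n)) ^ (2 * v)) \<longlonglongrightarrow> (1 / (2 * L)) ^ v"
proof -
  have "(\<lambda>n. (real n / (2 * real (m n)) * (1 / 2)) ^ v) \<longlonglongrightarrow> (1 / L * (1 / 2)) ^ v"
    by (intro tendsto_intros inverse_ratio_lim)
  then have "(\<lambda>n. (real n / (2 * real (m n)) * (1 / 2)) ^ v) \<longlonglongrightarrow> (1 / (2 * L)) ^ v" by (simp add: mult.commute)
  moreover have "\<forall>\<^sub>F n in sequentially. (real n / (2 * real (m n)) * (1 / 2)) ^ v = real n ^ v * real (m n) ^ v / (2 * real (m n)) ^ (2 * v)"
    using m_ge_1
  proof eventually_elim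
    case (elim n)
    have "real n / (2 * real (m n)) * (1 / 2) = real n * real (m n) / (2 * real (m n))\<^sup>2"
      using elim by (simp add: power2_eq_square)
    then show ?case by (simp add: power_divide power_mult power_mult_distrib)
  qed
  ultimately show ?thesis by (rule Lim_transform_eventually)
qed

text \<open>Each surplus edge multiplies a convergent weight by m / (2m)^2 = 1 / (4m).\<close>

lemma weight_lim_dense:
  assumes "v < e"
  shows "(\<lambda>n. real n ^ v * real (m n) ^ e / (2 * real (m n)) ^ (2 * e)) \<longlonglongrightarrow> 0"
proof -
  obtain d where e: "e = v + Suc d" using less_imp_Suc_add[OF assms] by auto
  have inv: "(\<lambda>n. 1 / real (m n)) \<longlonglongrightarrow> 0"
    using filterlim_compose[OF lim_inverse_n m_lim] by (simp add: divide_inverse)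
  have "(\<lambda>n. (real n ^ v * real (m n) ^ v / (2 * real (m n)) ^ (2 * v)) * (1 / real (m n) * (1 / 4)) ^ Suc d) \<longlonglongrightarrow> (1 / (2 * L)) ^ v * (0 * (1 / 4)) ^ Suc d"
    by (intro tendsto_intros weight_lim_unicyclic inv)
  then have "(\<lambda>n. (real n ^ v * real (m n) ^ v / (2 * real (m n)) ^ (2 * v)) * (1 / real (m n) * (1 / 4)) ^ Suc d) \<longlonglongrightarrow> 0" by simp
  moreover have "\<forall>\<^sub>F n in sequentially. (real n ^ v * real (m n) ^ v / (2 * real (m n)) ^ (2 * v)) * (1 / real (m n) * (1 / 4)) ^ Suc d = real n ^ v * real (m n) ^ e / (2 * real (m n)) ^ (2 * e)"
    using m_ge_1
  proof eventually_elim
    case (elim n)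
    have "1 / real (m n) * (1 / 4) = real (m n) / (2 * real (m n))\<^sup>2"
      using elim by (simp add: power2_eq_square)
    then have "(1 / real (m n) * (1 / 4)) ^ Suc d = real (m n) ^ Suc d / (2 * real (m n)) ^ (2 * Suc d)"
      by (simp only: power_divide power_mult)
    then show ?case by (simp only: e power_add distrib_left times_divide_times_eq mult.assoc)
  qed
  ultimately show ?thesis by (rule Lim_transform_eventually)
qed

lemma avg_dense_pairs: "(\<lambda>n. avg n (\<lambda>G. real (card (dense_pairs b G)))) \<longlonglongrightarrow> 0"
proof (rule tendsto_sandwich)
  show "\<forall>\<^sub>F n in sequentially. 0 \<le> avg n (\<lambda>G. real (card (dense_pairs b G)))"
    by (auto simp: avg_def intro!: always_eventually divide_nonneg_nonneg sum_nonneg)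
  show "\<forall>\<^sub>F n in sequentially. avg n (\<lambda>G. real (card (dense_pairs b G))) \<le>
      (\<Sum>J\<in>dense_shapes b. avg n (\<lambda>G. real (card {q \<in> embeddings J n (m n). realizes G J q})))"
    unfolding avg_sum[symmetric] of_nat_sum[symmetric]
    by (intro always_eventually allI avg_mono of_nat_mono card_dense_pairs_le graphs_facts)
  have "(\<lambda>n. avg n (\<lambda>G. real (card {q \<in> embeddings J n (m n). realizes G J q}))) \<longlonglongrightarrow> 0" if J: "J \<in> dense_shapes b" for J
  proof -
    obtain v e where ve: "v < e" "J \<in> multigraphs v e" using J unfolding dense_shapes_def by blast
    note J' = multigraphs_wf[OF ve(2)]
    show ?thesis using avg_realizations[OF J'(1), of 0] weight_lim_dense[OF ve(1)] J' by simp
  qed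
  then show "(\<lambda>n. \<Sum>J\<in>dense_shapes b. avg n (\<lambda>G. real (card {q \<in> embeddings J n (m n). realizes G J q}))) \<longlonglongrightarrow> 0"
    by (rule tendsto_null_sum)
qed simp

text \<open>Disjoint tuples, multiplied by the t-th power of the number of automorphisms, are
  realized placements summed over all reversal sets and have a known average. Overlapping tuples are
  dominated by dense pairs and vanish in the mean.\<close>

lemma binomial_moment_limit:
  fixes F :: "('a, 'b) pre_digraph"
  assumes F: "balanced_unicyclic F" and a: "0 < card (automorphism_triples F)"
  shows "(\<lambda>n. avg n (\<lambda>G. real (subgraph_count F G choose t))) \<longlonglongrightarrow>
    (1 / real (card (automorphism_triples F)) * (1 / L) ^ card (verts F) * (x0 ^ (2 * card (verts F)) / Delta D x0 ^ card (verts F))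
      * (\<Prod>v\<in>verts F. Delta {d. d + vdeg F v \<in> D} x0)) ^ t / fact t"
proof -
  interpret F: balanced_unicyclic F by (rule F)
  define k where "k = card (verts F)"
  define a where "a = real (card (automorphism_triples F))"
  define P where "P = (\<Prod>v\<in>verts F. Delta {d. d + vdeg F v \<in> D} x0)"
  have a0: "a > 0" using a by (simp add: a_def)
  let ?Y = "\<lambda>G. real (card (F.disjoint_copy_tuples t G))"
  let ?B = "\<lambda>G. real (card (F.copy_tuples t G - F.disjoint_copy_tuples t G))"
  \<comment> \<open>t! times the binomial coefficient counts ordered tuples of distinct copies;
    split them by whether the vertex sets are pairwise disjoint.\<close>
  have count: "fact t * real (subgraph_count F G choose t) = ?Y G + ?B G" if G: "G \<in> graphs n" for G n
  proof -
    have fin: "finite (copies F G)" using graphs_facts[OF G] by (intro finite_copies) auto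
    have finT: "finite (F.copy_tuples t G)"
      by (rule finite_subset[of _ "{..<t} \<rightarrow>\<^sub>E copies F G"]) (use fin in \<open>auto simp: F.copy_tuples_def intro!: finite_PiE\<close>)
    have "fact t * (subgraph_count F G choose t) = card (F.copy_tuples t G)"
      unfolding fact_mult_choose_eq_prod F.copy_tuples_def using card_inj_PiE[OF _ fin, of "{..<t}"]
      by (simp add: subgraph_count_def copies_def)
    also have "\<dots> = card (F.disjoint_copy_tuples t G) + card (F.copy_tuples t G - F.disjoint_copy_tuples t G)"
      using F.disjoint_copy_tuples_subset finT by (metis card_Diff_subset card_mono finite_subset le_add_diff_inverse)
    finally show ?thesis by (metis of_nat_add of_nat_fact of_nat_mult)
  qed
  have Y_eq: "a ^ t * ?Y G = (\<Sum>R\<in>Pow ({..<t} \<times> arcs F). real (card {q \<in> embeddings (F.blowup t R) n (m n). realizes G (F.blowup t R) q}))"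
    if G: "G \<in> graphs n" for G n
    using F.card_disjoint_copy_tuples[of G t] F.card_triple_tuples[of G n "m n" t] graphs_facts[OF G]
    by (simp add: a_def mult.commute flip: of_nat_mult of_nat_power of_nat_sum)
  have emb_lim: "(\<lambda>n. avg n (\<lambda>G. real (card {q \<in> embeddings (F.blowup t R) n (m n). realizes G (F.blowup t R) q}))) \<longlonglongrightarrow>
     (1 / (2 * L)) ^ (t * k) * (x0 ^ (2 * (t * k)) * P ^ t / Delta D x0 ^ (t * k))" for R
  proof -
    have "(\<Prod>v\<in>{..<t} \<times> verts F. Delta {d. d + vdeg (F.blowup t R) v \<in> D} x0) = (\<Prod>i<t. P)"
      unfolding P_def prod.cartesian_product by (intro prod.cong) (auto simp: F.vdeg_blowup)
    then show ?thesis
      using avg_realizations[OF F.blowup_wf, of t R "(1 / (2 * L)) ^ (t * k)"] weight_lim_unicyclic[of "t * k"] F.F_finite F.F_eq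
      by (simp add: card_cartesian_product k_def)
  qed
  have "(\<lambda>n. \<Sum>R\<in>Pow ({..<t} \<times> arcs F). avg n (\<lambda>G. real (card {q \<in> embeddings (F.blowup t R) n (m n). realizes G (F.blowup t R) q})))
     \<longlonglongrightarrow> (\<Sum>R\<in>Pow ({..<t} \<times> arcs F). (1 / (2 * L)) ^ (t * k) * (x0 ^ (2 * (t * k)) * P ^ t / Delta D x0 ^ (t * k)))"
    by (intro tendsto_sum emb_lim)
  moreover have "(\<Sum>R\<in>Pow ({..<t} \<times> arcs F). avg n (\<lambda>G. real (card {q \<in> embeddings (F.blowup t R) n (m n). realizes G (F.blowup t R) q}))) = a ^ t * avg n ?Y" for n
    unfolding avg_sum[symmetric] avg_cmult[symmetric] by (rule avg_cong) (simp add: Y_eq)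
  ultimately have "(\<lambda>n. a ^ t * avg n ?Y / a ^ t) \<longlonglongrightarrow> (\<Sum>R\<in>Pow ({..<t} \<times> arcs F). (1 / (2 * L)) ^ (t * k) * (x0 ^ (2 * (t * k)) * P ^ t / Delta D x0 ^ (t * k))) / a ^ t"
    using a0 by (intro tendsto_divide) auto
  moreover have "card (Pow ({..<t} \<times> arcs F)) = 2 ^ (t * k)"
    using F.F_finite F.F_eq by (simp add: card_Pow card_cartesian_product k_def)
  ultimately have Y: "(\<lambda>n. avg n ?Y) \<longlonglongrightarrow> 2 ^ (t * k) * ((1 / (2 * L)) ^ (t * k) * (x0 ^ (2 * (t * k)) * P ^ t / Delta D x0 ^ (t * k))) / a ^ t"
    using a0 by simp
  \<comment> \<open>The 2^(t k) reversal sets cancel the factor 1/2 per edge of the weight.\<close>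
  have eq: "2 ^ (t * k) * ((1 / (2 * L)) ^ (t * k) * (x0 ^ (2 * (t * k)) * P ^ t / Delta D x0 ^ (t * k))) / a ^ t
     = (1 / a * (1 / L) ^ k * (x0 ^ (2 * k) / Delta D x0 ^ k) * P) ^ t"
    by (simp add: power_mult_distrib power_divide power_mult[symmetric] mult_ac)
  have B: "(\<lambda>n. avg n ?B) \<longlonglongrightarrow> 0"
  proof (rule tendsto_sandwich)
    show "\<forall>\<^sub>F n in sequentially. 0 \<le> avg n ?B"
      by (auto simp: avg_def intro!: always_eventually divide_nonneg_nonneg sum_nonneg)
    show "\<forall>\<^sub>F n in sequentially. avg n ?B \<le> real ((2 ^ (2 * t * k)) ^ t) * avg n (\<lambda>G. real (card (dense_pairs (t * k) G)))"
    proof (intro always_eventually allI)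
      fix n
      show "avg n ?B \<le> real ((2 ^ (2 * t * k)) ^ t) * avg n (\<lambda>G. real (card (dense_pairs (t * k) G)))"
        unfolding avg_cmult[symmetric] of_nat_mult[symmetric]
      proof (intro avg_mono of_nat_mono)
        fix G assume "G \<in> graphs n"
        then show "card (F.copy_tuples t G - F.disjoint_copy_tuples t G) \<le> (2 ^ (2 * t * k)) ^ t * card (dense_pairs (t * k) G)"
          using F.card_overlapping_tuples_le[of G t] graphs_facts[of G n] by (simp add: k_def mult.commute)
      qed
    qed
    show "(\<lambda>n. real ((2 ^ (2 * t * k)) ^ t) * avg n (\<lambda>G. real (card (dense_pairs (t * k) G)))) \<longlonglongrightarrow> 0"
      using tendsto_mult[OF tendsto_const avg_dense_pairs] by simp
  qed simp
  have "(\<lambda>n. (avg n ?Y + avg n ?B) / fact t) \<longlonglongrightarrow> ((1 / a * (1 / L) ^ k * (x0 ^ (2 * k) / Delta D x0 ^ k) * P) ^ t + 0) / fact t"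
    using Y B unfolding eq by (intro tendsto_intros) auto
  moreover have "(avg n ?Y + avg n ?B) / fact t = avg n (\<lambda>G. real (subgraph_count F G choose t))" for n
  proof -
    have "fact t * avg n (\<lambda>G. real (subgraph_count F G choose t)) = avg n ?Y + avg n ?B"
      unfolding avg_cmult[symmetric] avg_add[symmetric] by (rule avg_cong) (rule count)
    then show ?thesis by (simp add: field_simps)
  qed
  ultimately show ?thesis by (simp add: a_def k_def P_def)
qed

end

section \<open>Equality of k and l, and the Poisson law\<close>

lemma power_quotient_limit_pos:
  assumes "(\<lambda>n. real n ^ k / real n ^ l) \<longlonglongrightarrow> s" "0 < s"
  shows "k = l"
proof (cases k l rule: linorder_cases)
  case less
  have "\<forall>\<^sub>F n in sequentially. real n ^ k / real n ^ l \<le> 1 / real n"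
    using eventually_gt_at_top[of 0]
  proof eventually_elim
    case (elim n)
    have "real n ^ Suc k \<le> real n ^ l" using less elim by (intro power_increasing) auto
    then show ?case using elim by (simp add: field_simps)
  qed
  moreover have "(\<lambda>n. 1 / real n) \<longlonglongrightarrow> 0" by real_asymp
  ultimately have "s \<le> 0" using tendsto_le[OF trivial_limit_sequentially _ assms(1)] by blast
  then show ?thesis using assms(2) by simp
next
  case greater
  have "\<forall>\<^sub>F n in sequentially. real n \<le> real n ^ k / real n ^ l"
    using eventually_gt_at_top[of 0]
  proof eventually_elim
    case (elim n)
    have "real n ^ Suc l \<le> real n ^ k" using greater elim by (intro power_increasing) auto
    then show ?case using elim by (simp add: field_simps)
  qed
  then have "filterlim (\<lambda>n. real n ^ k / real n ^ l) at_top sequentially"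
    by (rule filterlim_at_top_mono[OF filterlim_real_sequentially])
  then show ?thesis
    using not_tendsto_and_filterlim_at_infinity[OF trivial_limit_sequentially assms(1)] filterlim_at_top_imp_at_infinity by blast
qed simp

theorem theorem5:
  fixes D :: "nat set" and m :: "nat \<Rightarrow> nat" and L lam :: real
    and F :: "(nat, nat) pre_digraph" and k l :: nat
  assumes D_two: "\<exists>a\<in>D. \<exists>b\<in>D. a \<noteq> b"
    and D_gcd: "Gcd ((\<lambda>d. d - Inf D) ` D) = 1"
    and m_lim: "filterlim m at_top sequentially"
    and ratio_lim: "(\<lambda>n. 2 * real (m n) / real n) \<longlonglongrightarrow> L"
    and L_gt: "real (Inf D) < L"
    and L_lt: "ereal L < (SUP d\<in>D. ereal (real d))"
    and F_multigraph: "F \<in> multigraphs k l"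
    and F_balanced: "strictly_balanced F"
    and expr_lim: "(\<lambda>n. let x = chi D (real (m n) / real n) in
            1 / real (card (automorphism_triples F)) *
            (real n ^ k / (2 * real (m n)) ^ l) *
            (x ^ (2 * l) / Delta D x ^ k) *
            (\<Prod>v\<in>verts F. (deriv ^^ vdeg F v) (Delta D) x)) \<longlonglongrightarrow> lam"
    and lam_pos: "0 < lam"
  shows "\<forall>t. (\<lambda>n. measure_pmf.prob (pmf_of_set (multigraphs_deg_in n (m n) D))
                    {G. subgraph_count F G = t}) \<longlonglongrightarrow> lam ^ t / fact t * exp (- lam)"
proof -
  interpret degree_regime D m L
    by (rule degree_regime.intro) (fact D_two D_gcd m_lim ratio_lim L_gt L_lt)+
  note F' = multigraphs_wf[OF F_multigraph]
  define a where "a = real (card (automorphism_triples F))"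
  define P where "P = (\<lambda>y. \<Prod>v\<in>verts F. Delta {d. d + vdeg F v \<in> D} y)"
  define c where "c = (\<lambda>y. 1 / a * (y ^ (2 * l) / Delta D y ^ k) * P y)"
  have expr: "(\<lambda>n. c (x n) * (real n ^ k / (2 * real (m n)) ^ l)) \<longlonglongrightarrow> lam"
    using expr_lim by (simp add: Let_def higher_deriv_Delta c_def P_def a_def x_def mult_ac)
  \<comment> \<open>Division by zero yields zero, so a = 0 would make the whole expression vanish;
    the positive limit excludes this.\<close>
  have a_pos: "a > 0"
  proof (rule ccontr)
    assume "\<not> a > 0"
    then have "a = 0" by (simp add: a_def)
    then have "c y = 0" for y by (simp add: c_def)
    then show False using expr lam_pos LIMSEQ_unique[OF expr, of 0] by simp
  qed
  \<comment> \<open>If no element of D reached the degree of v, the corresponding derivative would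
    be identically zero, again contradicting the positive limit.\<close>
  have "{d. d + vdeg F v \<in> D} \<noteq> {}" if v: "v \<in> verts F" for v
  proof
    assume e: "{d. d + vdeg F v \<in> D} = {}"
    have "\<exists>v\<in>verts F. Delta {d. d + vdeg F v \<in> D} y = 0" for y
      using v by (intro bexI[of _ v]) (simp only: e Delta_empty)
    then have "c y = 0" for y using F' by (simp add: c_def P_def)
    then show False using expr lam_pos LIMSEQ_unique[OF expr, of 0] by simp
  qed
  then have P_pos: "P x0 > 0" unfolding P_def by (intro prod_pos Delta_pos x0_pos) auto
  have c_pos: "c x0 > 0" using a_pos P_pos Delta_x0_pos x0_pos by (simp add: c_def)
  have c_lim: "(\<lambda>n. c (x n)) \<longlonglongrightarrow> c x0"
    unfolding c_def P_def using Delta_x0_pos by (intro tendsto_intros x_tendsto tendsto_Delta) auto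
  \<comment> \<open>Dividing by the convergent factor c (x n) and compensating the power of 2 m / n
    leaves n^k / n^l with a positive finite limit, which forces k = l.\<close>
  have "(\<lambda>n. c (x n) * (real n ^ k / (2 * real (m n)) ^ l) / c (x n) * (2 * real (m n) / real n) ^ l) \<longlonglongrightarrow> lam / c x0 * L ^ l"
    using c_pos by (intro tendsto_intros expr c_lim ratio_lim) auto
  moreover have "\<forall>\<^sub>F n in sequentially. c (x n) * (real n ^ k / (2 * real (m n)) ^ l) / c (x n) * (2 * real (m n) / real n) ^ l = real n ^ k / real n ^ l"
    using order_tendstoD(1)[OF c_lim c_pos] m_ge_1 by eventually_elim (simp add: power_divide)
  ultimately have "(\<lambda>n. real n ^ k / real n ^ l) \<longlonglongrightarrow> lam / c x0 * L ^ l" by (rule Lim_transform_eventually)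
  then have kl: "k = l" using lam_pos c_pos L_pos by (elim power_quotient_limit_pos) simp
  have "(\<lambda>n. c (x n) * (real n / (2 * real (m n))) ^ k) \<longlonglongrightarrow> c x0 * (1 / L) ^ k"
    by (intro tendsto_intros c_lim inverse_ratio_lim)
  \<comment> \<open>With k = l both sequences coincide, so the limit lam is the closed form in which
    the binomial moments were computed.\<close>
  then have lam: "lam = c x0 * (1 / L) ^ k"
    using expr unfolding kl power_divide by (rule LIMSEQ_unique[rotated])
  have F_loc: "balanced_unicyclic F" by unfold_locales (use F' F_balanced kl in \<open>auto simp: wf_digraph.tail_in_verts wf_digraph.head_in_verts\<close>)
  have "(\<lambda>n. avg n (\<lambda>G. real (subgraph_count F G choose t))) \<longlonglongrightarrow> lam ^ t / fact t" for t
    using binomial_moment_limit[OF F_loc, of t] a_pos F' kl by (simp add: lam c_def P_def a_def mult_ac)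
  then have lim: "(\<lambda>n. real (card {G\<in>graphs n. subgraph_count F G = t}) / real (card (graphs n))) \<longlonglongrightarrow> lam ^ t / fact t * exp (- lam)" for t
    using finite_graphs graphs_nonempty
    by (intro poisson_limit_of_binomial_moments[where X = "\<lambda>n. subgraph_count F"]) (auto simp: avg_def)
  have ev: "\<forall>\<^sub>F n in sequentially. real (card {G\<in>graphs n. subgraph_count F G = t}) / real (card (graphs n)) =
     measure_pmf.prob (pmf_of_set (multigraphs_deg_in n (m n) D)) {G. subgraph_count F G = t}" for t
    using graphs_nonempty
  proof eventually_elim
    case (elim n)
    have "graphs n \<inter> {G. subgraph_count F G = t} = {G\<in>graphs n. subgraph_count F G = t}" by auto
    then show ?case using measure_pmf_of_set[OF elim finite_graphs] by (simp add: graphs_def)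
  qed
  show ?thesis by (intro allI Lim_transform_eventually[OF lim ev])
qed

end
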